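(* (i) Let $X$ be a weakly Lindelöf determined (WLD) Banach space with $\mathrm{dens}\, X > \omega_1$. Then $X$ contains a subspace $Y$ with an Auerbach basis and such that $\mathrm{dens}\,Y=\mathrm{dens}\,X$. (ii) Assume the Continuum Hypothesis. Then there exists a norm $|||\cdot|||$ on the real space $c_0(\omega_1)$, equivalent to the canonical one, such that the space $(c_0(\omega_1),|||\cdot|||)$ contains no uncountable Auerbach systems.
   Context: In (i) Banach spaces are over the real or the complex field; in (ii) the scalars are real. Subspaces are closed subspaces. $\mathrm{dens}\,X$ is the density character. A compact space is a Corson compact if it is homeomorphic to a compact subset $C$ of $[-1,1]^\Gamma$ for some set $\Gamma$ such that each element of $C$ has only countably many non-zero coordinates; a Banach space $X$ is WLD if $B_{X^*}$ with the relative $w^*$-topology is a Corson compact. An Auerbach system in a Banach space $X$ is a family $\{x_\gamma;x_\gamma^*\}_{\gamma\in\Gamma}\subseteq X\times X^*$ with $\langle x_\alpha^*,x_\beta\rangle=\delta_{\alpha,\beta}$ and $\|x_\gamma\|=\|x_\gamma^*\|=1$ for all indices. An M-basis of $X$ is a family $\{x_\gamma;x_\gamma^*\}_{\gamma\in\Gamma}\subseteq X\times X^*$ with $\langle x_\alpha^*,x_\beta\rangle=\delta_{\alpha,\beta}$, with $\{x_\gamma\}$ having norm-dense linear span in $X$ and $\{x_\gamma^*\}$ having $w^*$-dense linear span in $X^*$. An Auerbach basis of $X$ is an M-basis of $X$ that is also an Auerbach system. *)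

theory Defs
  imports "HOL-Analysis.Analysis"
begin

unbundle cardinal_syntax

section \<open>Banach spaces over the real or the complex field\<close>

text \<open>
  A type of class \<^class>\<open>banach\<close> is a real Banach space. A Banach space over a larger field
  (the complex numbers) is such a type together with a scalar multiplication that extends the
  given real one and for which the norm is homogeneous.
\<close>

locale banach_space_over = vector_space smul
  for smul :: "'k::real_normed_field \<Rightarrow> 'a::banach \<Rightarrow> 'a" +
  assumes norm_smul: "norm (smul c x) = norm c * norm x"
    and smul_of_real: "smul (of_real r) x = r *\<^sub>R x"

lemma banach_space_over_scaleR:
  "banach_space_over (scaleR :: real \<Rightarrow> 'a::banach \<Rightarrow> 'a)"
  by unfold_locales (auto simp: algebra_simps)

lemma banach_space_over_complex: "banach_space_over ((*) :: complex \<Rightarrow> complex \<Rightarrow> complex)"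
  by unfold_locales (auto simp: algebra_simps norm_mult scaleR_conv_of_real)

definition closed_subspace :: "('k::field \<Rightarrow> 'a::banach \<Rightarrow> 'a) \<Rightarrow> 'a set \<Rightarrow> bool" where
  "closed_subspace smul Y \<longleftrightarrow> module.subspace smul Y \<and> closed Y"


section \<open>Density character\<close>

definition dens :: "'a::topological_space set \<Rightarrow> 'a rel" where
  "dens S = |SOME D. D \<subseteq> S \<and> S \<subseteq> closure D \<and>
                (\<forall>E. E \<subseteq> S \<and> S \<subseteq> closure E \<longrightarrow> |D| \<le>o |E| )|"

lemma dens_attained:
  obtains D where "D \<subseteq> S" "S \<subseteq> closure D" "dens S = |D|"
    and "\<And>E. E \<subseteq> S \<Longrightarrow> S \<subseteq> closure E \<Longrightarrow> dens S \<le>o |E|"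
proof -
  let ?P = "\<lambda>D. D \<subseteq> S \<and> S \<subseteq> closure D"
  have "\<exists>r\<in>card_of ` Collect ?P. \<forall>r'\<in>card_of ` Collect ?P. r \<le>o r'"
    by (intro exists_minim_Card_order) (auto simp: card_of_Card_order intro: exI[of _ S] closure_subset[THEN subsetD])
  then have "\<exists>D. D \<subseteq> S \<and> S \<subseteq> closure D \<and> (\<forall>E. E \<subseteq> S \<and> S \<subseteq> closure E \<longrightarrow> |D| \<le>o |E| )"
    by auto
  from someI_ex[OF this] show thesis
    by (intro that[of "SOME D. D \<subseteq> S \<and> S \<subseteq> closure D \<and>
      (\<forall>E. E \<subseteq> S \<and> S \<subseteq> closure E \<longrightarrow> |D| \<le>o |E| )"]) (auto simp: dens_def)
qed


section \<open>Dual spaces\<close>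

text \<open>
  Throughout, \<open>V\<close> is a linear subspace of the ambient type and \<open>N\<close> is a norm on it, which need
  not be the \<^const>\<open>norm\<close> of the ambient type. Functionals on \<open>V\<close> are \<^const>\<open>extensional\<close>, so that
  two of them are equal as soon as they agree on \<open>V\<close>.
\<close>

definition dual_space ::
  "('k::real_normed_field \<Rightarrow> 'a::ab_group_add \<Rightarrow> 'a) \<Rightarrow> ('a \<Rightarrow> real) \<Rightarrow> 'a set \<Rightarrow> ('a \<Rightarrow> 'k) set"
  where
  "dual_space smul N V =
     {f \<in> extensional V.
        (\<forall>x\<in>V. \<forall>y\<in>V. f (x + y) = f x + f y) \<and>
        (\<forall>c. \<forall>x\<in>V. f (smul c x) = c * f x) \<and>
        (\<exists>B. \<forall>x\<in>V. norm (f x) \<le> B * N x)}"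

definition dual_norm ::
  "('a \<Rightarrow> real) \<Rightarrow> 'a set \<Rightarrow> ('a \<Rightarrow> 'k::real_normed_field) \<Rightarrow> real"
  where
  "dual_norm N V f = (SUP x\<in>{x \<in> V. N x \<le> 1}. norm (f x))"

definition weak_star_topology ::
  "('k::real_normed_field \<Rightarrow> 'a::ab_group_add \<Rightarrow> 'a) \<Rightarrow> ('a \<Rightarrow> real) \<Rightarrow> 'a set \<Rightarrow> ('a \<Rightarrow> 'k) topology"
  where
  "weak_star_topology smul N V =
     subtopology (product_topology (\<lambda>_. euclidean) V) (dual_space smul N V)"

definition functional_span ::
  "'a set \<Rightarrow> ('a \<Rightarrow> 'k::real_normed_field) set \<Rightarrow> ('a \<Rightarrow> 'k) set"
  where
  "functional_span V G =
     {(\<lambda>x\<in>V. \<Sum>g\<in>F. c g * g x) | F c. finite F \<and> F \<subseteq> G}"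


section \<open>Corson compacta and WLD Banach spaces\<close>

abbreviation cube :: "'g set \<Rightarrow> ('g \<Rightarrow> real) topology" where
  "cube \<Gamma> \<equiv> product_topology (\<lambda>_. top_of_set {-1..1}) \<Gamma>"

text \<open>
  The set \<open>\<Gamma>\<close> is looked for inside the type of the points of \<open>T\<close>. This is no restriction: by
  \<open>corson_compactI\<close> below, an index set of any type can be replaced by one of this type.
\<close>

definition corson_compact :: "'t topology \<Rightarrow> bool" where
  "corson_compact T \<longleftrightarrow>
     (\<exists>(\<Gamma> :: 't set) C. compactin (cube \<Gamma>) C \<and>
        (\<forall>c\<in>C. countable {\<gamma>\<in>\<Gamma>. c \<gamma> \<noteq> 0}) \<and>
        T homeomorphic_space subtopology (cube \<Gamma>) C)"

lemma corson_compact_transfer: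
  fixes T :: "'t topology" and \<Gamma>' :: "'t set"
  assumes C: "compactin (cube \<Gamma>) C" and T: "T homeomorphic_space subtopology (cube \<Gamma>) C"
    and g: "continuous_map (subtopology (cube \<Gamma>) C) (cube \<Gamma>') g" "inj_on g C"
    and supp: "\<And>c. c \<in> C \<Longrightarrow> countable {\<gamma>\<in>\<Gamma>'. g c \<gamma> \<noteq> 0}"
  shows "corson_compact T"
proof -
  have CT: "topspace (subtopology (cube \<Gamma>) C) = C"
    using compactin_subset_topspace[OF C] by auto
  have cpt: "compact_space (subtopology (cube \<Gamma>) C)"
    using C compact_space_subtopology by blast
  have C': "compactin (cube \<Gamma>') (g ` C)"
    using image_compactin[OF _ g(1), of C] cpt CT unfolding compact_space_def by metis
  have C'T: "topspace (subtopology (cube \<Gamma>') (g ` C)) = g ` C"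
    using compactin_subset_topspace[OF C'] by auto
  have "homeomorphic_map (subtopology (cube \<Gamma>) C) (subtopology (cube \<Gamma>') (g ` C)) g"
  proof (rule continuous_imp_homeomorphic_map)
    show "Hausdorff_space (subtopology (cube \<Gamma>') (g ` C))"
      by (intro Hausdorff_space_subtopology) (simp add: Hausdorff_space_product_topology Hausdorff_space_subtopology)
    show "continuous_map (subtopology (cube \<Gamma>) C) (subtopology (cube \<Gamma>') (g ` C)) g"
      using g(1) CT by (auto simp: continuous_map_in_subtopology)
  qed (use cpt CT C'T g(2) in auto)
  then have "T homeomorphic_space subtopology (cube \<Gamma>') (g ` C)"
    using T homeomorphic_map_imp_homeomorphic_space homeomorphic_space_trans by blast
  then show ?thesis
    unfolding corson_compact_def using C' supp by blast
qed

lemma corson_compactI: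
  fixes T :: "'t topology" and \<Gamma> :: "'g set"
  assumes C: "compactin (cube \<Gamma>) C" and supp: "\<forall>c\<in>C. countable {\<gamma>\<in>\<Gamma>. c \<gamma> \<noteq> 0}"
    and T: "T homeomorphic_space subtopology (cube \<Gamma>) C"
  shows "corson_compact T"
proof -
  have Csub: "C \<subseteq> topspace (cube \<Gamma>)"
    using C compactin_subset_topspace by blast
  then have CT: "topspace (subtopology (cube \<Gamma>) C) = C"
    by auto
  obtain h where "homeomorphic_map T (subtopology (cube \<Gamma>) C) h"
    using T homeomorphic_space by blast
  then have h: "bij_betw h (topspace T) C"
    using CT by (metis bij_betw_def homeomorphic_imp_surjective_map homeomorphic_imp_injective_map)
  show ?thesis
  proof (cases "finite C")
    case True
    define g where "g c = (\<lambda>t\<in>{undefined::'t}. 1 / (1 + real (to_nat_on C c)))" for c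
    have "Hausdorff_space (subtopology (cube \<Gamma>) C)"
      by (intro Hausdorff_space_subtopology) (simp add: Hausdorff_space_product_topology Hausdorff_space_subtopology)
    then have "subtopology (cube \<Gamma>) C = discrete_topology C"
      using True CT finite_t1_space_imp_discrete_topology Hausdorff_imp_t1_space by metis
    moreover have "g c \<in> topspace (cube {undefined})" for c
      by (auto simp: g_def field_simps)
    ultimately have 1: "continuous_map (subtopology (cube \<Gamma>) C) (cube {undefined}) g"
      by simp
    have 2: "inj_on g C"
    proof (rule inj_onI)
      fix a b assume ab: "a \<in> C" "b \<in> C" "g a = g b"
      then have "g a undefined = g b undefined"
        by simp
      then have "to_nat_on C a = to_nat_on C b"
        by (simp add: g_def)
      then show "a = b"
        using ab True by (simp add: countable_finite)
    qed
    have "countable {\<gamma> \<in> {undefined}. g c \<gamma> \<noteq> 0}" for c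
      by (rule countable_subset[of _ "{undefined}"]) auto
    then show ?thesis
      using corson_compact_transfer[OF C T 1 2] by blast
  next
    case False
    define \<Gamma>0 where "\<Gamma>0 = (\<Union>c\<in>C. {\<gamma>\<in>\<Gamma>. c \<gamma> \<noteq> 0})"
    have "|\<Gamma>0| \<le>o |C|"
      unfolding \<Gamma>0_def
    proof (rule card_of_UNION_ordLeq_infinite[OF False])
      show "\<forall>c\<in>C. |{\<gamma>\<in>\<Gamma>. c \<gamma> \<noteq> 0}| \<le>o |C|"
      proof
        fix c assume "c \<in> C"
        then obtain n :: "'g \<Rightarrow> nat" where "inj_on n {\<gamma>\<in>\<Gamma>. c \<gamma> \<noteq> 0}"
          using supp unfolding countable_def by blast
        then have "|{\<gamma>\<in>\<Gamma>. c \<gamma> \<noteq> 0}| \<le>o |UNIV :: nat set|"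
          using card_of_ordLeq[of _ "UNIV :: nat set"] by blast
        then show "|{\<gamma>\<in>\<Gamma>. c \<gamma> \<noteq> 0}| \<le>o |C|"
          using False infinite_iff_card_of_nat ordLeq_transitive by blast
      qed
    qed (rule card_of_mono1, rule subset_refl)
    moreover have "|C| =o |topspace T|"
      using h by (metis bij_betw_inv card_of_ordIso)
    ultimately have "|\<Gamma>0| \<le>o |topspace T|"
      using ordLeq_ordIso_trans by blast
    then obtain j where j: "inj_on j \<Gamma>0" "j ` \<Gamma>0 \<subseteq> topspace T"
      using card_of_ordLeq by metis
    define k where "k = inv_into \<Gamma>0 j"
    have k: "k \<gamma> \<in> \<Gamma>" "k \<gamma> \<in> \<Gamma>0" if "\<gamma> \<in> j ` \<Gamma>0" for \<gamma>
    proof -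
      show "k \<gamma> \<in> \<Gamma>0"
        using that unfolding k_def by (rule inv_into_into)
      then show "k \<gamma> \<in> \<Gamma>"
        by (auto simp: \<Gamma>0_def)
    qed
    define g where "g c = (\<lambda>t\<in>j ` \<Gamma>0. c (k t))" for c :: "'g \<Rightarrow> real"
    have 1: "continuous_map (subtopology (cube \<Gamma>) C) (cube (j ` \<Gamma>0)) g"
      unfolding g_def continuous_map_componentwise
    proof (intro conjI ballI)
      fix t assume "t \<in> j ` \<Gamma>0"
      then show "continuous_map (subtopology (cube \<Gamma>) C) (top_of_set {- 1..1})
                   (\<lambda>x. (\<lambda>t\<in>j ` \<Gamma>0. x (k t)) t)"
        using k(1)[of t] continuous_map_product_projection[of "k t" \<Gamma> "\<lambda>_. top_of_set {-1..1::real}"]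
        by (simp add: continuous_map_from_subtopology)
    qed auto
    have 2: "inj_on g C"
    proof (rule inj_onI, rule ext)
      fix a b \<gamma> assume ab: "a \<in> C" "b \<in> C" "g a = g b"
      show "a \<gamma> = b \<gamma>"
      proof (cases "\<gamma> \<in> \<Gamma>0")
        case True
        have "g a (j \<gamma>) = g b (j \<gamma>)"
          using ab by simp
        then show ?thesis
          using True j(1) by (simp add: g_def k_def)
      next
        case nz: False
        show ?thesis
        proof (cases "\<gamma> \<in> \<Gamma>")
          case True
          then have "a \<gamma> = 0" "b \<gamma> = 0"
            using nz ab by (auto simp: \<Gamma>0_def)
          then show ?thesis
            by simp
        next
          case False
          then show ?thesis
            using ab Csub by (metis PiE_arb subsetD topspace_product_topology)
        qed
      qed
    qed
    have "countable {\<gamma> \<in> j ` \<Gamma>0. g c \<gamma> \<noteq> 0}" if "c \<in> C" for c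
    proof (rule countable_subset)
      show "{\<gamma> \<in> j ` \<Gamma>0. g c \<gamma> \<noteq> 0} \<subseteq> j ` {\<gamma>\<in>\<Gamma>. c \<gamma> \<noteq> 0}"
      proof
        fix t assume "t \<in> {\<gamma> \<in> j ` \<Gamma>0. g c \<gamma> \<noteq> 0}"
        then have t: "t \<in> j ` \<Gamma>0" "c (k t) \<noteq> 0"
          by (auto simp: g_def)
        moreover have "t = j (k t)"
          using t(1) by (simp add: k_def f_inv_into_f)
        ultimately show "t \<in> j ` {\<gamma>\<in>\<Gamma>. c \<gamma> \<noteq> 0}"
          using k(1) by blast
      qed
      show "countable (j ` {\<gamma>\<in>\<Gamma>. c \<gamma> \<noteq> 0})"
        using supp that by blast
    qed
    then show ?thesis
      using corson_compact_transfer[OF C T 1 2] by blast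
  qed
qed


text \<open>Weakly Lindeloef determined spaces; the dual unit ball carries the \<open>w\<^sup>*\<close>-topology.\<close>

definition WLD :: "('k::real_normed_field \<Rightarrow> 'a::banach \<Rightarrow> 'a) \<Rightarrow> bool" where
  "WLD smul \<longleftrightarrow>
     corson_compact (subtopology (weak_star_topology smul norm UNIV)
       {f \<in> dual_space smul norm UNIV. dual_norm norm UNIV f \<le> 1})"


section \<open>Auerbach systems, M-bases and Auerbach bases\<close>

definition biorthogonal_system ::
  "('k::real_normed_field \<Rightarrow> 'a::ab_group_add \<Rightarrow> 'a) \<Rightarrow> ('a \<Rightarrow> real) \<Rightarrow> 'a set \<Rightarrow>
   'i set \<Rightarrow> ('i \<Rightarrow> 'a) \<Rightarrow> ('i \<Rightarrow> 'a \<Rightarrow> 'k) \<Rightarrow> bool"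
  where
  "biorthogonal_system smul N V \<Gamma> x f \<longleftrightarrow>
     (\<forall>\<gamma>\<in>\<Gamma>. x \<gamma> \<in> V \<and> f \<gamma> \<in> dual_space smul N V) \<and>
     (\<forall>\<alpha>\<in>\<Gamma>. \<forall>\<beta>\<in>\<Gamma>. f \<alpha> (x \<beta>) = (if \<alpha> = \<beta> then 1 else 0))"

definition auerbach_system ::
  "('k::real_normed_field \<Rightarrow> 'a::ab_group_add \<Rightarrow> 'a) \<Rightarrow> ('a \<Rightarrow> real) \<Rightarrow> 'a set \<Rightarrow>
   'i set \<Rightarrow> ('i \<Rightarrow> 'a) \<Rightarrow> ('i \<Rightarrow> 'a \<Rightarrow> 'k) \<Rightarrow> bool"
  where
  "auerbach_system smul N V \<Gamma> x f \<longleftrightarrow>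
     biorthogonal_system smul N V \<Gamma> x f \<and>
     (\<forall>\<gamma>\<in>\<Gamma>. N (x \<gamma>) = 1 \<and> dual_norm N V (f \<gamma>) = 1)"

definition M_basis ::
  "('k::real_normed_field \<Rightarrow> 'a::banach \<Rightarrow> 'a) \<Rightarrow> 'a set \<Rightarrow>
   'i set \<Rightarrow> ('i \<Rightarrow> 'a) \<Rightarrow> ('i \<Rightarrow> 'a \<Rightarrow> 'k) \<Rightarrow> bool"
  where
  "M_basis smul Y \<Gamma> x f \<longleftrightarrow>
     biorthogonal_system smul norm Y \<Gamma> x f \<and>
     Y \<subseteq> closure (module.span smul (x ` \<Gamma>)) \<and>
     weak_star_topology smul norm Y closure_of functional_span Y (f ` \<Gamma>) = dual_space smul norm Y"

definition auerbach_basis ::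
  "('k::real_normed_field \<Rightarrow> 'a::banach \<Rightarrow> 'a) \<Rightarrow> 'a set \<Rightarrow>
   'i set \<Rightarrow> ('i \<Rightarrow> 'a) \<Rightarrow> ('i \<Rightarrow> 'a \<Rightarrow> 'k) \<Rightarrow> bool"
  where
  "auerbach_basis smul Y \<Gamma> x f \<longleftrightarrow> M_basis smul Y \<Gamma> x f \<and> auerbach_system smul norm Y \<Gamma> x f"

text \<open>
  The vectors of a biorthogonal system are pairwise distinct, so the system may be indexed by the
  set of its vectors. Hence index sets inside the type of the space suffice.
\<close>

lemma biorthogonal_system_inj: "biorthogonal_system smul N V \<Gamma> x f \<Longrightarrow> inj_on x \<Gamma>"
  unfolding biorthogonal_system_def inj_on_def by (metis zero_neq_one)

lemma auerbach_system_reindex: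
  assumes "auerbach_system smul N V \<Gamma> x f"
  shows "auerbach_system smul N V (x ` \<Gamma>) (\<lambda>v. v) (\<lambda>v. f (inv_into \<Gamma> x v))"
    and "countable (x ` \<Gamma>) \<longleftrightarrow> countable \<Gamma>"
proof -
  have inj: "inj_on x \<Gamma>"
    using assms biorthogonal_system_inj by (auto simp: auerbach_system_def)
  then show "auerbach_system smul N V (x ` \<Gamma>) (\<lambda>v. v) (\<lambda>v. f (inv_into \<Gamma> x v))"
    using assms by (auto simp: auerbach_system_def biorthogonal_system_def inj_on_eq_iff)
  show "countable (x ` \<Gamma>) \<longleftrightarrow> countable \<Gamma>"
    using inj countable_image_inj_eq by blast
qed

lemma auerbach_basis_reindex:
  assumes "auerbach_basis smul Y \<Gamma> x f"
  shows "auerbach_basis smul Y (x ` \<Gamma>) (\<lambda>v. v) (\<lambda>v. f (inv_into \<Gamma> x v))"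
proof -
  have "inj_on x \<Gamma>"
    using assms biorthogonal_system_inj by (auto simp: auerbach_basis_def M_basis_def)
  then have "(\<lambda>v. f (inv_into \<Gamma> x v)) ` x ` \<Gamma> = f ` \<Gamma>"
    by (auto simp: image_image cong: image_cong)
  then show ?thesis
    using assms auerbach_system_reindex[of smul norm Y \<Gamma> x f]
    by (auto simp: auerbach_basis_def M_basis_def auerbach_system_def)
qed


section \<open>The space \<open>c\<^sub>0(\<omega>\<^sub>1)\<close> and its equivalent norms\<close>

typedef omega1 = "Field (cardSuc natLeq)"
proof -
  have "cinfinite (cardSuc natLeq)"
    using Cinfinite_cardSuc natLeq_Cinfinite by blast
  then show ?thesis
    unfolding cinfinite_def by (metis all_not_in_conv finite.emptyI)
qed

lemma card_omega1: "|UNIV :: omega1 set| =o cardSuc natLeq"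
proof -
  have "bij_betw Rep_omega1 UNIV (Field (cardSuc natLeq))"
    by (metis bij_betw_def inj_onI Rep_omega1_inject type_definition.Rep_range type_definition_omega1)
  then show ?thesis
    using card_of_ordIso card_of_Field_ordIso[OF cardSuc_Card_order[OF natLeq_Card_order]]
      ordIso_transitive by blast
qed

typedef 'g c0 = "{f :: 'g \<Rightarrow> real. \<forall>e>0. finite {\<gamma>. e \<le> \<bar>f \<gamma>\<bar>}}"
  morphisms apply_c0 Abs_c0
  by (rule exI[of _ "\<lambda>_. 0"]) auto

setup_lifting type_definition_c0

lemma c0_add:
  fixes f g :: "'g \<Rightarrow> real"
  assumes "\<forall>e>0. finite {\<gamma>. e \<le> \<bar>f \<gamma>\<bar>}" "\<forall>e>0. finite {\<gamma>. e \<le> \<bar>g \<gamma>\<bar>}"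
  shows "\<forall>e>0. finite {\<gamma>. e \<le> \<bar>f \<gamma> + g \<gamma>\<bar>}"
proof (intro allI impI)
  fix e :: real assume "e > 0"
  then have "finite ({\<gamma>. e / 2 \<le> \<bar>f \<gamma>\<bar>} \<union> {\<gamma>. e / 2 \<le> \<bar>g \<gamma>\<bar>})"
    using assms[rule_format, of "e / 2"] by simp
  then show "finite {\<gamma>. e \<le> \<bar>f \<gamma> + g \<gamma>\<bar>}"
    by (rule rev_finite_subset) (auto simp: abs_if split: if_splits)
qed

lemma c0_scaleR:
  fixes f :: "'g \<Rightarrow> real"
  assumes "\<forall>e>0. finite {\<gamma>. e \<le> \<bar>f \<gamma>\<bar>}"
  shows "\<forall>e>0. finite {\<gamma>. e \<le> \<bar>r * f \<gamma>\<bar>}"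
proof (cases "r = 0")
  case False
  have "finite {\<gamma>. e / \<bar>r\<bar> \<le> \<bar>f \<gamma>\<bar>}" if "e > 0" for e
    using assms that False by simp
  then show ?thesis
    using False by (simp add: abs_mult field_simps)
qed auto

instantiation c0 :: (type) real_vector
begin

lift_definition zero_c0 :: "'a c0" is "\<lambda>_. 0" by simp
lift_definition plus_c0 :: "'a c0 \<Rightarrow> 'a c0 \<Rightarrow> 'a c0" is "\<lambda>f g \<gamma>. f \<gamma> + g \<gamma>"
  subgoal for f g using c0_add[of f g] by blast
  done
lift_definition uminus_c0 :: "'a c0 \<Rightarrow> 'a c0" is "\<lambda>f \<gamma>. - f \<gamma>" by simp
lift_definition minus_c0 :: "'a c0 \<Rightarrow> 'a c0 \<Rightarrow> 'a c0" is "\<lambda>f g \<gamma>. f \<gamma> - g \<gamma>"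
  subgoal for f g using c0_add[of f "\<lambda>\<gamma>. - g \<gamma>"] by simp
  done
lift_definition scaleR_c0 :: "real \<Rightarrow> 'a c0 \<Rightarrow> 'a c0" is "\<lambda>r f \<gamma>. r * f \<gamma>"
  subgoal for r f using c0_scaleR[of f r] by blast
  done

instance
  by standard (transfer; simp add: algebra_simps fun_eq_iff)+

end

lemma bdd_above_c0: "bdd_above (range (\<lambda>\<gamma>. \<bar>apply_c0 f \<gamma>\<bar>))"
proof -
  have "finite {\<gamma>. 1 \<le> \<bar>apply_c0 f \<gamma>\<bar>}"
    using apply_c0[of f] by auto
  then have "bdd_above ((\<lambda>\<gamma>. \<bar>apply_c0 f \<gamma>\<bar>) ` {\<gamma>. 1 \<le> \<bar>apply_c0 f \<gamma>\<bar>} \<union> {..1})"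
    by auto
  then show ?thesis
    by (rule bdd_above_mono) auto
qed

instantiation c0 :: (type) real_normed_vector
begin

definition norm_c0 :: "'a c0 \<Rightarrow> real" where
  "norm_c0 f = (SUP \<gamma>. \<bar>apply_c0 f \<gamma>\<bar>)"
definition sgn_c0 :: "'a c0 \<Rightarrow> 'a c0" where
  "sgn_c0 f = f /\<^sub>R norm f"
definition dist_c0 :: "'a c0 \<Rightarrow> 'a c0 \<Rightarrow> real" where
  "dist_c0 f g = norm (f - g)"
definition uniformity_c0 :: "('a c0 \<times> 'a c0) filter" where
  "uniformity_c0 = (INF e\<in>{0 <..}. principal {(x, y). dist x y < e})"
definition open_c0 :: "'a c0 set \<Rightarrow> bool" where
  "open_c0 S = (\<forall>x\<in>S. \<forall>\<^sub>F (x', y) in uniformity. x' = x \<longrightarrow> y \<in> S)"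

lemma abs_le_norm_c0: "\<bar>apply_c0 f \<gamma>\<bar> \<le> norm f"
  unfolding norm_c0_def by (intro cSUP_upper bdd_above_c0) simp

lemma norm_c0_le: "(\<And>\<gamma>. \<bar>apply_c0 f \<gamma>\<bar> \<le> B) \<Longrightarrow> norm f \<le> B"
  unfolding norm_c0_def by (intro cSUP_least) auto

instance
proof
  fix f g :: "'a c0" and r :: real
  show "norm f = 0 \<longleftrightarrow> f = 0"
  proof
    assume "norm f = 0"
    then have "apply_c0 f \<gamma> = 0" for \<gamma>
      using abs_le_norm_c0[of f \<gamma>] by simp
    then show "f = 0"
      by transfer auto
  next
    assume "f = 0"
    then show "norm f = 0"
      by (simp add: norm_c0_def zero_c0.rep_eq)
  qed
  show "norm (f + g) \<le> norm f + norm g"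
  proof (rule norm_c0_le)
    fix \<gamma>
    show "\<bar>apply_c0 (f + g) \<gamma>\<bar> \<le> norm f + norm g"
      using abs_le_norm_c0[of f \<gamma>] abs_le_norm_c0[of g \<gamma>] by (simp add: plus_c0.rep_eq)
  qed
  show "norm (r *\<^sub>R f) = \<bar>r\<bar> * norm f"
  proof (rule antisym)
    show "norm (r *\<^sub>R f) \<le> \<bar>r\<bar> * norm f"
      by (rule norm_c0_le) (simp add: scaleR_c0.rep_eq abs_mult abs_le_norm_c0 mult_left_mono)
    show "\<bar>r\<bar> * norm f \<le> norm (r *\<^sub>R f)"
    proof (cases "r = 0")
      case True
      then show ?thesis
        using abs_le_norm_c0[of "r *\<^sub>R f" undefined] by simp
    next
      case False
      have "norm f \<le> norm (r *\<^sub>R f) / \<bar>r\<bar>"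
      proof (rule norm_c0_le)
        fix \<gamma>
        show "\<bar>apply_c0 f \<gamma>\<bar> \<le> norm (r *\<^sub>R f) / \<bar>r\<bar>"
          using abs_le_norm_c0[of "r *\<^sub>R f" \<gamma>] False
          by (simp add: scaleR_c0.rep_eq abs_mult field_simps)
      qed
      then show ?thesis
        using False by (simp add: field_simps)
    qed
  qed
qed (rule sgn_c0_def dist_c0_def uniformity_c0_def open_c0_def)+

end

instance c0 :: (type) banach
proof
  fix X :: "nat \<Rightarrow> 'a c0"
  assume X: "Cauchy X"
  have ptw: "\<bar>apply_c0 (X m) \<gamma> - apply_c0 (X n) \<gamma>\<bar> \<le> norm (X m - X n)" for m n \<gamma>
    using abs_le_norm_c0[of "X m - X n" \<gamma>] by (simp add: minus_c0.rep_eq)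
  have "Cauchy (\<lambda>n. apply_c0 (X n) \<gamma>)" for \<gamma>
    unfolding Cauchy_def dist_real_def
    using X[unfolded Cauchy_def dist_norm] ptw by (meson le_less_trans)
  then have "\<exists>l. (\<lambda>n. apply_c0 (X n) \<gamma>) \<longlonglongrightarrow> l" for \<gamma>
    using Cauchy_convergent convergentD by blast
  then obtain l where l: "\<And>\<gamma>. (\<lambda>n. apply_c0 (X n) \<gamma>) \<longlonglongrightarrow> l \<gamma>"
    by metis
  have unif: "\<exists>M. \<forall>n\<ge>M. \<forall>\<gamma>. \<bar>apply_c0 (X n) \<gamma> - l \<gamma>\<bar> \<le> e" if "e > 0" for e
  proof -
    obtain M where M: "\<And>m n. m \<ge> M \<Longrightarrow> n \<ge> M \<Longrightarrow> norm (X m - X n) < e"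
      using X \<open>e > 0\<close> unfolding Cauchy_def dist_norm by metis
    have "\<bar>apply_c0 (X n) \<gamma> - l \<gamma>\<bar> \<le> e" if "n \<ge> M" for n \<gamma>
    proof (rule LIMSEQ_le_const2)
      show "(\<lambda>m. \<bar>apply_c0 (X n) \<gamma> - apply_c0 (X m) \<gamma>\<bar>) \<longlonglongrightarrow> \<bar>apply_c0 (X n) \<gamma> - l \<gamma>\<bar>"
        by (intro tendsto_intros l)
      show "\<exists>N. \<forall>m\<ge>N. \<bar>apply_c0 (X n) \<gamma> - apply_c0 (X m) \<gamma>\<bar> \<le> e"
        using M[OF that] ptw by (meson le_less_trans less_imp_le)
    qed
    then show ?thesis
      by blast
  qed
  have "finite {\<gamma>. e \<le> \<bar>l \<gamma>\<bar>}" if "e > 0" for e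
  proof -
    obtain n where n: "\<And>\<gamma>. \<bar>apply_c0 (X n) \<gamma> - l \<gamma>\<bar> \<le> e / 2"
      using unif[of "e / 2"] \<open>e > 0\<close> by auto
    have "finite {\<gamma>. e / 2 \<le> \<bar>apply_c0 (X n) \<gamma>\<bar>}"
      using apply_c0[of "X n"] half_gt_zero[OF \<open>e > 0\<close>] by blast
    then show ?thesis
    proof (rule rev_finite_subset, intro subsetI CollectI)
      fix \<gamma> assume "\<gamma> \<in> {\<gamma>. e \<le> \<bar>l \<gamma>\<bar>}"
      then show "e / 2 \<le> \<bar>apply_c0 (X n) \<gamma>\<bar>"
        using n[of \<gamma>] by (auto simp: abs_if split: if_splits)
    qed
  qed
  then obtain L where L: "apply_c0 L = l"
    using Abs_c0_inverse[of l] by auto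
  have "X \<longlonglongrightarrow> L"
  proof (rule LIMSEQ_I)
    fix e :: real assume "e > 0"
    then obtain M where M: "\<forall>n\<ge>M. \<forall>\<gamma>. \<bar>apply_c0 (X n) \<gamma> - l \<gamma>\<bar> \<le> e / 2"
      using unif[of "e / 2"] by auto
    have "norm (X n - L) \<le> e / 2" if "n \<ge> M" for n
      by (rule norm_c0_le) (use M that in \<open>simp add: minus_c0.rep_eq L\<close>)
    moreover have "e / 2 < e"
      using \<open>e > 0\<close> by simp
    ultimately show "\<exists>no. \<forall>n\<ge>no. norm (X n - L) < e"
      by (meson le_less_trans)
  qed
  then show "convergent X"
    by (rule convergentI)
qed

definition equivalent_norm :: "('a::real_normed_vector \<Rightarrow> real) \<Rightarrow> bool" where
  "equivalent_norm N \<longleftrightarrow>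
     (\<forall>x. N x = 0 \<longleftrightarrow> x = 0) \<and>
     (\<forall>x y. N (x + y) \<le> N x + N y) \<and>
     (\<forall>r x. N (r *\<^sub>R x) = \<bar>r\<bar> * N x) \<and>
     (\<exists>a>0. \<exists>b>0. \<forall>x. a * norm x \<le> N x \<and> N x \<le> b * norm x)"

end

theory Submission
  imports Defs "HOL-Library.Countable_Set_Type"
begin

text \<open>
  Large WLD spaces. A Corson structure on the dual ball is a compact space of countably supported
  coordinates \<open>\<pi> \<gamma>\<close>. By compactness every vector depends on countably many coordinates and every
  coordinate on countably many vectors, so a set \<open>A\<close> of coordinates has a saturation of the same
  (infinite) cardinality; the functionals supported in a saturated set form a compact, convex,
  symmetric part of the dual ball onto which the whole ball retracts by restricting coordinates. If
  \<open>A\<close> is smaller than the density of the space, the Hahn-Banach theorem and a bipolar argument give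
  a nonzero vector on which that part vanishes (\<open>dens_le_of_determined\<close>,
  \<open>vector_killed_by_ball_on\<close>). Choosing such vectors by transfinite recursion gives a sequence of
  unit vectors whose length is the density, on which every functional has countable support and
  whose initial parts are separated from the rest by functionals (\<open>long_sequence\<close>).

  Pick a norming functional for each member of the sequence. The indices of the other members on
  which it does not vanish form a countable set, so Hajnal's theorem on countable set mappings
  (\<open>free_set_of_countable_set_mapping\<close>), which needs a cardinal above \<open>\<omega>\<^sub>1\<close>, gives a subsequence of the
  full length which, together with its norming functionals, is an Auerbach system. The separation of
  initial parts makes these functionals total on the closed span (\<open>long_sequence_total\<close>), and a
  total set of functionals has a weak* dense linear span (\<open>weak_star_dense\<close>). Both scalar
  fields are treated at once, by working with the real parts of functionals.

  The renorming. The norm is \<open>N x = (SUP \<alpha>. \<bar>\<phi> \<alpha> x\<bar>)\<close>, where \<open>\<phi> \<alpha>\<close> is a small perturbation of the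
  \<open>\<alpha>\<close>-th coordinate functional. Since the coordinates of \<open>x\<close> tend to zero, only finitely many of the
  numbers \<open>\<bar>\<phi> \<alpha> x\<bar>\<close> are close to \<open>N x\<close>, hence a functional attaining its norm is a finite linear
  combination of the \<open>\<phi> \<alpha>\<close> (\<open>norm_attaining_finite_combination\<close>). Under the Continuum Hypothesis
  all sequences in the space are indexed by \<open>\<omega>\<^sub>1\<close>, and a Baire category choice of \<open>\<phi> \<alpha>\<close> ensures that
  no combination of the functionals which really involves a \<open>\<phi> \<alpha>\<close> with \<open>\<alpha>\<close> above the index of an
  infinite-dimensional sequence vanishes on that sequence (\<open>generic_functionals\<close>). In an uncountable
  Auerbach system, uncountably many functionals vanish on a fixed sequence of vectors of the system,
  so they lie in the span of countably many \<open>\<phi> \<alpha>\<close>, and infinitely many of them lie in the span of the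
  same finite set, which contradicts biorthogonality.
\<close>

section \<open>Cardinalities, well-orderings and density characters\<close>

lemma cardinal_well_ordering:
  fixes I :: "'i set"
  obtains L where "wf L" "trans L" "total_on I L" "L \<subseteq> I \<times> I"
    and "\<And>a. a \<in> I \<Longrightarrow> |{b. (b, a) \<in> L}| <o |I|"
proof
  let ?r = "|I|"
  have wo: "Well_order ?r" and F: "Field ?r = I"
    by (rule card_of_Well_order, rule Field_card_of)
  then have lin: "Linear_order ?r" and wf: "wf (?r - Id)"
    by (simp_all add: well_order_on_def)
  show "wf (?r - Id)" by (rule wf)
  show "trans (?r - Id)"
    using lin by (metis linear_order_on_def partial_order_on_def preorder_on_def trans_diff_Id)
  show "total_on I (?r - Id)"
    using lin F by (simp add: linear_order_on_def)
  show "?r - Id \<subseteq> I \<times> I"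
    using F FieldI1 FieldI2 by fastforce
  fix a assume "a \<in> I"
  then have "|underS ?r a| <o |I|"
    using card_of_underS[of ?r a] F by (simp add: card_of_card_order_on)
  moreover have "underS ?r a = {b. (b, a) \<in> ?r - Id}"
    by (auto simp: underS_def)
  ultimately show "|{b. (b, a) \<in> ?r - Id}| <o |I|" by simp
qed

lemma Cinfinite_card_of: "infinite A \<Longrightarrow> Cinfinite |A|"
  by (simp add: cinfinite_def Field_card_of card_of_card_order_on)

lemma countable_ordLeq_Cinfinite: "countable A \<Longrightarrow> Cinfinite r \<Longrightarrow> |A| \<le>o r"
  using ordLeq_transitive[OF _ natLeq_ordLeq_cinfinite] by (simp add: countable_card_le_natLeq)

lemma uncountable_iff_cardSuc: "uncountable A \<longleftrightarrow> cardSuc natLeq \<le>o |A|"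
  unfolding countable_card_le_natLeq not_ordLeq_iff_ordLess[OF natLeq_Well_order card_of_Well_order]
  by (rule cardSuc_ordLess_ordLeq[OF natLeq_Card_order card_of_Card_order])

lemma uncountable_mono: "A \<subseteq> B \<Longrightarrow> uncountable A \<Longrightarrow> uncountable B"
  using countable_subset by blast

lemma card_between:
  fixes r :: "'r rel" and B :: "'b set"
  assumes "Card_order r" "r \<le>o |B|"
  obtains A :: "'b set" where "A \<subseteq> B" "|A| =o r"
proof -
  have r: "|Field r| =o r" using assms(1) by (rule card_of_Field_ordIso)
  then have "|Field r| \<le>o |B|" using assms(2) by (rule ordIso_ordLeq_trans)
  then obtain A where A: "A \<subseteq> B" "|Field r| =o |A|"
    unfolding internalize_card_of_ordLeq2[of "Field r"] by blast
  have "|A| =o r" by (rule ordIso_transitive[OF ordIso_symmetric[OF A(2)] r])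
  with A(1) show thesis by (rule that)
qed

lemma not_ordLess_card: "\<not> |A| <o |B| \<longleftrightarrow> |B| \<le>o |A|"
  by (simp add: not_ordLess_iff_ordLeq card_of_Well_order)

lemma not_ordLeq_card: "\<not> |A| \<le>o |B| \<longleftrightarrow> |B| <o |A|"
  by (simp add: not_ordLeq_iff_ordLess card_of_Well_order)

lemma card_less_not_subset:
  assumes "|A| <o |B|" shows "\<not> B \<subseteq> A"
proof
  assume "B \<subseteq> A"
  then have "|B| \<le>o |A|" by (rule card_of_mono1)
  then show False using assms by (simp flip: not_ordLeq_card)
qed

lemma card_of_finite_subsets:
  assumes r: "Cinfinite r" and A: "|A| \<le>o r"
  shows "|{F. finite F \<and> F \<subseteq> A}| \<le>o r"
proof -
  define P where "P n = {F. finite F \<and> F \<subseteq> A \<and> card F = n}" for n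
  have "|P n| \<le>o r" for n
  proof (induction n)
    case 0
    have "P 0 = {{}}" by (auto simp: P_def)
    then show ?case using r by (simp add: countable_ordLeq_Cinfinite)
  next
    case (Suc n)
    have "P (Suc n) \<subseteq> (\<lambda>(a, F). insert a F) ` (A \<times> P n)"
    proof
      fix F assume F: "F \<in> P (Suc n)"
      then obtain a F' where "F = insert a F'" "a \<notin> F'" "card F' = n"
        by (auto simp: P_def card_Suc_eq)
      then show "F \<in> (\<lambda>(a, F). insert a F) ` (A \<times> P n)"
        using F by (auto simp: P_def image_iff intro!: bexI[of _ F'])
    qed
    then have "|P (Suc n)| \<le>o |A \<times> P n|"
      by (rule ordLeq_transitive[OF card_of_mono1 card_of_image])
    moreover have "|A \<times> P n| \<le>o r"
      using Suc A r by (intro card_of_Times_ordLeq_infinite_Field) (auto simp: cinfinite_def)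
    ultimately show ?case by (rule ordLeq_transitive)
  qed
  then have "|\<Union>n. P n| \<le>o r"
    using r by (intro UNION_Cinfinite_bound) (auto intro: countable_ordLeq_Cinfinite)
  moreover have "{F. finite F \<and> F \<subseteq> A} = (\<Union>n. P n)" by (auto simp: P_def)
  ultimately show ?thesis by simp
qed

lemma finite_total_greatest:
  assumes "finite T" "T \<noteq> {}" "T \<subseteq> I" "trans L" "total_on I L"
  shows "\<exists>m\<in>T. \<forall>a\<in>T. a = m \<or> (a, m) \<in> L"
  using assms(1-3)
proof (induction T rule: finite_ne_induct)
  case (insert t T)
  then obtain m where m: "m \<in> T" "\<forall>a\<in>T. a = m \<or> (a, m) \<in> L" by auto
  have "(t, m) \<in> L \<or> (m, t) \<in> L \<or> t = m"
    using insert.prems m(1) assms(5) by (auto simp: total_on_def)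
  then show ?case
  proof (elim disjE)
    assume "(m, t) \<in> L"
    then show ?thesis using m assms(4) by (intro bexI[of _ t]) (auto dest: transD)
  qed (use m in auto)
qed simp

text \<open>
  Iterating an operation \<open>\<omega>\<close> times closes a set under it, because a finite subset of the union is
  already contained in one of the stages.
\<close>

lemma countably_generated_closure:
  fixes S :: "'a set \<Rightarrow> 'a set"
  assumes r: "Cinfinite r" and A: "|A| \<le>o r" and S: "\<And>F. finite F \<Longrightarrow> countable (S F)"
  obtains B where "A \<subseteq> B" "\<And>F. finite F \<Longrightarrow> F \<subseteq> B \<Longrightarrow> S F \<subseteq> B" "|B| \<le>o r"
proof
  define step where "step X = X \<union> (\<Union>F\<in>{F. finite F \<and> F \<subseteq> X}. S F)" for X
  define C where "C n = (step ^^ n) A" for n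
  have C: "C 0 = A" "C (Suc n) = step (C n)" for n
    by (simp_all add: C_def)
  have "incseq C"
    by (rule incseq_SucI) (auto simp: C step_def)
  have card: "|C n| \<le>o r" for n
  proof (induction n)
    case (Suc n)
    have "|\<Union>F\<in>{F. finite F \<and> F \<subseteq> C n}. S F| \<le>o r"
      using r S Suc by (intro UNION_Cinfinite_bound card_of_finite_subsets ballI)
        (auto intro: countable_ordLeq_Cinfinite)
    then show ?case
      unfolding C step_def by (intro Un_Cinfinite_bound Suc r)
  qed (simp add: C A)
  show "A \<subseteq> (\<Union>n. C n)" using C(1) by blast
  show "|\<Union>n. C n| \<le>o r"
    using r card by (intro UNION_Cinfinite_bound) (auto intro: countable_ordLeq_Cinfinite)
  fix F assume F: "finite F" "F \<subseteq> (\<Union>n. C n)"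
  then have "\<exists>n. F \<subseteq> C n"
  proof (induction F)
    case (insert x F)
    then obtain m n where "x \<in> C m" "F \<subseteq> C n" by auto
    then have "insert x F \<subseteq> C (max m n)"
      using incseqD[OF \<open>incseq C\<close>, of m "max m n"] incseqD[OF \<open>incseq C\<close>, of n "max m n"] by auto
    then show ?case by blast
  qed simp
  then obtain n where "F \<subseteq> C n" by blast
  then have "S F \<subseteq> C (Suc n)"
    using F(1) by (auto simp: C step_def)
  then show "S F \<subseteq> (\<Union>n. C n)" by blast
qed


lemma dens_ordLeq:
  assumes "E \<subseteq> S" "S \<subseteq> closure E"
  shows "dens S \<le>o |E|"
proof (rule dens_attained[of S])
  assume "\<And>E. E \<subseteq> S \<Longrightarrow> S \<subseteq> closure E \<Longrightarrow> dens S \<le>o |E|"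
  from this[OF assms] show ?thesis .
qed

lemma Card_order_dens: "Card_order (dens S)"
  unfolding dens_def by (rule card_of_Card_order)


text \<open>
  Density does not increase when passing to a subset of a metric space: near each point of a dense
  set and for each scale, pick a point of \<open>Y\<close> if there is one.
\<close>

lemma dens_mono_ordLeq:
  fixes Y D :: "'a::metric_space set"
  assumes inf: "infinite D" and D: "closure D = UNIV"
  shows "dens Y \<le>o |D|"
proof -
  define p where "p = (\<lambda>(d, n::nat). SOME y. y \<in> Y \<and> dist d y < 1 / Suc n)"
  define E where "E = Y \<inter> p ` (D \<times> UNIV)"
  have "Y \<subseteq> closure E"
  proof
    fix y assume y: "y \<in> Y"
    show "y \<in> closure E"
      unfolding closure_approachable
    proof (intro allI impI)
      fix e :: real assume "e > 0"
      then obtain n where n: "1 / Suc n < e / 2" using nat_approx_posE[of "e / 2"] by auto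
      have "y \<in> closure D" using D by simp
      then obtain d where d: "d \<in> D" "dist d y < 1 / Suc n"
        unfolding closure_approachable by (metis divide_pos_pos of_nat_0_less_iff zero_less_Suc zero_less_one)
      then have "\<exists>y. y \<in> Y \<and> dist d y < 1 / Suc n" using y by blast
      from someI_ex[OF this] have p: "p (d, n) \<in> Y" "dist d (p (d, n)) < 1 / Suc n" by (auto simp: p_def)
      have "dist (p (d, n)) y \<le> dist d (p (d, n)) + dist d y" by (rule dist_triangle3)
      then have "dist (p (d, n)) y < e" using p(2) d(2) n by linarith
      moreover have "p (d, n) \<in> E" using p(1) d(1) by (auto simp: E_def)
      ultimately show "\<exists>z\<in>E. dist z y < e" by blast
    qed
  qed
  then have 1: "dens Y \<le>o |E|" by (intro dens_ordLeq) (auto simp: E_def)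
  have 2: "|E| \<le>o |p ` (D \<times> (UNIV :: nat set))|" by (rule card_of_mono1) (auto simp: E_def)
  have 3: "|D \<times> (UNIV :: nat set)| \<le>o |D|"
  proof (rule card_of_Times_ordLeq_infinite_Field)
    show "infinite (Field |D| )" using inf by (simp add: Field_card_of)
    show "|D| \<le>o |D|" by (rule ordLeq_refl[OF card_of_Card_order])
    show "|UNIV :: nat set| \<le>o |D|" by (rule countable_ordLeq_Cinfinite[OF _ Cinfinite_card_of[OF inf]]) simp
  qed (rule card_of_Card_order)
  show ?thesis
    by (rule ordLeq_transitive[OF 1 ordLeq_transitive[OF 2 ordLeq_transitive[OF card_of_image 3]]])
qed


section \<open>Free sets for countable set mappings\<close>

text \<open>
  A regressive set mapping is a graph that can be coloured greedily along the well-order, avoiding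
  the countably many colours already used on \<open>F a\<close>; every colour class is free. The point is to get a
  class of full size also when the cardinality of \<open>I\<close> is singular. To this end, a new point only
  receives a colour for which at most countably many colours have had a strictly smaller class so
  far. If all classes ended up small, uncountably many of them would have size at most some
  \<open>\<nu> < |I|\<close>; the rule then bounds every initial segment of every class by \<open>\<nu>\<close>, so that the classes
  have size at most \<open>\<nu>\<^sup>+\<close>, too little to cover \<open>I\<close>. The assumption \<open>big\<close> on the number of colours is
  what produces \<open>\<nu>\<close> without any reference to cofinalities.
\<close>

lemma large_class_of_regressive:
  fixes I M :: "'i set" and F :: "'i \<Rightarrow> 'i set"
  assumes L: "wf L" "trans L" "total_on I L"
    and reg: "\<And>a b. a \<in> I \<Longrightarrow> b \<in> I \<Longrightarrow> b \<in> F a \<Longrightarrow> b \<noteq> a \<Longrightarrow> (b, a) \<in> L"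
    and F: "\<And>a. a \<in> I \<Longrightarrow> countable (F a)"
    and M: "uncountable M" "|M| <o |I|"
    and big: "cardSuc (cardSuc natLeq) \<le>o |M| \<or> |I| \<le>o cardSuc (cardSuc natLeq)"
  obtains H where "H \<subseteq> I" "|H| =o |I|" "\<And>a b. a \<in> H \<Longrightarrow> b \<in> H \<Longrightarrow> a \<noteq> b \<Longrightarrow> b \<notin> F a"
proof -
  have infM: "infinite M" using M(1) countable_finite by blast
  have infI: "infinite I"
    using card_of_ordLeq_infinite[OF ordLess_imp_ordLeq[OF M(2)] infM] .
  define cls where "cls c a e = {b \<in> I. (b, a) \<in> L \<and> c b = e}" for c :: "'i \<Rightarrow> 'i" and a e
  define P where "P c a e \<longleftrightarrow> (a \<in> I \<longrightarrow> e \<in> M \<and> (\<forall>b\<in>F a \<inter> I. (b, a) \<in> L \<longrightarrow> c b \<noteq> e) \<and>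
      countable {d \<in> M. |cls c a d| <o |cls c a e|})" for c a e
  have "\<exists>c. \<forall>a. P c a (c a)"
  proof (rule dependent_wf_choice[where P = P, OF L(1)])
    fix f g :: "'i \<Rightarrow> 'i" and a e
    assume eq: "\<And>b. (b, a) \<in> L \<Longrightarrow> f b = g b"
    have 1: "cls f a = cls g a"
    proof
      show "cls f a d = cls g a d" for d
        unfolding cls_def by (rule Collect_cong) (auto simp: eq)
    qed
    have 2: "(\<forall>b\<in>F a \<inter> I. (b, a) \<in> L \<longrightarrow> f b \<noteq> e) \<longleftrightarrow> (\<forall>b\<in>F a \<inter> I. (b, a) \<in> L \<longrightarrow> g b \<noteq> e)"
      by (rule ball_cong[OF refl], rule imp_cong[OF refl]) (simp add: eq)
    show "P f a e = P g a e"
      unfolding P_def 1 2 ..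
  next
    fix a c
    show "\<exists>e. P c a e"
    proof (cases "a \<in> I")
      case True
      define Q where "Q = {e \<in> M. countable {d \<in> M. |cls c a d| <o |cls c a e|}}"
      (* otherwise an element of least class size outside Q would satisfy the defining condition of Q *)
      have "uncountable Q"
      proof
        assume cQ: "countable Q"
        then have ne: "M - Q \<noteq> {}" using uncountable_mono[OF _ M(1), of Q] by auto
        define R where "R = (\<lambda>e. |cls c a e| ) ` (M - Q)"
        have "\<exists>r\<in>R. \<forall>r'\<in>R. r \<le>o r'"
          using ne by (intro exists_minim_Card_order) (auto simp: R_def card_of_card_order_on Field_card_of)
        then obtain e where e: "e \<in> M - Q" "\<And>d. d \<in> M - Q \<Longrightarrow> |cls c a e| \<le>o |cls c a d|"
          unfolding R_def by auto
        have "{d \<in> M. |cls c a d| <o |cls c a e|} \<subseteq> Q"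
          using e(2) by (auto simp flip: not_ordLess_card)
        then have "countable {d \<in> M. |cls c a d| <o |cls c a e|}"
          using cQ by (rule countable_subset)
        then show False using e(1) by (simp add: Q_def)
      qed
      moreover have "countable (c ` (F a \<inter> I))"
        using F[OF True] by simp
      ultimately have "\<not> Q \<subseteq> c ` (F a \<inter> I)"
        using uncountable_mono by metis
      then obtain e where "e \<in> Q" "e \<notin> c ` (F a \<inter> I)" by blast
      then have "P c a e" by (auto simp: P_def Q_def)
      then show ?thesis by blast
    qed (simp add: P_def)
  qed
  then obtain c where "\<forall>a. P c a (c a)" ..
  then have c: "P c a (c a)" for a ..
  define C where "C e = {a \<in> I. c a = e}" for e
  have free: "b \<notin> F a" if "a \<in> C e" "b \<in> C e" "a \<noteq> b" for a b e
    using that c[of a] reg[of a b] by (auto simp: P_def C_def)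
  have CI: "I = (\<Union>e\<in>M. C e)"
    using c by (auto simp: C_def P_def)
  show thesis
  proof (cases "\<exists>e\<in>M. |I| \<le>o |C e|")
    case True
    then obtain e where "|I| \<le>o |C e|" by blast
    then have "|C e| =o |I|"
      by (simp add: C_def card_of_mono1 ordIso_iff_ordLeq)
    then show thesis
      using free by (intro that[of "C e"]) (auto simp: C_def)
  next
    case False
    then have small: "|C e| <o |I|" if "e \<in> M" for e
      using that by (simp add: not_ordLeq_card)
    (* N plays the role of the cardinal bounding uncountably many classes *)
    obtain N :: "'i set" where N: "M \<subseteq> N" "|N| <o |I|" "uncountable {e \<in> M. |C e| \<le>o |N|}"
    proof (cases "|I| \<le>o cardSuc (cardSuc natLeq)")
      case True
      have "|C e| \<le>o |M|" if "e \<in> M" for e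
      proof -
        have "|C e| <o cardSuc (cardSuc natLeq)"
          using small[OF that] True by (rule ordLess_ordLeq_trans)
        then have "|C e| \<le>o cardSuc natLeq"
          using cardSuc_ordLeq_ordLess[OF cardSuc_Card_order[OF natLeq_Card_order] card_of_Card_order] by blast
        moreover have "cardSuc natLeq \<le>o |M|"
          using M(1) by (simp add: uncountable_iff_cardSuc)
        ultimately show ?thesis by (rule ordLeq_transitive)
      qed
      then have "{e \<in> M. |C e| \<le>o |M|} = M" by blast
      then show ?thesis using M by (intro that[of M]) auto
    next
      case False
      then have M2: "cardSuc (cardSuc natLeq) \<le>o |M|" using big by blast
      have r1: "Cinfinite (cardSuc natLeq)" using Cinfinite_cardSuc natLeq_Cinfinite by blast
      have r2: "Card_order (cardSuc natLeq)" using r1 by blast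
      (* the classes are ordered by size; if all initial parts of that order were countable,
         there would be at most \<omega>\<^sub>1 colours *)
      have "\<exists>e0\<in>M. uncountable {e \<in> M. |C e| \<le>o |C e0|}"
      proof (rule ccontr)
        assume "\<not> ?thesis"
        then have cnt: "countable {e \<in> M. |C e| \<le>o |C e0|}" if "e0 \<in> M" for e0
          using that by blast
        have "cardSuc natLeq \<le>o |M|" using M(1) by (simp add: uncountable_iff_cardSuc)
        then obtain M1 where M1: "M1 \<subseteq> M" and M1c: "|M1| =o cardSuc natLeq"
          by (rule card_between[OF r2])
        have "|\<Union>e0\<in>M1. {e \<in> M. |C e| \<le>o |C e0|}| \<le>o cardSuc natLeq"
          using M1 cnt by (intro UNION_Cinfinite_bound ordIso_imp_ordLeq[OF M1c] r1 ballI
              countable_ordLeq_Cinfinite[OF _ r1]) auto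
        then have "\<not> M \<subseteq> (\<Union>e0\<in>M1. {e \<in> M. |C e| \<le>o |C e0|})"
          by (intro card_less_not_subset
              ordLeq_ordLess_trans[OF _ ordLess_ordLeq_trans[OF cardSuc_greater[OF r2] M2]])
        then obtain e where e: "e \<in> M" "\<And>e0. e0 \<in> M1 \<Longrightarrow> \<not> |C e| \<le>o |C e0|" by blast
        then have "M1 \<subseteq> {e0 \<in> M. |C e0| \<le>o |C e|}"
          using M1 by (auto simp: not_ordLeq_card intro: ordLess_imp_ordLeq)
        then have "countable M1" using cnt[OF e(1)] by (rule countable_subset)
        moreover have "uncountable M1"
          unfolding uncountable_iff_cardSuc using M1c by (simp add: ordIso_iff_ordLeq)
        ultimately show False by simp
      qed
      then obtain e0 where e0: "e0 \<in> M" "uncountable {e \<in> M. |C e| \<le>o |C e0|}" by blast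
      show ?thesis
      proof (rule that[of "C e0 \<union> M"])
        show "|C e0 \<union> M| <o |I|"
          by (rule card_of_Un_ordLess_infinite[OF infI small[OF e0(1)] M(2)])
        have "{e \<in> M. |C e| \<le>o |C e0|} \<subseteq> {e \<in> M. |C e| \<le>o |C e0 \<union> M|}"
          using ordLeq_transitive[OF _ card_of_mono1[of "C e0" "C e0 \<union> M"]] by auto
        then show "uncountable {e \<in> M. |C e| \<le>o |C e0 \<union> M|}"
          using e0(2) by (rule uncountable_mono)
      qed simp
    qed
    have infN: "infinite N" using N(1) infM finite_subset by blast
    have rN: "Cinfinite |N|" using Cinfinite_card_of[OF infN] .
    then have rN1: "Cinfinite (cardSuc |N| )" using Cinfinite_cardSuc by blast
    (* when a received its colour e, that class cannot have been larger than N *)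
    have seg: "|{b \<in> C e. (b, a) \<in> L}| \<le>o |N|" if "a \<in> C e" for a e
    proof (rule ccontr)
      assume "\<not> ?thesis"
      then have 1: "|N| <o |{b \<in> C e. (b, a) \<in> L}|" by (simp add: not_ordLeq_card)
      have eq: "{b \<in> C e. (b, a) \<in> L} = cls c a e" for e by (auto simp: C_def cls_def)
      have "{d \<in> M. |C d| \<le>o |N|} \<subseteq> {d \<in> M. |cls c a d| <o |cls c a e|}"
      proof clarify
        fix d assume "d \<in> M" "|C d| \<le>o |N|"
        have "|cls c a d| \<le>o |C d|"
          unfolding eq[symmetric] by (intro card_of_mono1) auto
        from ordLeq_ordLess_trans[OF ordLeq_transitive[OF this \<open>|C d| \<le>o |N|\<close>] 1]
        show "|cls c a d| <o |cls c a e|" unfolding eq .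
      qed
      then have "uncountable {d \<in> M. |cls c a d| <o |cls c a e|}"
        using N(3) by (rule uncountable_mono)
      moreover have "a \<in> I" "c a = e" using that by (auto simp: C_def)
      ultimately show False using c[of a] by (auto simp: P_def)
    qed
    have le: "|C e| \<le>o cardSuc |N|" for e
    proof (rule ccontr)
      assume "\<not> ?thesis"
      then have gt: "cardSuc |N| <o |C e|"
        using not_ordLeq_iff_ordLess[OF card_order_on_well_order_on[OF conjunct2[OF rN1]] card_of_Well_order] by blast
      obtain C1 where C1: "C1 \<subseteq> C e" and C1c: "|C1| =o cardSuc |N|"
        by (rule card_between[OF conjunct2[OF rN1] ordLess_imp_ordLeq[OF gt]])
      have NN: "|N| \<le>o cardSuc |N|" by (rule cardSuc_ordLeq[OF card_of_Card_order])
      have "|(\<Union>a\<in>C1. {b \<in> C e. (b, a) \<in> L}) \<union> C1| \<le>o cardSuc |N|"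
      proof (intro Un_Cinfinite_bound UNION_Cinfinite_bound rN1)
        show "\<forall>a\<in>C1. |{b \<in> C e. (b, a) \<in> L}| \<le>o cardSuc |N|"
          using C1 by (auto intro!: ordLeq_transitive[OF seg NN])
      qed (rule ordIso_imp_ordLeq[OF C1c])+
      then have "\<not> C e \<subseteq> (\<Union>a\<in>C1. {b \<in> C e. (b, a) \<in> L}) \<union> C1"
        by (rule card_less_not_subset[OF ordLeq_ordLess_trans[OF _ gt]])
      then obtain a where a: "a \<in> C e" "a \<notin> (\<Union>a\<in>C1. {b \<in> C e. (b, a) \<in> L}) \<union> C1"
        unfolding subset_eq ball_simps(10) by (rule bexE)
      have "C1 \<subseteq> {b \<in> C e. (b, a) \<in> L}"
      proof
        fix b assume b: "b \<in> C1"
        then have "(a, b) \<notin> L" "a \<noteq> b" "b \<in> C e" using a C1 by auto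
        moreover have "a \<in> I" "b \<in> I" using a(1) \<open>b \<in> C e\<close> by (auto simp: C_def)
        ultimately show "b \<in> {b \<in> C e. (b, a) \<in> L}"
          using L(3) by (auto simp: total_on_def)
      qed
      then have "|C1| \<le>o |N|"
        by (rule ordLeq_transitive[OF card_of_mono1 seg[OF a(1)]])
      moreover have "|N| <o |C1|"
        by (rule ordLess_ordIso_trans[OF cardSuc_greater[OF card_of_Card_order] ordIso_symmetric[OF C1c]])
      ultimately show False by (simp flip: not_ordLeq_card)
    qed
    have MN: "|M| \<le>o |N|" using N(1) card_of_mono1 by blast
    show thesis
    proof (cases "|I| \<le>o cardSuc |N|")
      case True
      have "|C e| \<le>o |N|" if "e \<in> M" for e
        using ordLess_ordLeq_trans[OF small[OF that] True]
        cardSuc_ordLeq_ordLess[OF card_of_Card_order card_of_Card_order] by blast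
      then have "|\<Union>e\<in>M. C e| \<le>o |N|"
        using rN MN by (intro UNION_Cinfinite_bound) auto
      then show thesis using N(2) by (simp flip: not_ordLeq_card CI)
    next
      case False
      have "|\<Union>e\<in>M. C e| \<le>o cardSuc |N|"
        using le by (intro UNION_Cinfinite_bound rN1 ballI
            ordLeq_transitive[OF MN cardSuc_ordLeq[OF card_of_Card_order]])
      then show thesis using False by (simp flip: CI)
    qed
  qed
qed

text \<open>
  Hajnal's free set theorem for countable set mappings. Every point is reached, along the relation
  \<open>b \<in> F a\<close>, from a least point, and a point reaches only countably many others. Hence the points not
  reached from smaller ones still form a set of full cardinality, and on that set \<open>F\<close> is regressive.
\<close>

theorem free_set_of_countable_set_mapping:
  fixes I :: "'i set" and F :: "'i \<Rightarrow> 'i set"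
  assumes I: "cardSuc natLeq <o |I|" and F: "\<And>a. a \<in> I \<Longrightarrow> countable (F a)"
  obtains H where "H \<subseteq> I" "|H| =o |I|" "\<And>a b. a \<in> H \<Longrightarrow> b \<in> H \<Longrightarrow> a \<noteq> b \<Longrightarrow> b \<notin> F a"
proof -
  have uI: "uncountable I" unfolding uncountable_iff_cardSuc by (rule ordLess_imp_ordLeq[OF I])
  then have infI: "infinite I" using countable_finite by blast
  obtain L where L: "wf L" "trans L" "total_on I L" "L \<subseteq> I \<times> I"
    by (rule cardinal_well_ordering)
  define E where "E = {(a, b). a \<in> I \<and> b \<in> F a \<inter> I}"
  have reach: "countable (E\<^sup>* `` {a})" for a
  proof -
    have "countable ((E ^^ n) `` {a})" for n
    proof (induction n)
      case (Suc n)
      have "(E ^^ Suc n) `` {a} = (\<Union>b\<in>(E ^^ n) `` {a}. E `` {b})" by auto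
      moreover have "countable (E `` {b})" for b
        using F[of b] by (cases "b \<in> I") (auto simp: E_def)
      ultimately show ?case using Suc by simp
    qed simp
    moreover have "E\<^sup>* `` {a} = (\<Union>n. (E ^^ n) `` {a})"
      by (auto simp: rtrancl_power)
    ultimately show ?thesis by simp
  qed
  (* the points that are not reached from smaller ones *)
  define J where "J = {a \<in> I. \<forall>b. (b, a) \<in> L \<longrightarrow> (b, a) \<notin> E\<^sup>*}"
  have cover: "I \<subseteq> (\<Union>a\<in>J. E\<^sup>* `` {a})"
  proof
    fix x assume x: "x \<in> I"
    define S where "S = {a \<in> I. (a, x) \<in> E\<^sup>*}"
    have "x \<in> S" using x by (simp add: S_def)
    then obtain a where a: "a \<in> S" "\<And>b. (b, a) \<in> L \<Longrightarrow> b \<notin> S"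
      using L(1) wfE_min by metis
    have "a \<in> J"
      using a L(4) by (auto simp: J_def S_def dest: rtrancl_trans)
    then show "x \<in> (\<Union>a\<in>J. E\<^sup>* `` {a})" using a(1) by (auto simp: S_def)
  qed
  have infJ: "infinite J"
  proof
    assume "finite J"
    then have "countable (\<Union>a\<in>J. E\<^sup>* `` {a})" using reach by (simp add: countable_finite)
    then show False using uncountable_mono[OF cover uI] by simp
  qed
  have JI: "|J| =o |I|"
  proof -
    have "|\<Union>a\<in>J. E\<^sup>* `` {a}| \<le>o |J|"
      by (intro UNION_Cinfinite_bound Cinfinite_card_of[OF infJ] card_of_mono1 ballI
          countable_ordLeq_Cinfinite[OF reach]) simp
    then have "|I| \<le>o |J|"
      by (rule ordLeq_transitive[OF card_of_mono1[OF cover]])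
    moreover have "|J| \<le>o |I|" by (rule card_of_mono1) (auto simp: J_def)
    ultimately show ?thesis by (simp add: ordIso_iff_ordLeq)
  qed
  have reg: "(b, a) \<in> L" if "a \<in> J" "b \<in> J" "b \<in> F a" "b \<noteq> a" for a b
  proof (rule ccontr)
    assume "(b, a) \<notin> L"
    then have "(a, b) \<in> L" using L(3) that by (auto simp: total_on_def J_def)
    moreover have "(a, b) \<in> E" using that by (auto simp: E_def J_def)
    ultimately show False using that(2) by (auto simp: J_def)
  qed
  have totJ: "total_on J L" using L(3) by (auto simp: total_on_def J_def)
  have r1: "Cinfinite (cardSuc natLeq)" using Cinfinite_cardSuc natLeq_Cinfinite by blast
  have Jgt: "cardSuc natLeq <o |J|"
    by (rule ordLess_ordIso_trans[OF I ordIso_symmetric[OF JI]])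
  obtain M :: "'i set" where M: "uncountable M" "|M| <o |J|"
    and big: "cardSuc (cardSuc natLeq) \<le>o |M| \<or> |J| \<le>o cardSuc (cardSuc natLeq)"
  proof (cases "|J| \<le>o cardSuc (cardSuc natLeq)")
    case True
    obtain M where M: "M \<subseteq> J" "|M| =o cardSuc natLeq"
      by (rule card_between[OF conjunct2[OF r1] ordLess_imp_ordLeq[OF Jgt]])
    show ?thesis
    proof (rule that[of M])
      show "uncountable M" unfolding uncountable_iff_cardSuc using M(2) by (simp add: ordIso_iff_ordLeq)
      show "|M| <o |J|" by (rule ordIso_ordLess_trans[OF M(2) Jgt])
    qed (use True in simp)
  next
    case False
    have r2: "Card_order (cardSuc (cardSuc natLeq))" using r1 Cinfinite_cardSuc by blast
    then have gt: "cardSuc (cardSuc natLeq) <o |J|"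
      using False not_ordLeq_iff_ordLess[OF card_order_on_well_order_on[OF r2] card_of_Well_order] by blast
    obtain M where M: "M \<subseteq> J" "|M| =o cardSuc (cardSuc natLeq)"
      by (rule card_between[OF r2 ordLess_imp_ordLeq[OF gt]])
    show ?thesis
    proof (rule that[of M])
      have "cardSuc natLeq \<le>o cardSuc (cardSuc natLeq)" using r1 cardSuc_ordLeq by blast
      then show "uncountable M"
        unfolding uncountable_iff_cardSuc by (rule ordLeq_ordIso_trans[OF _ ordIso_symmetric[OF M(2)]])
      show "|M| <o |J|" by (rule ordIso_ordLess_trans[OF M(2) gt])
    qed (use M(2) in \<open>simp add: ordIso_iff_ordLeq\<close>)
  qed
  have cnt: "countable (F a)" if "a \<in> J" for a
    using F that by (auto simp: J_def)
  show thesis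
  proof (rule large_class_of_regressive[OF L(1,2) totJ reg cnt M big])
    fix H assume H: "H \<subseteq> J" "|H| =o |J|" "\<And>a b. a \<in> H \<Longrightarrow> b \<in> H \<Longrightarrow> a \<noteq> b \<Longrightarrow> b \<notin> F a"
    show thesis
      using H(1,3) ordIso_transitive[OF H(2) JI] by (intro that[of H]) (auto simp: J_def)
  qed
qed


section \<open>Sublinear functionals and the Hahn-Banach theorem\<close>

definition sublinear :: "('a::real_vector \<Rightarrow> real) \<Rightarrow> bool" where
  "sublinear p \<longleftrightarrow> (\<forall>x y. p (x + y) \<le> p x + p y) \<and> (\<forall>t x. 0 \<le> t \<longrightarrow> p (t *\<^sub>R x) = t * p x)"

lemma sublinear_add: "sublinear p \<Longrightarrow> p (x + y) \<le> p x + p y"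
  and sublinear_scale: "sublinear p \<Longrightarrow> 0 \<le> t \<Longrightarrow> p (t *\<^sub>R x) = t * p x"
  by (auto simp: sublinear_def)

lemma sublinear_zero: "sublinear p \<Longrightarrow> p 0 = 0"
  using sublinear_scale[of p 0 0] by simp

lemma sublinear_minus: "sublinear p \<Longrightarrow> - p (- x) \<le> p x"
  using sublinear_add[of p x "- x"] by (simp add: sublinear_zero)

lemma sublinear_scaleI:
  assumes "\<And>c x. 0 < c \<Longrightarrow> q (c *\<^sub>R x) \<le> c * q x" "0 \<le> c"
    and "q (0::'a::real_vector) = (0::real)"
  shows "q (c *\<^sub>R x) = c * q x"
proof (cases "c = 0")
  case False
  then have c: "c > 0" using assms(2) by simp
  have "q x \<le> (1 / c) * q (c *\<^sub>R x)"
    using assms(1)[of "1 / c" "c *\<^sub>R x"] c by simp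
  then have "c * q x \<le> q (c *\<^sub>R x)" using c by (simp add: field_simps)
  then show ?thesis using assms(1)[OF c, of x] by simp
qed (use assms(3) in simp)

lemma sublinear_INF:
  fixes q :: "'i \<Rightarrow> 'a::real_vector \<Rightarrow> real"
  assumes I: "I \<noteq> {}" and bdd: "\<And>x. bdd_below ((\<lambda>i. q i x) ` I)"
    and zero: "(INF i\<in>I. q i 0) = 0"
    and scale: "\<And>i c x. i \<in> I \<Longrightarrow> 0 < c \<Longrightarrow> \<exists>j\<in>I. q j (c *\<^sub>R x) \<le> c * q i x"
    and add: "\<And>i j x y. i \<in> I \<Longrightarrow> j \<in> I \<Longrightarrow> \<exists>k\<in>I. q k (x + y) \<le> q i x + q j y"
  shows "sublinear (\<lambda>x. INF i\<in>I. q i x)"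
proof -
  let ?q = "\<lambda>x. INF i\<in>I. q i x"
  have "?q (x + y) \<le> ?q x + ?q y" for x y
  proof -
    have 1: "?q (x + y) - q i x \<le> q j y" if ij: "i \<in> I" "j \<in> I" for i j
    proof -
      obtain k where "k \<in> I" "q k (x + y) \<le> q i x + q j y" using add[OF ij] by blast
      then show ?thesis using cINF_lower[OF bdd, of k "x + y"] by simp
    qed
    have "?q (x + y) - q i x \<le> ?q y" if "i \<in> I" for i
      using 1[OF that] by (intro cINF_greatest[OF I]) auto
    then have "?q (x + y) - ?q y \<le> q i x" if "i \<in> I" for i
      using that by (simp add: algebra_simps)
    then have "?q (x + y) - ?q y \<le> ?q x"
      by (intro cINF_greatest[OF I]) auto
    then show ?thesis by simp
  qed
  moreover have "?q (c *\<^sub>R x) = c * ?q x" if "0 \<le> c" for c x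
  proof (rule sublinear_scaleI[of ?q, OF _ that zero])
    fix c x assume c: "0 < (c::real)"
    have "?q (c *\<^sub>R x) / c \<le> q i x" if i: "i \<in> I" for i
    proof -
      obtain j where "j \<in> I" "q j (c *\<^sub>R x) \<le> c * q i x" using scale[OF i c] by blast
      then have "?q (c *\<^sub>R x) \<le> c * q i x" using cINF_lower[OF bdd, of j "c *\<^sub>R x"] by simp
      then show ?thesis using c by (simp add: field_simps)
    qed
    then have "?q (c *\<^sub>R x) / c \<le> ?q x" by (intro cINF_greatest[OF I])
    then show "?q (c *\<^sub>R x) \<le> c * ?q x" using c by (simp add: field_simps)
  qed
  ultimately show ?thesis by (simp add: sublinear_def)
qed

text \<open>
  The usual step that forces a sublinear functional down in the direction \<open>- y\<close>: take
  \<open>q x = (INF t\<in>{0..}. p (x + t *\<^sub>R y) - t * p y)\<close>.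
\<close>

lemma sublinear_lower_at:
  assumes p: "sublinear p"
  obtains q where "sublinear q" "\<And>x. q x \<le> p x" "q (- y) \<le> - p y"
proof
  define h where "h t x = p (x + t *\<^sub>R y) - t * p y" for t x
  have bdd: "bdd_below ((\<lambda>t. h t x) ` {0..})" for x
  proof (rule bdd_belowI2)
    fix t :: real assume "t \<in> {0..}"
    then have "t * p y = p (t *\<^sub>R y)" using p by (simp add: sublinear_scale)
    also have "\<dots> \<le> p (x + t *\<^sub>R y) + p (- x)"
      using sublinear_add[OF p, of "x + t *\<^sub>R y" "- x"] by simp
    finally show "- p (- x) \<le> h t x" by (simp add: h_def)
  qed
  let ?q = "\<lambda>x. INF t\<in>{0..}. h t x"
  show "sublinear ?q"
  proof (rule sublinear_INF[OF _ bdd])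
    have "h t 0 = 0" if "t \<in> {0..}" for t using that p by (simp add: h_def sublinear_scale)
    then have "(INF t\<in>{0..}. h t 0) = (INF t\<in>{0::real..}. 0)" by (intro INF_cong) auto
    then show "(INF t\<in>{0..}. h t 0) = 0" by (simp add: cINF_const)
  next
    fix t c :: real and x assume t: "t \<in> {0..}" "0 < c"
    have "h (c * t) (c *\<^sub>R x) = p (c *\<^sub>R (x + t *\<^sub>R y)) - c * t * p y"
      by (simp add: h_def scaleR_add_right)
    also have "\<dots> = c * h t x" using t p by (simp only: sublinear_scale h_def) (simp add: algebra_simps)
    finally show "\<exists>s\<in>{0..}. h s (c *\<^sub>R x) \<le> c * h t x"
      using t by (intro bexI[of _ "c * t"]) auto
  next
    fix s t :: real and x z assume st: "s \<in> {0..}" "t \<in> {0..}"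
    have "p (x + z + (s + t) *\<^sub>R y) \<le> p (x + s *\<^sub>R y) + p (z + t *\<^sub>R y)"
      using sublinear_add[OF p, of "x + s *\<^sub>R y" "z + t *\<^sub>R y"] by (simp add: algebra_simps)
    then have "h (s + t) (x + z) \<le> h s x + h t z" by (simp add: h_def algebra_simps)
    then show "\<exists>k\<in>{0..}. h k (x + z) \<le> h s x + h t z"
      using st by (intro bexI[of _ "s + t"]) auto
  qed auto
  show "?q x \<le> p x" for x
    using cINF_lower[OF bdd, of 0 x] by (simp add: h_def)
  show "?q (- y) \<le> - p y"
    using cINF_lower[OF bdd, of 1 "- y"] p by (simp add: h_def sublinear_zero)
qed

text \<open>
  Forcing \<open>p\<close> down to at most \<open>- p y\<close> at \<open>- y\<close> cannot change it, so \<open>p\<close> is odd.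
\<close>

lemma minimal_sublinear_linear:
  assumes p: "sublinear p" and min: "\<And>q. sublinear q \<Longrightarrow> (\<And>x. q x \<le> p x) \<Longrightarrow> q = p"
  shows "linear p"
proof -
  have odd: "p (- y) = - p y" for y
  proof -
    obtain q where q: "sublinear q" "\<And>x. q x \<le> p x" "q (- y) \<le> - p y"
      by (rule sublinear_lower_at[OF p, of y]) blast
    then have "q = p" by (intro min)
    then show ?thesis using q(3) sublinear_minus[OF p, of y] by simp
  qed
  show ?thesis
  proof
    fix x y
    have "- p (x + y) \<le> - p x - p y"
      using sublinear_add[OF p, of "- x" "- y"] odd[of "x + y"] odd[of x] odd[of y] by simp
    then show "p (x + y) = p x + p y" using sublinear_add[OF p, of x y] by simp
    fix r
    show "p (r *\<^sub>R x) = r *\<^sub>R p x"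
    proof (cases "0 \<le> r")
      case False
      then have "p ((- r) *\<^sub>R x) = - r * p x" using sublinear_scale[OF p, of "- r" x] by simp
      then show ?thesis using odd[of "r *\<^sub>R x"] by simp
    qed (use sublinear_scale[OF p] in simp)
  qed
qed

text \<open>
  Zorn's lemma provides a minimal sublinear functional below \<open>q\<close>, and minimal sublinear functionals
  are linear. Starting from a functional that is at most \<open>- q x0\<close> at \<open>- x0\<close> fixes the value at
  \<open>x0\<close>.
\<close>

theorem hahn_banach_sublinear:
  assumes q: "sublinear q"
  obtains \<psi> where "linear \<psi>" "\<And>x. \<psi> x \<le> q x" "\<psi> x0 = q x0"
proof -
  obtain q0 where q0: "sublinear q0" "\<And>x. q0 x \<le> q x" "q0 (- x0) \<le> - q x0"
    by (rule sublinear_lower_at[OF q, of x0]) blast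
  define A where "A = {p. sublinear p \<and> (\<forall>x. p x \<le> q0 x)}"
  define P where "P p r \<longleftrightarrow> (\<forall>x. r x \<le> p x)" for p r :: "'a \<Rightarrow> real"
  have "\<exists>m\<in>A. \<forall>a\<in>A. P m a \<longrightarrow> a = m"
  proof (rule predicate_Zorn)
    show "partial_order_on A (relation_of P A)"
      by (rule partial_order_on_relation_ofI) (auto simp: P_def fun_eq_iff intro: order_trans antisym)
  next
    fix C assume "C \<in> Chains (relation_of P A)"
    then have CA: "C \<subseteq> A" and chain: "\<And>a b. a \<in> C \<Longrightarrow> b \<in> C \<Longrightarrow> P a b \<or> P b a"
      by (auto simp: Chains_def relation_of_def)
    show "\<exists>u\<in>A. \<forall>a\<in>C. P a u"
    proof (cases "C = {}")
      case True
      have "q0 \<in> A" using q0(1) by (simp add: A_def)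
      then show ?thesis using True by auto
    next
      case False
      have sub: "sublinear p" "p x \<le> q0 x" if "p \<in> C" for p x
        using that CA by (auto simp: A_def)
      have bdd: "bdd_below ((\<lambda>p. p x) ` C)" for x
      proof (rule bdd_belowI2)
        fix p assume "p \<in> C"
        then show "- q0 (- x) \<le> p x"
          using sublinear_minus[OF sub(1), of p x] sub(2)[of p "- x"] by linarith
      qed
      define u where "u x = (INF p\<in>C. p x)" for x
      have lower: "u x \<le> p x" if "p \<in> C" for p x
        unfolding u_def using that by (rule cINF_lower[OF bdd])
      have "sublinear u"
        unfolding u_def
      proof (rule sublinear_INF[OF False bdd])
        have "(INF p\<in>C. p 0) = (INF p\<in>C. 0)"
          using sub(1) by (intro INF_cong) (auto simp: sublinear_zero)
        then show "(INF p\<in>C. p 0) = 0" using False by (simp add: cINF_const)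
      next
        fix p c x assume "p \<in> C" "0 < (c::real)"
        then show "\<exists>r\<in>C. r (c *\<^sub>R x) \<le> c * p x"
          using sub(1)[of p] by (intro bexI[of _ p]) (auto simp: sublinear_scale)
      next
        fix p r x y assume pr: "p \<in> C" "r \<in> C"
        show "\<exists>k\<in>C. k (x + y) \<le> p x + r y"
        proof (cases "P p r")
          case True
          then show ?thesis
            using pr(2) sublinear_add[OF sub(1)[OF pr(2)], of x y]
            by (intro bexI[of _ r]) (auto simp: P_def intro: order_trans add_mono)
        next
          case False
          then have "P r p" using chain[OF pr] by blast
          then show ?thesis
            using pr(1) sublinear_add[OF sub(1)[OF pr(1)], of x y]
            by (intro bexI[of _ p]) (auto simp: P_def intro: order_trans add_mono)
        qed
      qed
      moreover have "u x \<le> q0 x" for x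
        using False lower sub(2) by (meson ex_in_conv order_trans)
      ultimately have "u \<in> A" by (simp add: A_def)
      then show ?thesis using lower by (auto simp: P_def)
    qed
  qed
  then obtain m where m: "m \<in> A" "\<And>a. a \<in> A \<Longrightarrow> P m a \<Longrightarrow> a = m" by blast
  have "linear m"
  proof (rule minimal_sublinear_linear)
    show "sublinear m" using m(1) by (simp add: A_def)
    fix p assume "sublinear p" "\<And>x. p x \<le> m x"
    then show "p = m"
      using m by (intro m(2)) (auto simp: A_def P_def intro: order_trans)
  qed
  moreover have le: "m x \<le> q x" for x
    using m(1) q0(2) by (auto simp: A_def intro: order_trans)
  moreover have "m x0 = q x0"
  proof (rule antisym[OF le])
    have "m (- x0) \<le> - q x0" using m(1) q0(3) by (auto simp: A_def intro: order_trans)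
    then show "q x0 \<le> m x0" using linear_neg[OF \<open>linear m\<close>, of x0] by simp
  qed
  ultimately show thesis by (rule that)
qed

text \<open>
  Apply the preceding theorem to the \<open>q\<close>-distance from \<open>V\<close>.
\<close>

corollary hahn_banach_distance:
  assumes q: "sublinear q" and nonneg: "\<And>x. 0 \<le> q x" and V: "subspace V"
  obtains \<psi> where "linear \<psi>" "\<And>x. \<psi> x \<le> q x" "\<And>v. v \<in> V \<Longrightarrow> \<psi> v = 0"
    "\<psi> x0 = (INF v\<in>V. q (x0 - v))"
proof -
  have ne: "V \<noteq> {}" using subspace_0[OF V] by blast
  have bdd: "bdd_below ((\<lambda>v. q (x - v)) ` V)" for x
    using nonneg by (intro bdd_belowI2[of _ 0])
  define d where "d x = (INF v\<in>V. q (x - v))" for x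
  have upper: "d x \<le> q (x - v)" if "v \<in> V" for x v
    unfolding d_def by (rule cINF_lower[OF bdd that])
  have d0: "d 0 = 0"
  proof (rule antisym)
    show "d 0 \<le> 0" using upper[OF subspace_0[OF V], of 0] by (simp add: sublinear_zero[OF q])
    show "0 \<le> d 0" unfolding d_def using nonneg by (intro cINF_greatest[OF ne])
  qed
  have "sublinear d"
    unfolding d_def
  proof (rule sublinear_INF[where q = "\<lambda>v x. q (x - v)", OF ne bdd d0[unfolded d_def]])
    fix v c x assume "v \<in> V" "0 < (c::real)"
    then show "\<exists>w\<in>V. q (c *\<^sub>R x - w) \<le> c * q (x - v)"
      using sublinear_scale[OF q, of c "x - v"] subspace_scale[OF V]
      by (intro bexI[of _ "c *\<^sub>R v"]) (auto simp: scaleR_diff_right)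
  next
    fix v w x y assume "v \<in> V" "w \<in> V"
    then show "\<exists>k\<in>V. q (x + y - k) \<le> q (x - v) + q (y - w)"
      using sublinear_add[OF q, of "x - v" "y - w"] subspace_add[OF V]
      by (intro bexI[of _ "v + w"]) (auto simp: algebra_simps)
  qed
  then obtain \<psi> where \<psi>: "linear \<psi>" "\<And>x. \<psi> x \<le> d x" "\<psi> x0 = d x0"
    by (rule hahn_banach_sublinear[of d x0]) blast
  show thesis
  proof (rule that[OF \<psi>(1)])
    show "\<psi> x \<le> q x" for x
      using \<psi>(2)[of x] upper[OF subspace_0[OF V], of x] by simp
    fix v assume v: "v \<in> V"
    have "\<psi> w \<le> 0" if "w \<in> V" for w
      using \<psi>(2)[of w] upper[OF that, of w] by (simp add: sublinear_zero[OF q])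
    from this[OF v] this[OF subspace_neg[OF V v]] show "\<psi> v = 0"
      by (simp add: linear_neg[OF \<psi>(1)])
  next
    show "\<psi> x0 = (INF v\<in>V. q (x0 - v))" using \<psi>(3) by (simp add: d_def)
  qed
qed

lemma norm_sublinear: "sublinear (norm :: 'a::real_normed_vector \<Rightarrow> real)"
  by (simp add: sublinear_def norm_triangle_ineq)


section \<open>Finitely many linear functionals\<close>

text \<open>
  Stated for arbitrary functions on a set \<open>W\<close> closed under \<open>w - c z\<close>, so that it serves twice: with
  vectors as the elements of \<open>W\<close> and functionals as the \<open>u i\<close>, and with the two roles exchanged.
\<close>

lemma in_span_of_common_kernel:
  fixes u :: "'i \<Rightarrow> 'w \<Rightarrow> 'k::field" and v :: "'w \<Rightarrow> 'k"
  assumes "finite E"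
    and "\<And>w z c. w \<in> W \<Longrightarrow> z \<in> W \<Longrightarrow>
           \<exists>y\<in>W. v y = v w - c * v z \<and> (\<forall>i\<in>E. u i y = u i w - c * u i z)"
    and "\<And>w. w \<in> W \<Longrightarrow> (\<And>i. i \<in> E \<Longrightarrow> u i w = 0) \<Longrightarrow> v w = 0"
  shows "\<exists>c. \<forall>w\<in>W. v w = (\<Sum>i\<in>E. c i * u i w)"
  using assms
proof (induction E arbitrary: v rule: finite_induct)
  case (insert e E)
  show ?case
  proof (cases "\<forall>w\<in>W. (\<forall>i\<in>E. u i w = 0) \<longrightarrow> u e w = 0")
    case True
    have "\<exists>c. \<forall>w\<in>W. v w = (\<Sum>i\<in>E. c i * u i w)"
    proof (rule insert.IH)
      show "\<exists>y\<in>W. v y = v w - c * v z \<and> (\<forall>i\<in>E. u i y = u i w - c * u i z)"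
        if "w \<in> W" "z \<in> W" for w z c
        using insert.prems(1)[OF that, of c] by auto
      show "v w = 0" if "w \<in> W" "\<And>i. i \<in> E \<Longrightarrow> u i w = 0" for w
        using insert.prems(2)[OF that(1)] True that by auto
    qed
    then obtain c where c: "\<forall>w\<in>W. v w = (\<Sum>i\<in>E. c i * u i w)" ..
    have "(\<Sum>i\<in>E. (c(e := 0)) i * u i w) = (\<Sum>i\<in>E. c i * u i w)" for w
      using insert.hyps(2) by (intro sum.cong) auto
    then show ?thesis
      using c insert.hyps by (intro exI[of _ "c(e := 0)"]) simp
  next
    case False
    then obtain w0 where w0: "w0 \<in> W" "\<And>i. i \<in> E \<Longrightarrow> u i w0 = 0" "u e w0 \<noteq> 0" by blast
    define k where "k = v w0 / u e w0"
    have "\<exists>c. \<forall>w\<in>W. v w - k * u e w = (\<Sum>i\<in>E. c i * u i w)"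
    proof (rule insert.IH)
      show "\<exists>y\<in>W. v y - k * u e y = v w - k * u e w - c * (v z - k * u e z) \<and>
              (\<forall>i\<in>E. u i y = u i w - c * u i z)" if wz: "w \<in> W" "z \<in> W" for w z c
      proof -
        obtain y where y: "y \<in> W" "v y = v w - c * v z"
          "\<forall>i\<in>insert e E. u i y = u i w - c * u i z"
          using insert.prems(1)[OF wz, of c] by blast
        have "u e y = u e w - c * u e z" using y(3) by simp
        then have "v y - k * u e y = v w - k * u e w - c * (v z - k * u e z)"
          by (simp only: y(2)) (simp add: algebra_simps)
        then show ?thesis using y by blast
      qed
      fix w assume w: "w \<in> W" "\<And>i. i \<in> E \<Longrightarrow> u i w = 0"
      obtain y where y: "y \<in> W" "v y = v w - u e w / u e w0 * v w0"
        "\<And>i. i \<in> insert e E \<Longrightarrow> u i y = u i w - u e w / u e w0 * u i w0"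
        using insert.prems(1)[OF w(1) w0(1), of "u e w / u e w0"] by blast
      have "v y = 0"
        using w0 w(2) by (intro insert.prems(2)[OF y(1)]) (auto simp: y(3))
      then show "v w - k * u e w = 0" using y(2) by (simp add: k_def)
    qed
    then obtain c where c: "\<forall>w\<in>W. v w - k * u e w = (\<Sum>i\<in>E. c i * u i w)" ..
    have "(\<Sum>i\<in>E. (c(e := k)) i * u i w) = (\<Sum>i\<in>E. c i * u i w)" for w
      using insert.hyps(2) by (intro sum.cong) auto
    then show ?thesis
      using c insert.hyps by (intro exI[of _ "c(e := k)"]) (simp add: algebra_simps)
  qed
qed auto

text \<open>
  Passing to the kernel of one functional costs at most one dimension.
\<close>

lemma common_zero_in_infinite_dimensional:
  fixes V :: "'a::real_vector set" and E :: "('a \<Rightarrow> real) set"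
  assumes "finite E" "subspace V" "\<And>T. finite T \<Longrightarrow> \<not> V \<subseteq> span T" "\<And>\<phi>. \<phi> \<in> E \<Longrightarrow> linear \<phi>"
  shows "\<exists>w\<in>V. w \<noteq> 0 \<and> (\<forall>\<phi>\<in>E. \<phi> w = 0)"
  using assms
proof (induction E arbitrary: V rule: finite_induct)
  case empty
  have "\<not> V \<subseteq> span {}" by (rule empty.prems(2)) simp
  then show ?case by auto
next
  case (insert \<phi> E)
  have lin: "linear \<phi>" using insert.prems(3) by simp
  define V' where "V' = {v \<in> V. \<phi> v = 0}"
  have "subspace V'"
    unfolding V'_def using insert.prems(1) lin
    by (auto simp: subspace_def linear_0 linear_add linear_scale)
  moreover have "\<not> V' \<subseteq> span T" if T: "finite T" for T
  proof
    assume V': "V' \<subseteq> span T"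
    show False
    proof (cases "V' = V")
      case True
      then show False using V' insert.prems(2)[OF T] by simp
    next
      case False
      then obtain x0 where x0: "x0 \<in> V" "\<phi> x0 \<noteq> 0" by (auto simp: V'_def)
      have "V \<subseteq> span (insert x0 T)"
      proof
        fix v assume v: "v \<in> V"
        have "v - (\<phi> v / \<phi> x0) *\<^sub>R x0 \<in> V'"
          using v x0 insert.prems(1)
          by (auto simp: V'_def linear_diff[OF lin] linear_scale[OF lin] intro: subspace_diff subspace_scale)
        then show "v \<in> span (insert x0 T)"
          using V' unfolding span_breakdown_eq by blast
      qed
      then show False using insert.prems(2)[of "insert x0 T"] T by simp
    qed
  qed
  ultimately have "\<exists>w\<in>V'. w \<noteq> 0 \<and> (\<forall>\<psi>\<in>E. \<psi> w = 0)"
    using insert.prems(3) by (intro insert.IH) auto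
  then show ?case by (auto simp: V'_def)
qed


section \<open>Compact spaces and Corson coordinates\<close>

lemma compactin_indexed_cover:
  assumes S: "compactin X S" and op: "\<And>i. i \<in> I \<Longrightarrow> openin X (U i)" and cover: "S \<subseteq> (\<Union>i\<in>I. U i)"
  obtains J where "finite J" "J \<subseteq> I" "S \<subseteq> (\<Union>i\<in>J. U i)"
proof -
  obtain F where F: "finite F" "F \<subseteq> U ` I" "S \<subseteq> \<Union>F"
    using compactinD[OF S, of "U ` I"] op cover by auto
  obtain J where "finite J" "J \<subseteq> I" "F = U ` J"
    using finite_subset_image[OF F(1,2)] by blast
  then show thesis using F(3) that by blast
qed

text \<open>
  In a compact space, a continuous \<open>u\<close> depends on countably many members of a separating family: the
  pairs with \<open>norm (u f - u g) \<ge> 1 / n\<close> form a compact set, covered by the open sets on which some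
  \<open>e i\<close> differs.
\<close>

lemma countably_many_separate:
  fixes e :: "'i \<Rightarrow> 't \<Rightarrow> 'b::real_normed_vector" and u :: "'t \<Rightarrow> 'c::real_normed_vector"
  assumes T: "compact_space T" and e: "\<And>i. continuous_map T euclidean (e i)"
    and sep: "\<And>f g. f \<in> topspace T \<Longrightarrow> g \<in> topspace T \<Longrightarrow> (\<And>i. e i f = e i g) \<Longrightarrow> f = g"
    and u: "continuous_map T euclidean u"
  shows "\<exists>A. countable A \<and> (\<forall>f\<in>topspace T. \<forall>g\<in>topspace T. (\<forall>i\<in>A. e i f = e i g) \<longrightarrow> u f = u g)"
proof -
  let ?P = "prod_topology T T"
  have diff: "continuous_map ?P euclideanreal (\<lambda>p. norm (h (fst p) - h (snd p)))"
    if "continuous_map T euclidean h" for h :: "'t \<Rightarrow> 'd::real_normed_vector"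
    using continuous_map_compose[OF continuous_map_fst that] continuous_map_compose[OF continuous_map_snd that]
    by (intro continuous_map_norm continuous_map_diff) (simp_all add: o_def)
  define K where "K n = {p \<in> topspace ?P. norm (u (fst p) - u (snd p)) \<in> {1 / Suc n..}}" for n
  define V where "V i = {p \<in> topspace ?P. norm (e i (fst p) - e i (snd p)) \<in> {0<..}}" for i
  have P: "compact_space ?P" using T by (simp add: compact_space_prod_topology)
  have K: "compactin ?P (K n)" for n
    unfolding K_def by (intro closedin_compact_space[OF P] closedin_continuous_map_preimage[OF diff[OF u]]) simp
  have V: "openin ?P (V i)" for i
    unfolding V_def by (intro openin_continuous_map_preimage[OF diff[OF e]]) simp
  have cover: "K n \<subseteq> (\<Union>i\<in>UNIV. V i)" for n
  proof
    fix p assume p: "p \<in> K n"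
    then have "u (fst p) \<noteq> u (snd p)" by (auto simp: K_def)
    then have "fst p \<noteq> snd p" by metis
    moreover have "fst p \<in> topspace T" "snd p \<in> topspace T" using p by (auto simp: K_def)
    ultimately obtain i where "e i (fst p) \<noteq> e i (snd p)"
      using sep[of "fst p" "snd p"] by blast
    then have "p \<in> V i" using p by (simp add: V_def K_def)
    then show "p \<in> (\<Union>i\<in>UNIV. V i)" by blast
  qed
  have "\<exists>J. finite J \<and> K n \<subseteq> (\<Union>i\<in>J. V i)" for n
    using compactin_indexed_cover[OF K V cover] by metis
  then obtain J where J: "\<And>n. finite (J n)" "\<And>n. K n \<subseteq> (\<Union>i\<in>J n. V i)" by metis
  show ?thesis
  proof (intro exI[of _ "\<Union>n. J n"] conjI ballI impI)
    show "countable (\<Union>n. J n)" using J(1) by (simp add: countable_finite)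
    fix f g assume fg: "f \<in> topspace T" "g \<in> topspace T" "\<forall>i\<in>\<Union>n. J n. e i f = e i g"
    show "u f = u g"
    proof (rule ccontr)
      assume "u f \<noteq> u g"
      then obtain n where "1 / Suc n < norm (u f - u g)"
        using nat_approx_posE[of "norm (u f - u g)"] by auto
      then have "(f, g) \<in> K n" using fg by (simp add: K_def)
      then obtain i where "i \<in> J n" "(f, g) \<in> V i" using J(2) by blast
      then show False using fg(3) by (auto simp: V_def)
    qed
  qed
qed

lemma compact_simultaneous_values:
  fixes r :: "'i \<Rightarrow> 't \<Rightarrow> real"
  assumes T: "compact_space T" and S: "closedin T S"
    and r: "\<And>i. i \<in> I \<Longrightarrow> continuous_map T euclideanreal (r i)"
    and approx: "\<And>J e. finite J \<Longrightarrow> J \<subseteq> I \<Longrightarrow> e > 0 \<Longrightarrow> \<exists>f\<in>S. \<forall>i\<in>J. \<bar>r i f - t i\<bar> \<le> e"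
  obtains f where "f \<in> S" "\<forall>i\<in>I. r i f = t i"
proof -
  define C where "C p = {f \<in> S. r (fst p) f \<in> {t (fst p) - 1 / Suc (snd p)..t (fst p) + 1 / Suc (snd p)}}" for p
  let ?F = "insert S (C ` (I \<times> UNIV))"
  have "\<Inter>?F \<noteq> {}"
  proof (rule compact_space_fip[THEN iffD1, rule_format, OF T], intro conjI ballI allI impI)
    fix D assume D: "D \<in> ?F"
    have "closedin T (C p)" if "p \<in> I \<times> UNIV" for p
      unfolding C_def by (rule closedin_continuous_map_preimage_gen[OF r S]) (use that in auto)
    with D S show "closedin T D" by auto
  next
    fix G assume G: "finite G \<and> G \<subseteq> ?F"
    then have "finite (G - {S})" "G - {S} \<subseteq> C ` (I \<times> UNIV)" by auto
    from finite_subset_image[OF this]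
    obtain P where P: "P \<subseteq> I \<times> UNIV" "finite P" "G - {S} = C ` P" by (elim exE conjE)
    define e where "e = Min (insert 1 ((\<lambda>p. 1 / Suc (snd p)) ` P))"
    have "e > 0" unfolding e_def using P(2) by (subst Min_gr_iff) auto
    have e_le: "e \<le> 1 / Suc (snd p)" if "p \<in> P" for p
      unfolding e_def using P(2) that by (intro Min_le) auto
    have "finite (fst ` P)" "fst ` P \<subseteq> I" using P by auto
    from approx[OF this \<open>e > 0\<close>]
    obtain f where f: "f \<in> S" "\<forall>i\<in>fst ` P. \<bar>r i f - t i\<bar> \<le> e" by (rule bexE)
    have "f \<in> C p" if "p \<in> P" for p
    proof -
      have "\<bar>r (fst p) f - t (fst p)\<bar> \<le> 1 / Suc (snd p)"
        using f(2) e_le[OF that] that by fastforce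
      then show ?thesis using f(1) by (auto simp: C_def abs_le_iff)
    qed
    then have "f \<in> \<Inter>G" using f(1) P(3) by blast
    then show "\<Inter>G \<noteq> {}" by blast
  qed
  then obtain f where f: "f \<in> S" "\<And>i n. i \<in> I \<Longrightarrow> f \<in> C (i, n)" by auto
  have "r i f = t i" if "i \<in> I" for i
  proof (rule ccontr)
    assume "r i f \<noteq> t i"
    then obtain n where n: "1 / Suc n < \<bar>r i f - t i\<bar>"
      using nat_approx_posE[of "\<bar>r i f - t i\<bar>"] by auto
    have "\<bar>r i f - t i\<bar> \<le> 1 / Suc n" using f(2)[OF that, of n] by (auto simp: C_def abs_le_iff)
    then show False using n by simp
  qed
  then show thesis using f(1) that by blast
qed

text \<open>
  Of a Corson compactum only this is used: it is compact and has a separating family of countably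
  supported continuous coordinates. Coordinates outside the index set are set to zero.
\<close>

lemma corson_compact_coordinates:
  fixes T :: "'t topology"
  assumes "corson_compact T"
  obtains \<pi> :: "'t \<Rightarrow> 't \<Rightarrow> real" where "compact_space T"
    "\<And>\<gamma>. continuous_map T euclideanreal (\<pi> \<gamma>)"
    "\<And>f g. f \<in> topspace T \<Longrightarrow> g \<in> topspace T \<Longrightarrow> (\<And>\<gamma>. \<pi> \<gamma> f = \<pi> \<gamma> g) \<Longrightarrow> f = g"
    "\<And>f. f \<in> topspace T \<Longrightarrow> countable {\<gamma>. \<pi> \<gamma> f \<noteq> 0}"
proof -
  obtain \<Gamma> :: "'t set" and C where C: "compactin (cube \<Gamma>) C"
    "\<forall>c\<in>C. countable {\<gamma>\<in>\<Gamma>. c \<gamma> \<noteq> 0}" "T homeomorphic_space subtopology (cube \<Gamma>) C"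
    using assms unfolding corson_compact_def by blast
  have CT: "C \<subseteq> topspace (cube \<Gamma>)" using C(1) by (rule compactin_subset_topspace)
  obtain h where h: "homeomorphic_map T (subtopology (cube \<Gamma>) C) h"
    using C(3) homeomorphic_space by blast
  define \<pi> where "\<pi> \<gamma> f = (if \<gamma> \<in> \<Gamma> then h f \<gamma> else 0)" for \<gamma> f
  have hC: "h f \<in> C" if "f \<in> topspace T" for f
    using homeomorphic_imp_surjective_map[OF h] that CT by auto
  show thesis
  proof (rule that)
    show "compact_space T"
      using C(1,3) compact_space_subtopology homeomorphic_compact_space by blast
    show "continuous_map T euclideanreal (\<pi> \<gamma>)" for \<gamma>
    proof (cases "\<gamma> \<in> \<Gamma>")
      case True
      have "continuous_map (subtopology (cube \<Gamma>) C) (top_of_set {-1..1}) (\<lambda>c. c \<gamma>)"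
        using True by (intro continuous_map_from_subtopology continuous_map_product_projection)
      then have "continuous_map T (top_of_set {-1..1}) ((\<lambda>c. c \<gamma>) \<circ> h)"
        using homeomorphic_imp_continuous_map[OF h] continuous_map_compose by blast
      moreover have "\<pi> \<gamma> = (\<lambda>f. h f \<gamma>)" using True by (simp add: \<pi>_def fun_eq_iff)
      ultimately show ?thesis by (simp add: o_def continuous_map_in_subtopology)
    next
      case False
      then have "\<pi> \<gamma> = (\<lambda>f. 0)" by (simp add: \<pi>_def fun_eq_iff)
      then show ?thesis by simp
    qed
    fix f assume f: "f \<in> topspace T"
    have "{\<gamma>. \<pi> \<gamma> f \<noteq> 0} = {\<gamma>\<in>\<Gamma>. h f \<gamma> \<noteq> 0}" by (auto simp: \<pi>_def)
    then show "countable {\<gamma>. \<pi> \<gamma> f \<noteq> 0}" using C(2) hC[OF f] by simp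
  next
    fix f g assume fg: "f \<in> topspace T" "g \<in> topspace T" "\<And>\<gamma>. \<pi> \<gamma> f = \<pi> \<gamma> g"
    have "h f \<gamma> = h g \<gamma>" if "\<gamma> \<in> \<Gamma>" for \<gamma>
      using fg(3)[of \<gamma>] that by (simp add: \<pi>_def)
    moreover have "h f \<in> \<Gamma> \<rightarrow>\<^sub>E {-1..1}" "h g \<in> \<Gamma> \<rightarrow>\<^sub>E {-1..1}"
      using hC[OF fg(1)] hC[OF fg(2)] CT by (simp_all add: subset_iff)
    ultimately have "h f = h g" by (intro PiE_ext)
    then show "f = g"
      using homeomorphic_imp_injective_map[OF h] fg(1,2) by (meson inj_onD)
  qed
qed


section \<open>The dual ball of a real or complex Banach space\<close>

text \<open>
  Real and complex Banach spaces are treated together through the real part \<open>re\<close> of scalars. The set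
  \<open>units\<close> contains enough scalars of modulus one to recover a scalar from the real parts of its
  multiples; it is \<open>{1, -1}\<close> in the real case and \<open>{1, -1, \<i>}\<close> in the complex case.
\<close>

locale banach_space_re = banach_space_over smul
  for smul :: "'k::real_normed_field \<Rightarrow> 'a::banach \<Rightarrow> 'a" +
  fixes re :: "'k \<Rightarrow> real" and units :: "'k set"
  assumes re_add: "re (c + d) = re c + re d"
    and re_of_real_mult: "re (of_real r * c) = r * re c"
    and re_le: "\<bar>re c\<bar> \<le> norm c"
    and re_rotate: "\<exists>u. norm u = 1 \<and> re (u * c) = norm c"
    and re_eq_norm: "re c = norm c \<Longrightarrow> c = of_real (norm c)"
    and units: "countable units" "1 \<in> units" "-1 \<in> units" "u \<in> units \<Longrightarrow> norm u = 1"
    and units_determine: "(\<And>u. u \<in> units \<Longrightarrow> re (u * c) = 0) \<Longrightarrow> c = 0"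
    and complexify: "linear \<psi> \<Longrightarrow>
      \<exists>\<phi>. (\<forall>x y. \<phi> (x + y) = \<phi> x + \<phi> y) \<and> (\<forall>c x. \<phi> (smul c x) = c * \<phi> x) \<and> (\<forall>x. re (\<phi> x) = \<psi> x)"
begin

lemma re_zero [simp]: "re 0 = 0"
  using re_of_real_mult[of 0 0] by simp

lemma re_one: "re 1 = 1"
proof -
  obtain u where u: "norm u = 1" "re (u * 1) = norm (1::'k)" using re_rotate by blast
  then have "u = 1" using re_eq_norm[of u] by simp
  then show ?thesis using u by simp
qed

lemma re_minus: "re (- c) = - re c"
  using re_of_real_mult[of "-1" c] by simp

lemma re_diff: "re (c - d) = re c - re d"
  using re_add[of c "- d"] by (simp add: re_minus)

lemma bounded_linear_re: "bounded_linear re"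
  by (rule bounded_linear_intro[of _ 1])
    (use re_add re_of_real_mult re_le in \<open>auto simp: scaleR_conv_of_real\<close>)

definition dual_ball :: "('a \<Rightarrow> 'k) set" where
  "dual_ball = {f. (\<forall>x y. f (x + y) = f x + f y) \<and> (\<forall>c x. f (smul c x) = c * f x) \<and>
                 (\<forall>x. norm (f x) \<le> norm x)}"

abbreviation ball_topology :: "('a \<Rightarrow> 'k) topology" where
  "ball_topology \<equiv> subtopology (product_topology (\<lambda>_. euclidean) UNIV) dual_ball"

lemma topspace_ball [simp]: "topspace ball_topology = dual_ball"
  by simp

lemma dual_ball_add: "f \<in> dual_ball \<Longrightarrow> f (x + y) = f x + f y"
  and dual_ball_smul: "f \<in> dual_ball \<Longrightarrow> f (smul c x) = c * f x"
  and dual_ball_le: "f \<in> dual_ball \<Longrightarrow> norm (f x) \<le> norm x"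
  by (auto simp: dual_ball_def)

lemma dual_ball_scaleR: "f \<in> dual_ball \<Longrightarrow> f (r *\<^sub>R x) = of_real r * f x"
  using dual_ball_smul[of f "of_real r" x] by (simp add: smul_of_real)

lemma dual_ball_zero: "f \<in> dual_ball \<Longrightarrow> f 0 = 0"
  using dual_ball_scaleR[of f 0 0] by simp

lemma dual_ball_minus: "f \<in> dual_ball \<Longrightarrow> f (- x) = - f x"
  using dual_ball_scaleR[of f "-1" x] by simp

lemma dual_ball_diff: "f \<in> dual_ball \<Longrightarrow> f (x - y) = f x - f y"
  using dual_ball_add[of f x "- y"] by (simp add: dual_ball_minus)

lemma dual_ball_sum: "f \<in> dual_ball \<Longrightarrow> f (\<Sum>i\<in>S. smul (c i) (x i)) = (\<Sum>i\<in>S. c i * f (x i))"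
  by (induction S rule: infinite_finite_induct)
    (auto simp: dual_ball_zero dual_ball_add dual_ball_smul)

lemma dual_ball_re_le: "f \<in> dual_ball \<Longrightarrow> re (f x) \<le> norm x"
  using dual_ball_le[of f x] re_le[of "f x"] by linarith

lemma dual_ball_linear: "f \<in> dual_ball \<Longrightarrow> linear (\<lambda>x. re (f x))"
  by (rule linearI) (auto simp: dual_ball_add re_add dual_ball_scaleR re_of_real_mult)

lemma dual_ball_bounded_linear: "f \<in> dual_ball \<Longrightarrow> bounded_linear f"
  by (rule bounded_linear_intro[of _ 1])
    (auto simp: dual_ball_add dual_ball_scaleR dual_ball_le scaleR_conv_of_real)

lemma zero_in_dual_ball: "(\<lambda>_. 0) \<in> dual_ball"
  by (simp add: dual_ball_def)

lemma functional_in_dual_ball: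
  assumes "\<And>x y. f (x + y) = f x + f y" "\<And>c x. f (smul c x) = c * f x" "\<And>x. re (f x) \<le> norm x"
  shows "f \<in> dual_ball"
proof -
  have "norm (f x) \<le> norm x" for x
  proof -
    obtain u where u: "norm u = 1" "re (u * f x) = norm (f x)" using re_rotate by blast
    then show ?thesis using assms(2)[of u x] assms(3)[of "smul u x"] by (simp add: norm_smul)
  qed
  then show ?thesis using assms by (simp add: dual_ball_def)
qed

lemma re_determines:
  assumes "\<And>c x. f (smul c x) = c * f x" "\<And>c x. g (smul c x) = c * g x" "\<And>x. re (f x) = re (g x)"
  shows "f = g"
proof
  fix x
  have "re (u * (f x - g x)) = 0" for u
    using assms(3)[of "smul u x"] assms(1,2) by (simp add: right_diff_distrib re_diff)
  then show "f x = g x" using units_determine[of "f x - g x"] by simp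
qed

lemma norming_functional:
  obtains f where "f \<in> dual_ball" "f x = of_real (norm x)"
proof -
  obtain \<psi> where \<psi>: "linear \<psi>" "\<And>y. \<psi> y \<le> norm y" "\<psi> x = norm x"
    using hahn_banach_sublinear[OF norm_sublinear, of x] by blast
  then obtain f where f: "\<And>x y. f (x + y) = f x + f y" "\<And>c x. f (smul c x) = c * f x"
    "\<And>x. re (f x) = \<psi> x"
    using complexify by metis
  then have fB: "f \<in> dual_ball" using \<psi>(2) by (intro functional_in_dual_ball) auto
  have "re (f x) \<le> norm (f x)" using re_le[of "f x"] by simp
  then have "norm (f x) = norm x" using dual_ball_le[OF fB, of x] f(3) \<psi>(3) by simp
  then show thesis using that[OF fB] re_eq_norm[of "f x"] f(3) \<psi>(3) by simp
qed

lemma continuous_eval: "continuous_map ball_topology euclidean (\<lambda>f. f x)"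
  by (intro continuous_map_from_subtopology continuous_map_product_projection) simp

lemma continuous_re_eval: "continuous_map ball_topology euclideanreal (\<lambda>f. re (f x))"
proof -
  have "continuous_map euclidean euclideanreal re"
    using bounded_linear_re by (simp add: linear_continuous_on)
  from continuous_map_compose[OF continuous_eval this] show ?thesis by (simp add: o_def)
qed

text \<open>
  The operations on the dual ball under which the parts \<open>ball_on A\<close> are to be closed, midpoints and
  multiplication by units, are instances of one binary operation.
\<close>

definition combine :: "'k \<times> 'k \<Rightarrow> ('a \<Rightarrow> 'k) \<Rightarrow> ('a \<Rightarrow> 'k) \<Rightarrow> 'a \<Rightarrow> 'k" where
  "combine w f g = (\<lambda>x. fst w * f x + snd w * g x)"

definition weights :: "('k \<times> 'k) set" where
  "weights = insert (of_real (1/2), of_real (1/2)) ((\<lambda>u. (u, 0)) ` units)"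

lemma countable_weights: "countable weights"
  using units(1) by (simp add: weights_def)

lemma combine_in_dual_ball:
  assumes "f \<in> dual_ball" "g \<in> dual_ball" "w \<in> weights"
  shows "combine w f g \<in> dual_ball"
proof -
  have "norm (fst w) + norm (snd w) \<le> 1"
    using assms(3) units(4) by (auto simp: weights_def simp flip: of_real_divide)
  then have "norm (combine w f g x) \<le> norm x" for x
  proof -
    have "norm (combine w f g x) \<le> norm (fst w) * norm (f x) + norm (snd w) * norm (g x)"
      unfolding combine_def by (metis norm_mult norm_triangle_ineq)
    also have "\<dots> \<le> norm (fst w) * norm x + norm (snd w) * norm x"
      using assms dual_ball_le by (intro add_mono mult_left_mono) auto
    also have "\<dots> = (norm (fst w) + norm (snd w)) * norm x" by (simp add: algebra_simps)
    also have "\<dots> \<le> 1 * norm x" by (rule mult_right_mono) (fact, simp)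
    finally show ?thesis by simp
  qed
  then show ?thesis
    using assms by (auto simp: dual_ball_def combine_def algebra_simps)
qed

lemma continuous_combine_left:
  assumes "g \<in> dual_ball" "w \<in> weights"
  shows "continuous_map ball_topology ball_topology (\<lambda>f. combine w f g)"
    and "continuous_map ball_topology ball_topology (\<lambda>f. combine w g f)"
proof -
  have mult: "continuous_map euclidean euclidean (\<lambda>z. c * z + d)" "continuous_map euclidean euclidean (\<lambda>z. d + c * z)" for c d :: 'k
    by (auto intro!: continuous_intros)
  have "continuous_map ball_topology euclidean (\<lambda>f. combine w f g x)" for x
    using continuous_map_compose[OF continuous_eval[of x] mult(1)[of "fst w" "snd w * g x"]] by (simp add: combine_def o_def)
  then show "continuous_map ball_topology ball_topology (\<lambda>f. combine w f g)"
    unfolding continuous_map_in_subtopology continuous_map_componentwise_UNIV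
    using combine_in_dual_ball assms by auto
  have "continuous_map ball_topology euclidean (\<lambda>f. combine w g f x)" for x
    using continuous_map_compose[OF continuous_eval[of x] mult(2)[of "fst w * g x" "snd w"]] by (simp add: combine_def o_def)
  then show "continuous_map ball_topology ball_topology (\<lambda>f. combine w g f)"
    unfolding continuous_map_in_subtopology continuous_map_componentwise_UNIV
    using combine_in_dual_ball assms by auto
qed

end


section \<open>Saturated sets of coordinates of a Corson dual ball\<close>

locale corson_ball = banach_space_re smul re units
  for smul :: "'k::real_normed_field \<Rightarrow> 'a::banach \<Rightarrow> 'a" and re units +
  fixes \<pi> :: "'g \<Rightarrow> ('a \<Rightarrow> 'k) \<Rightarrow> real"
  assumes compact_ball: "compact_space ball_topology"
    and continuous_coordinate: "continuous_map ball_topology euclideanreal (\<pi> \<gamma>)"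
    and coordinates_separate: "f \<in> dual_ball \<Longrightarrow> g \<in> dual_ball \<Longrightarrow> (\<And>\<gamma>. \<pi> \<gamma> f = \<pi> \<gamma> g) \<Longrightarrow> f = g"
    and countable_support: "f \<in> dual_ball \<Longrightarrow> countable {\<gamma>. \<pi> \<gamma> f \<noteq> 0}"
begin

definition supp :: "('a \<Rightarrow> 'k) \<Rightarrow> 'g set" where
  "supp f = {\<gamma>. \<pi> \<gamma> f \<noteq> 0}"

definition agree :: "'g set \<Rightarrow> ('a \<Rightarrow> 'k) \<Rightarrow> ('a \<Rightarrow> 'k) \<Rightarrow> bool" where
  "agree A f g \<longleftrightarrow> (\<forall>\<gamma>\<in>A. \<pi> \<gamma> f = \<pi> \<gamma> g)"

text \<open>
  \<open>coords\<close> and \<open>vecs\<close> translate between vectors and coordinates: a countable set of coordinates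
  determines the values of functionals at \<open>x\<close>, and a countable set of vectors determines the
  coordinate \<open>\<gamma>\<close>.
\<close>

definition coords :: "'a \<Rightarrow> 'g set" where
  "coords x = (SOME A. countable A \<and> (\<forall>f\<in>dual_ball. \<forall>g\<in>dual_ball. agree A f g \<longrightarrow> f x = g x))"

lemma coords: "countable (coords x)"
  "f \<in> dual_ball \<Longrightarrow> g \<in> dual_ball \<Longrightarrow> agree (coords x) f g \<Longrightarrow> f x = g x"
proof -
  have "\<exists>A. countable A \<and> (\<forall>f\<in>dual_ball. \<forall>g\<in>dual_ball. agree A f g \<longrightarrow> f x = g x)"
    using countably_many_separate[where e = \<pi>, OF compact_ball continuous_coordinate _ continuous_eval[of x]]
      coordinates_separate unfolding agree_def topspace_ball by blast
  from someI_ex[OF this] show "countable (coords x)"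
    "f \<in> dual_ball \<Longrightarrow> g \<in> dual_ball \<Longrightarrow> agree (coords x) f g \<Longrightarrow> f x = g x"
    unfolding coords_def by blast+
qed

definition vecs :: "'g \<Rightarrow> 'a set" where
  "vecs \<gamma> = (SOME V. countable V \<and> (\<forall>f\<in>dual_ball. \<forall>g\<in>dual_ball.
     (\<forall>x\<in>V. re (f x) = re (g x)) \<longrightarrow> \<pi> \<gamma> f = \<pi> \<gamma> g))"

lemma vecs: "countable (vecs \<gamma>)"
  "f \<in> dual_ball \<Longrightarrow> g \<in> dual_ball \<Longrightarrow> (\<And>x. x \<in> vecs \<gamma> \<Longrightarrow> re (f x) = re (g x)) \<Longrightarrow> \<pi> \<gamma> f = \<pi> \<gamma> g"
proof -
  have "f = g" if "f \<in> dual_ball" "g \<in> dual_ball" "\<And>x. re (f x) = re (g x)" for f g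
    using that by (intro re_determines) (auto simp: dual_ball_smul)
  then have "\<exists>V. countable V \<and> (\<forall>f\<in>dual_ball. \<forall>g\<in>dual_ball.
     (\<forall>x\<in>V. re (f x) = re (g x)) \<longrightarrow> \<pi> \<gamma> f = \<pi> \<gamma> g)"
    using countably_many_separate[where e = "\<lambda>x f. re (f x)", OF compact_ball continuous_re_eval _ continuous_coordinate[of \<gamma>]]
    unfolding topspace_ball by blast
  from someI_ex[OF this] show "countable (vecs \<gamma>)"
   "f \<in> dual_ball \<Longrightarrow> g \<in> dual_ball \<Longrightarrow> (\<And>x. x \<in> vecs \<gamma> \<Longrightarrow> re (f x) = re (g x)) \<Longrightarrow> \<pi> \<gamma> f = \<pi> \<gamma> g"
    unfolding vecs_def by blast+
qed

lemma countable_net_exists: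
  assumes "finite F"
  shows "\<exists>D. countable D \<and> D \<subseteq> dual_ball \<and>
    (\<forall>f\<in>dual_ball. \<forall>e>0. \<exists>d\<in>D. \<forall>\<gamma>\<in>F. \<bar>\<pi> \<gamma> d - \<pi> \<gamma> f\<bar> < e)"
proof -
  define s where "s f g = (\<Sum>\<gamma>\<in>F. \<bar>\<pi> \<gamma> f - \<pi> \<gamma> g\<bar>)" for f g
  have cont: "continuous_map ball_topology euclideanreal (s f)" for f
    unfolding s_def using assms
    by (intro continuous_map_sum continuous_map_real_abs continuous_map_diff continuous_coordinate
        continuous_map_canonical_const)
  define W where "W n d = {g \<in> topspace ball_topology. s d g \<in> {..<1 / Suc n}}" for n :: nat and d
  have W: "openin ball_topology (W n d)" for n d
    unfolding W_def by (rule openin_continuous_map_preimage[OF cont]) simp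
  have cover: "dual_ball \<subseteq> (\<Union>d\<in>dual_ball. W n d)" for n
    by (auto simp: s_def W_def)
  have "compactin ball_topology dual_ball"
    using compact_ball by (simp add: compact_space_def)
  then have "\<exists>D. finite D \<and> D \<subseteq> dual_ball \<and> dual_ball \<subseteq> (\<Union>d\<in>D. W n d)" for n
    by (rule compactin_indexed_cover[OF _ W cover]) blast
  then have "\<forall>n. \<exists>D. finite D \<and> D \<subseteq> dual_ball \<and> dual_ball \<subseteq> (\<Union>d\<in>D. W n d)" ..
  from choice[OF this] obtain D where
    D: "\<And>n. finite (D n)" "\<And>n. D n \<subseteq> dual_ball" "\<And>n. dual_ball \<subseteq> (\<Union>d\<in>D n. W n d)"
    by blast
  show ?thesis
  proof (intro exI[of _ "\<Union>n. D n"] conjI ballI allI impI)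
    show "countable (\<Union>n. D n)" using D(1) by (simp add: countable_finite)
    show "(\<Union>n. D n) \<subseteq> dual_ball" using D(2) by blast
    fix f :: "'a \<Rightarrow> 'k" and e :: real assume f: "f \<in> dual_ball" and e: "e > 0"
    obtain n where n: "1 / Suc n < e" using nat_approx_posE[OF e] by auto
    obtain d where d: "d \<in> D n" "s d f < 1 / Suc n" using D(3)[of n] f by (auto simp: W_def)
    have "\<bar>\<pi> \<gamma> d - \<pi> \<gamma> f\<bar> < e" if "\<gamma> \<in> F" for \<gamma>
    proof -
      have "\<bar>\<pi> \<gamma> d - \<pi> \<gamma> f\<bar> \<le> s d f"
        unfolding s_def using assms that by (intro member_le_sum) auto
      then show ?thesis using d(2) n by linarith
    qed
    then show "\<exists>d\<in>\<Union>n. D n. \<forall>\<gamma>\<in>F. \<bar>\<pi> \<gamma> d - \<pi> \<gamma> f\<bar> < e" using d(1) by blast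
  qed
qed

text \<open>
  A countable set of functionals, dense in the dual ball as far as the coordinates in \<open>F\<close> can see.
\<close>

definition net :: "'g set \<Rightarrow> ('a \<Rightarrow> 'k) set" where
  "net F = (SOME D. countable D \<and> D \<subseteq> dual_ball \<and>
    (\<forall>f\<in>dual_ball. \<forall>e>0. \<exists>d\<in>D. \<forall>\<gamma>\<in>F. \<bar>\<pi> \<gamma> d - \<pi> \<gamma> f\<bar> < e))"

lemma net:
  assumes "finite F"
  shows "countable (net F)" "net F \<subseteq> dual_ball"
    "f \<in> dual_ball \<Longrightarrow> e > 0 \<Longrightarrow> \<exists>d\<in>net F. \<forall>\<gamma>\<in>F. \<bar>\<pi> \<gamma> d - \<pi> \<gamma> f\<bar> < e"
  using someI_ex[OF countable_net_exists[OF assms]] unfolding net_def by blast+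

lemma net_dual_ball: "finite F \<Longrightarrow> d \<in> net F \<Longrightarrow> d \<in> dual_ball"
  using net(2) by blast

definition nets :: "'g set \<Rightarrow> ('a \<Rightarrow> 'k) set" where
  "nets F = (\<Union>G\<in>Pow F. net G)"

lemma nets:
  assumes "finite F"
  shows "countable (nets F)" "nets F \<subseteq> dual_ball"
proof -
  have fin: "finite G" if "G \<in> Pow F" for G using that assms finite_subset by auto
  show "countable (nets F)"
    unfolding nets_def using assms by (intro countable_UN net(1) fin) (simp_all add: countable_finite)
  show "nets F \<subseteq> dual_ball" unfolding nets_def using net(2)[OF fin] by blast
qed

text \<open>
  What a saturated set containing \<open>F\<close> has to contain: the supports of combinations of elements of
  the nets, which makes the functionals supported in it a convex symmetric retract, and the
  coordinates of all \<open>x \<in> vecs \<gamma>\<close>, which makes them separated by the vectors they determine.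
\<close>

definition required :: "'g set \<Rightarrow> 'g set" where
  "required F = (\<Union>d\<in>nets F. \<Union>d'\<in>nets F. \<Union>w\<in>weights. supp (combine w d d')) \<union>
     (\<Union>\<gamma>\<in>F. \<Union>x\<in>vecs \<gamma>. coords x)"

lemma countable_required:
  assumes F: "finite F"
  shows "countable (required F)"
proof -
  have "countable (supp (combine w d d'))" if "d \<in> nets F" "d' \<in> nets F" "w \<in> weights" for w d d'
    unfolding supp_def using that nets(2)[OF F]
    by (intro countable_support combine_in_dual_ball) auto
  then have "countable (\<Union>d\<in>nets F. \<Union>d'\<in>nets F. \<Union>w\<in>weights. supp (combine w d d'))"
    by (intro countable_UN nets(1)[OF F] countable_weights)
  moreover have "countable (\<Union>\<gamma>\<in>F. \<Union>x\<in>vecs \<gamma>. coords x)"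
    using countable_finite[OF F] by (intro countable_UN coords(1) vecs(1))
  ultimately show ?thesis by (simp add: required_def)
qed

definition saturated :: "'g set \<Rightarrow> bool" where
  "saturated A \<longleftrightarrow> (\<forall>F. finite F \<and> F \<subseteq> A \<longrightarrow> required F \<subseteq> A)"

definition saturation :: "'g set \<Rightarrow> 'g set" where
  "saturation A = \<Inter>{B. A \<subseteq> B \<and> saturated B}"

lemma saturated_saturation: "saturated (saturation A)"
  unfolding saturation_def saturated_def by blast

lemma saturation_subset: "A \<subseteq> saturation A"
  by (auto simp: saturation_def)

lemma saturation_least: "A \<subseteq> B \<Longrightarrow> saturated B \<Longrightarrow> saturation A \<subseteq> B"
  by (auto simp: saturation_def)

lemma saturation_mono: "A \<subseteq> B \<Longrightarrow> saturation A \<subseteq> saturation B"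
  using saturation_least saturation_subset saturated_saturation by (meson order_trans)

lemma card_of_saturation:
  assumes "Cinfinite r" "|A| \<le>o r"
  shows "|saturation A| \<le>o r"
proof -
  obtain B where B: "A \<subseteq> B" "\<And>F. finite F \<Longrightarrow> F \<subseteq> B \<Longrightarrow> required F \<subseteq> B" "|B| \<le>o r"
    by (rule countably_generated_closure[where S = required, OF assms countable_required], assumption, rule that)
  then have "saturation A \<subseteq> B" by (intro saturation_least) (auto simp: saturated_def)
  from ordLeq_transitive[OF card_of_mono1[OF this] B(3)] show ?thesis .
qed

definition ball_on :: "'g set \<Rightarrow> ('a \<Rightarrow> 'k) set" where
  "ball_on A = {f \<in> dual_ball. supp f \<subseteq> A}"

lemma ball_on_subset: "ball_on A \<subseteq> dual_ball" by (auto simp: ball_on_def)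

lemma ball_on_mono: "A \<subseteq> B \<Longrightarrow> ball_on A \<subseteq> ball_on B" by (auto simp: ball_on_def)

lemma ball_on_outside: "f \<in> ball_on A \<Longrightarrow> \<gamma> \<notin> A \<Longrightarrow> \<pi> \<gamma> f = 0" by (auto simp: ball_on_def supp_def)

lemma ball_on_eqI:
  assumes f: "f \<in> ball_on A" and g: "g \<in> ball_on A" and eq: "agree A f g"
  shows "f = g"
proof (rule coordinates_separate)
  show "f \<in> dual_ball" "g \<in> dual_ball" using f g ball_on_subset by auto
  show "\<pi> \<gamma> f = \<pi> \<gamma> g" for \<gamma>
    using eq ball_on_outside[OF f, of \<gamma>] ball_on_outside[OF g, of \<gamma>] by (cases "\<gamma> \<in> A") (auto simp: agree_def)
qed

lemma closedin_zero_set: "closedin ball_topology {f \<in> topspace ball_topology. \<pi> \<gamma> f \<in> {0}}"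
  by (intro closedin_continuous_map_preimage[OF continuous_coordinate]) simp

lemma closedin_ball_on: "closedin ball_topology (ball_on A)"
proof -
  let ?Z = "\<lambda>\<gamma>. {f \<in> topspace ball_topology. \<pi> \<gamma> f \<in> {0}}"
  have "ball_on A = \<Inter>(insert (topspace ball_topology) (?Z ` (- A)))"
    by (auto simp: ball_on_def supp_def)
  then show ?thesis
    using closedin_zero_set by (simp only:) (intro closedin_Inter, auto)
qed

lemma net_in_ball_on:
  assumes "saturated A" "finite F" "F \<subseteq> A" "d \<in> net F"
  shows "d \<in> ball_on A"
proof -
  have w: "(1, 0) \<in> weights" using units(2) by (auto simp: weights_def)
  have d: "d \<in> nets F" using assms(4) by (auto simp: nets_def)
  have "combine (1, 0) d d = d" by (simp add: combine_def)
  moreover have "supp (combine (1, 0) d d) \<subseteq> required F"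
    unfolding required_def using d w by blast
  ultimately have "supp d \<subseteq> required F" by simp
  then show ?thesis
    using assms net(2)[OF assms(2)] by (auto simp: ball_on_def saturated_def)
qed

text \<open>
  The coordinates of \<open>f\<close>, cut off outside \<open>A\<close>, are approximated on finite sets by elements of the
  nets, which vanish outside \<open>A\<close>; compactness gives a functional having these coordinates. Allowing
  any closed \<open>S\<close> that contains the nets shows at the same time that the nets are dense in
  \<open>ball_on A\<close>.
\<close>

lemma retract_into_closed:
  assumes A: "saturated A" and S: "closedin ball_topology S"
    and D: "\<And>F d. finite F \<Longrightarrow> F \<subseteq> A \<Longrightarrow> d \<in> net F \<Longrightarrow> d \<in> S" and f: "f \<in> dual_ball"
  obtains g where "g \<in> S" "g \<in> ball_on A" "agree A g f"
proof -
  obtain g where g: "g \<in> S" "\<forall>\<gamma>\<in>UNIV. \<pi> \<gamma> g = (if \<gamma> \<in> A then \<pi> \<gamma> f else 0)"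
  proof (rule compact_simultaneous_values[where I = UNIV and r = \<pi> and t = "\<lambda>\<gamma>. if \<gamma> \<in> A then \<pi> \<gamma> f else 0", OF compact_ball S continuous_coordinate])
    fix J :: "'g set" and e :: real assume J: "finite J" "e > 0"
    obtain d where d: "d \<in> net (J \<inter> A)" "\<forall>\<gamma>\<in>J \<inter> A. \<bar>\<pi> \<gamma> d - \<pi> \<gamma> f\<bar> < e"
      using net(3)[of "J \<inter> A" f e] J f by auto
    have "d \<in> ball_on A" using net_in_ball_on[OF A _ _ d(1)] J(1) by simp
    then have "\<forall>\<gamma>\<in>J. \<bar>\<pi> \<gamma> d - (if \<gamma> \<in> A then \<pi> \<gamma> f else 0)\<bar> \<le> e"
      using d(2) ball_on_outside[of d A] J(2) by (auto intro: less_imp_le)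
    moreover have "d \<in> S" using D[of "J \<inter> A" d] d(1) J(1) by auto
    ultimately show "\<exists>d\<in>S. \<forall>\<gamma>\<in>J. \<bar>\<pi> \<gamma> d - (if \<gamma> \<in> A then \<pi> \<gamma> f else 0)\<bar> \<le> e" by blast
  qed
  have "g \<in> dual_ball" using closedin_subset[OF S] g(1) by auto
  then have "g \<in> ball_on A" using g(2) by (auto simp: ball_on_def supp_def)
  then show thesis using g by (intro that[of g]) (auto simp: agree_def)
qed

lemma retract:
  assumes "saturated A" "f \<in> dual_ball"
  obtains g where "g \<in> ball_on A" "agree A g f"
  using retract_into_closed[OF assms(1) closedin_topspace _ assms(2)] net_in_ball_on[OF assms(1)] ball_on_subset
  by (metis subsetD topspace_ball)

lemma ball_on_subset_closed:
  assumes "saturated A" "closedin ball_topology S"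
    and "\<And>F d. finite F \<Longrightarrow> F \<subseteq> A \<Longrightarrow> d \<in> net F \<Longrightarrow> d \<in> S"
  shows "ball_on A \<subseteq> S"
proof
  fix f assume f: "f \<in> ball_on A"
  then have "f \<in> dual_ball" using ball_on_subset by blast
  show "f \<in> S"
  proof (rule retract_into_closed[OF assms(1,2)])
    show "f \<in> dual_ball" by fact
    fix g assume g: "g \<in> S" "g \<in> ball_on A" "agree A g f"
    then show "f \<in> S" using ball_on_eqI[OF g(2) f g(3)] by simp
  qed (rule assms(3))
qed

text \<open>
  On the nets this holds by saturation. Since the operation is continuous in each variable, it
  extends to their closure \<open>ball_on A\<close>, one variable at a time.
\<close>

lemma ball_on_combine:
  assumes A: "saturated A" and w: "w \<in> weights" and f: "f \<in> ball_on A" and g: "g \<in> ball_on A"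
  shows "combine w f g \<in> ball_on A"
proof -
  have zero: "\<pi> \<gamma> (combine w f g) = 0" if \<gamma>: "\<gamma> \<notin> A" for \<gamma>
  proof -
    have cl: "closedin ball_topology {f \<in> topspace ball_topology. \<pi> \<gamma> (h f) \<in> {0}}"
      if "continuous_map ball_topology ball_topology h" for h
      using continuous_map_compose[OF that continuous_coordinate[of \<gamma>]]
      by (intro closedin_continuous_map_preimage) (auto simp: o_def)
    have nets: "\<pi> \<gamma> (combine w d d') = 0"
      if "finite F" "F \<subseteq> A" "d \<in> net F" "finite F'" "F' \<subseteq> A" "d' \<in> net F'" for F F' d d'
    proof -
      have "supp (combine w d d') \<subseteq> required (F \<union> F')"
      proof -
        have "d \<in> nets (F \<union> F')" "d' \<in> nets (F \<union> F')" using that by (auto simp: nets_def)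
        then show ?thesis unfolding required_def using w by blast
      qed
      moreover have "required (F \<union> F') \<subseteq> A" using A that by (simp add: saturated_def)
      ultimately show ?thesis using \<gamma> by (auto simp: supp_def)
    qed
    have step: "\<pi> \<gamma> (combine w d g) = 0" if "finite F" "F \<subseteq> A" "d \<in> net F" for F d
    proof -
      have dB: "d \<in> dual_ball" using net(2) that by blast
      have "ball_on A \<subseteq> {g \<in> topspace ball_topology. \<pi> \<gamma> (combine w d g) \<in> {0}}"
        by (rule ball_on_subset_closed[OF A cl[OF continuous_combine_left(2)[OF dB w]]])
          (use nets[OF that] net_dual_ball in auto)
      then show ?thesis using g by auto
    qed
    have gB: "g \<in> dual_ball" using g ball_on_subset by blast
    have "ball_on A \<subseteq> {f \<in> topspace ball_topology. \<pi> \<gamma> (combine w f g) \<in> {0}}"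
      by (rule ball_on_subset_closed[OF A cl[OF continuous_combine_left(1)[OF gB w]]])
        (use step net_dual_ball in auto)
    then show ?thesis using f by auto
  qed
  have "combine w f g \<in> dual_ball"
    using f g ball_on_subset w by (intro combine_in_dual_ball) auto
  then show ?thesis using zero by (auto simp: ball_on_def supp_def)
qed

lemma ball_on_unit: "saturated A \<Longrightarrow> u \<in> units \<Longrightarrow> f \<in> ball_on A \<Longrightarrow> (\<lambda>x. u * f x) \<in> ball_on A"
  using ball_on_combine[of A "(u, 0)" f f] by (auto simp: weights_def combine_def)

lemma ball_on_midpoint:
  "saturated A \<Longrightarrow> f \<in> ball_on A \<Longrightarrow> g \<in> ball_on A \<Longrightarrow> (\<lambda>x. of_real (1/2) * f x + of_real (1/2) * g x) \<in> ball_on A"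
  using ball_on_combine[of A "(of_real (1/2), of_real (1/2))" f g] by (auto simp: weights_def combine_def)

lemma zero_in_ball_on:
  assumes A: "saturated A"
  shows "(\<lambda>_. 0) \<in> ball_on A"
proof -
  obtain g where g: "g \<in> ball_on A" using retract[OF A zero_in_dual_ball] by blast
  then have "(\<lambda>x. -1 * g x) \<in> ball_on A" using ball_on_unit[OF A units(3)] by blast
  from ball_on_midpoint[OF A g this] show ?thesis by simp
qed

text \<open>
  The vectors that do not distinguish a functional from its retract; these form the subspace which
  corresponds to \<open>A\<close>.
\<close>

definition determined :: "'g set \<Rightarrow> 'a set" where
  "determined A = {x. \<forall>f\<in>dual_ball. \<forall>g\<in>ball_on A. agree A g f \<longrightarrow> g x = f x}"

lemma determinedI: "coords x \<subseteq> A \<Longrightarrow> x \<in> determined A"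
  using coords(2) ball_on_subset unfolding determined_def agree_def by blast

lemma ball_on_dual_ball: "f \<in> ball_on A \<Longrightarrow> f \<in> dual_ball"
  using ball_on_subset by blast

lemma subspace_determined: "Real_Vector_Spaces.subspace (determined A)"
  unfolding real_vector.subspace_def determined_def
  by (auto simp: dual_ball_zero dual_ball_add dual_ball_scaleR ball_on_dual_ball)

lemma closed_determined: "closed (determined A)"
proof -
  have "determined A = (\<Inter>f\<in>dual_ball. \<Inter>g\<in>{g \<in> ball_on A. agree A g f}. {x. g x = f x})"
    by (auto simp: determined_def)
  moreover have "closed {x. g x = f x}" if "f \<in> dual_ball" "g \<in> ball_on A" for f g
    using that ball_on_subset by (intro closed_Collect_eq linear_continuous_on dual_ball_bounded_linear) auto
  ultimately show ?thesis by (auto intro!: closed_INT)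
qed

lemma determined_separates:
  assumes A: "saturated A" and f: "f \<in> ball_on A" and g: "g \<in> ball_on A"
    and eq: "\<And>x. x \<in> determined A \<Longrightarrow> re (f x) = re (g x)"
  shows "f = g"
proof (rule ball_on_eqI[OF f g])
  have "\<pi> \<gamma> f = \<pi> \<gamma> g" if "\<gamma> \<in> A" for \<gamma>
  proof (rule vecs(2))
    fix x assume "x \<in> vecs \<gamma>"
    then have "coords x \<subseteq> required {\<gamma>}" by (auto simp: required_def)
    also have "\<dots> \<subseteq> A" using A that by (simp add: saturated_def)
    finally show "re (f x) = re (g x)" by (intro eq determinedI)
  qed (use f g ball_on_subset in auto)
  then show "agree A f g" by (simp add: agree_def)
qed

lemma norm_attained_on_ball_on:
  assumes A: "saturated A" and x: "x \<in> determined A"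
  obtains g where "g \<in> ball_on A" "g x = of_real (norm x)"
proof -
  obtain f where f: "f \<in> dual_ball" "f x = of_real (norm x)" by (rule norming_functional)
  obtain g where "g \<in> ball_on A" "agree A g f" by (rule retract[OF A f(1)])
  then show thesis using that f x by (auto simp: determined_def)
qed

lemma dyadic_in_ball_on:
  assumes A: "saturated A" and f: "f \<in> ball_on A" and g: "g \<in> ball_on A"
  shows "(\<lambda>x. f x + of_real ((1/2)^n) * (g x - f x)) \<in> ball_on A"
proof (induction n)
  case (Suc n)
  have "(\<lambda>x. of_real (1/2) * f x + of_real (1/2) * (f x + of_real ((1/2)^n) * (g x - f x))) =
        (\<lambda>x. f x + of_real ((1/2)^Suc n) * (g x - f x))"
  proof
    fix x
    have "of_real (1/2) * f x + of_real (1/2) * f x = f x"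
      by (simp flip: distrib_right of_real_add)
    then show "of_real (1/2) * f x + of_real (1/2) * (f x + of_real ((1/2)^n) * (g x - f x)) =
        f x + of_real ((1/2)^Suc n) * (g x - f x)"
      by (simp only: distrib_left power_Suc of_real_mult mult.assoc add.assoc[symmetric])
  qed
  with ball_on_midpoint[OF A f Suc] show ?case by simp
qed (use g in simp)

text \<open>
  The bipolar theorem for the compact convex set \<open>ball_on A\<close>. On finitely many vectors, minimise the
  sum of the squared differences between \<open>\<phi>\<close> and the elements of the set. If the minimum were
  positive, the variational inequality at a minimiser would provide a vector violating the
  hypothesis. Midpoint convexity suffices, as it allows variations of size \<open>(1/2) ^ n\<close>.
\<close>

lemma ball_on_bipolar:
  assumes A: "saturated A" and \<phi>: "\<And>x y. \<phi> (x + y) = \<phi> x + \<phi> y" "\<And>c x. \<phi> (smul c x) = c * \<phi> x"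
    and le: "\<And>x c. (\<And>f. f \<in> ball_on A \<Longrightarrow> re (f x) \<le> c) \<Longrightarrow> re (\<phi> x) \<le> c"
  shows "\<phi> \<in> ball_on A"
proof -
  have \<phi>lin: "linear (\<lambda>x. re (\<phi> x))"
  proof (rule linearI)
    fix r x show "re (\<phi> (r *\<^sub>R x)) = r *\<^sub>R re (\<phi> x)"
      using \<phi>(2)[of "of_real r" x] by (simp add: smul_of_real re_of_real_mult)
  qed (simp add: \<phi>(1) re_add)
  obtain f where f: "f \<in> ball_on A" "\<forall>x\<in>UNIV. re (f x) = re (\<phi> x)"
  proof (rule compact_simultaneous_values[where I = UNIV and r = "\<lambda>x f. re (f x)" and t = "\<lambda>x. re (\<phi> x)",
        OF compact_ball closedin_ball_on[of A] continuous_re_eval])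
    fix J :: "'a set" and e :: real assume J: "finite J" "e > 0"
    define h where "h f = (\<Sum>x\<in>J. (re (f x) - re (\<phi> x))\<^sup>2)" for f
    have cont: "continuous_map ball_topology euclideanreal h"
      unfolding h_def power2_eq_square using J(1)
      by (intro continuous_map_sum continuous_map_real_mult continuous_map_diff continuous_re_eval
          continuous_map_canonical_const)
    have "compactin euclideanreal (h ` ball_on A)"
      by (rule image_compactin[OF closedin_compact_space[OF compact_ball closedin_ball_on] cont])
    then have "compact (h ` ball_on A)" by simp
    moreover have "ball_on A \<noteq> {}" using zero_in_ball_on[OF A] by blast
    ultimately obtain f0 where f0: "f0 \<in> ball_on A" "\<And>f. f \<in> ball_on A \<Longrightarrow> h f0 \<le> h f"
      using compact_attains_inf[of "h ` ball_on A"] by auto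
    define a where "a x = re (f0 x) - re (\<phi> x)" for x
    have variation: "0 \<le> (\<Sum>x\<in>J. a x * (re (f x) - re (f0 x)))" if f: "f \<in> ball_on A" for f
    proof -
      define b where "b x = re (f x) - re (f0 x)" for x
      define s2 where "s2 = (\<Sum>x\<in>J. (b x)\<^sup>2)"
      define s1 where "s1 = (\<Sum>x\<in>J. a x * b x)"
      have "0 \<le> 2 * s1 + (1/2)^n * s2" for n :: nat
      proof -
        let ?t = "(1/2)^n :: real"
        let ?f = "\<lambda>x. f0 x + of_real ?t * (f x - f0 x)"
        have "h f0 \<le> h ?f" by (rule f0(2)[OF dyadic_in_ball_on[OF A f0(1) f]])
        also have "h ?f = (\<Sum>x\<in>J. (a x + ?t * b x)\<^sup>2)"
          unfolding h_def by (intro sum.cong refl) (simp only: re_add re_of_real_mult re_diff a_def b_def, simp add: algebra_simps)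
        also have "\<dots> = (\<Sum>x\<in>J. (a x)\<^sup>2 + 2 * ?t * (a x * b x) + ?t\<^sup>2 * (b x)\<^sup>2)"
          by (intro sum.cong refl) (simp add: power2_eq_square algebra_simps)
        also have "\<dots> = h f0 + 2 * ?t * s1 + ?t\<^sup>2 * s2"
          by (simp add: sum.distrib s1_def s2_def h_def a_def sum_distrib_left)
        finally have "0 \<le> ?t * (2 * s1 + ?t * s2)" by (simp add: power2_eq_square algebra_simps)
        moreover have "0 < ?t" by simp
        ultimately show ?thesis using mult_le_cancel_left_pos[of ?t 0 "2 * s1 + ?t * s2"] by simp
      qed
      moreover have "(\<lambda>n. 2 * s1 + (1/2)^n * s2) \<longlonglongrightarrow> 2 * s1 + 0 * s2"
        by (intro tendsto_intros LIMSEQ_power_zero) simp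
      ultimately have "0 \<le> 2 * s1 + 0 * s2"
        by (intro LIMSEQ_le_const[of _ _ 0]) auto
      then show ?thesis by (simp add: s1_def b_def)
    qed
    (* the vector on which f0 attains its maximum over the set, but the value of \<phi> is larger *)
    define y where "y = (\<Sum>x\<in>J. (- a x) *\<^sub>R x)"
    have ev: "F y = (\<Sum>x\<in>J. - a x * F x)" if "linear F" for F :: "'a \<Rightarrow> real"
      unfolding y_def using that by (simp add: linear_sum linear_scale linear_neg sum_negf)
    have "re (\<phi> y) \<le> re (f0 y)"
    proof (rule le)
      fix f assume f: "f \<in> ball_on A"
      have "re (f y) - re (f0 y) = - (\<Sum>x\<in>J. a x * (re (f x) - re (f0 x)))"
        using ev[OF dual_ball_linear, of f] ev[OF dual_ball_linear, of f0] ball_on_dual_ball[OF f] ball_on_dual_ball[OF f0(1)]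
        by (auto simp: algebra_simps sum_subtractf sum_negf)
      then show "re (f y) \<le> re (f0 y)" using variation[OF f] by simp
    qed
    then have "(\<Sum>x\<in>J. a x * re (f0 x)) \<le> (\<Sum>x\<in>J. a x * re (\<phi> x))"
      using ev[OF \<phi>lin] ev[OF dual_ball_linear, of f0] ball_on_dual_ball[OF f0(1)] by (auto simp: sum_negf)
    then have "(\<Sum>x\<in>J. (a x)\<^sup>2) \<le> 0"
    proof -
      have "(\<Sum>x\<in>J. (a x)\<^sup>2) = (\<Sum>x\<in>J. a x * re (f0 x)) - (\<Sum>x\<in>J. a x * re (\<phi> x))"
        unfolding sum_subtractf[symmetric]
        by (intro sum.cong refl) (simp add: a_def power2_eq_square right_diff_distrib)
      then show ?thesis using \<open>_ \<le> (\<Sum>x\<in>J. a x * re (\<phi> x))\<close> by simp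
    qed
    moreover have "0 \<le> (\<Sum>x\<in>J. (a x)\<^sup>2)" by (simp add: sum_nonneg)
    ultimately have "(\<Sum>x\<in>J. (a x)\<^sup>2) = 0" by simp
    then have "\<forall>x\<in>J. a x = 0" using J(1) by (simp add: sum_nonneg_eq_0_iff)
    then show "\<exists>f\<in>ball_on A. \<forall>x\<in>J. \<bar>re (f x) - re (\<phi> x)\<bar> \<le> e"
      using f0(1) J(2) by (intro bexI[of _ f0]) (auto simp: a_def)
  qed
  have "\<phi> = f"
    using f \<phi>(2) by (intro re_determines) (auto simp: dual_ball_smul ball_on_dual_ball)
  then show ?thesis using f(1) by simp
qed

text \<open>
  Let \<open>q x\<close> be the supremum of \<open>re (f x)\<close> over \<open>f \<in> ball_on A\<close>; it agrees with the norm on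
  \<open>determined A\<close>. Were the \<open>q\<close>-distance of \<open>x0\<close> from \<open>determined A\<close> positive, Hahn-Banach and the
  bipolar theorem would give a nonzero element of \<open>ball_on A\<close> vanishing on \<open>determined A\<close>. Hence the
  distance is zero; it is attained by completeness, and the difference is the vector sought.
\<close>

lemma vector_killed_by_ball_on:
  assumes A: "saturated A" and x0: "x0 \<notin> determined A"
  obtains z where "z \<noteq> 0" "\<And>f. f \<in> ball_on A \<Longrightarrow> f z = 0"
proof -
  define q where "q x = (SUP f\<in>ball_on A. re (f x))" for x
  have ne: "ball_on A \<noteq> {}" using zero_in_ball_on[OF A] by blast
  have bdd: "bdd_above ((\<lambda>f. re (f x)) ` ball_on A)" for x
    by (rule bdd_aboveI2[of _ _ "norm x"]) (simp add: ball_on_dual_ball dual_ball_re_le)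
  have upper: "re (f x) \<le> q x" if "f \<in> ball_on A" for f x
    unfolding q_def by (rule cSUP_upper[OF that bdd])
  have least: "q x \<le> c" if "\<And>f. f \<in> ball_on A \<Longrightarrow> re (f x) \<le> c" for x c
    unfolding q_def by (rule cSUP_least[OF ne that])
  have nonneg: "0 \<le> q x" for x using upper[OF zero_in_ball_on[OF A], of x] by simp
  have q_le: "q x \<le> norm x" for x
    by (rule least) (simp add: ball_on_dual_ball dual_ball_re_le)
  have sub: "sublinear q"
  proof -
    have add: "q (x + y) \<le> q x + q y" for x y
    proof (rule least)
      fix f assume f: "f \<in> ball_on A"
      then show "re (f (x + y)) \<le> q x + q y"
        using upper[OF f, of x] upper[OF f, of y] by (simp add: ball_on_dual_ball dual_ball_add re_add)
    qed
    have "q (c *\<^sub>R x) = c * q x" if "0 \<le> c" for c x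
    proof (rule sublinear_scaleI[of q, OF _ that])
      fix c x assume c: "0 < (c::real)"
      show "q (c *\<^sub>R x) \<le> c * q x"
      proof (rule least)
        fix f assume f: "f \<in> ball_on A"
        then show "re (f (c *\<^sub>R x)) \<le> c * q x"
          using upper[OF f, of x] c by (simp add: ball_on_dual_ball dual_ball_scaleR re_of_real_mult)
      qed
    next
      show "q 0 = 0" using q_le[of 0] nonneg[of 0] by simp
    qed
    then show ?thesis using add by (simp add: sublinear_def)
  qed
  have q_minus: "q (- x) \<le> q x" for x
  proof (rule least)
    fix f assume f: "f \<in> ball_on A"
    have "re (f (- x)) = re (-1 * f x)"
      using f by (simp add: ball_on_dual_ball dual_ball_minus)
    also have "\<dots> \<le> q x"
      using upper[OF ball_on_unit[OF A units(3) f], of x] by simp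
    finally show "re (f (- x)) \<le> q x" .
  qed
  have q_det: "norm x \<le> q x" if x: "x \<in> determined A" for x
  proof -
    obtain g where g: "g \<in> ball_on A" "g x = of_real (norm x)"
      by (rule norm_attained_on_ball_on[OF A x])
    have "re (g x) = norm x" using g(2) re_of_real_mult[of "norm x" 1] re_one by simp
    then show ?thesis using upper[OF g(1), of x] by simp
  qed
  define d where "d = (INF v\<in>determined A. q (x0 - v))"
  have det_ne: "determined A \<noteq> {}" using real_vector.subspace_0[OF subspace_determined] by blast
  have bdd': "bdd_below ((\<lambda>v. q (x0 - v)) ` determined A)"
    using nonneg by (intro bdd_belowI2[of _ 0])
  have "d = 0"
  proof -
    obtain \<psi> where \<psi>: "linear \<psi>" "\<And>x. \<psi> x \<le> q x" "\<And>v. v \<in> determined A \<Longrightarrow> \<psi> v = 0" "\<psi> x0 = d"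
      using hahn_banach_distance[OF sub nonneg subspace_determined, of A x0] unfolding d_def by blast
    obtain \<phi> where \<phi>: "\<And>x y. \<phi> (x + y) = \<phi> x + \<phi> y" "\<And>c x. \<phi> (smul c x) = c * \<phi> x" "\<And>x. re (\<phi> x) = \<psi> x"
      using complexify[OF \<psi>(1)] by blast
    have "\<phi> \<in> ball_on A"
    proof (rule ball_on_bipolar[OF A \<phi>(1,2)])
      fix x c assume "\<And>f. f \<in> ball_on A \<Longrightarrow> re (f x) \<le> c"
      then have "q x \<le> c" by (rule least)
      then show "re (\<phi> x) \<le> c" using \<psi>(2)[of x] by (simp add: \<phi>(3))
    qed
    then have "\<phi> = (\<lambda>_. 0)"
      using \<psi>(3) by (intro determined_separates[OF A _ zero_in_ball_on[OF A]]) (simp_all add: \<phi>(3))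
    then show ?thesis using \<phi>(3)[of x0] \<psi>(4) by simp
  qed
  have "\<exists>v\<in>determined A. q (x0 - v) < 1 / Suc n" for n :: nat
  proof -
    have "(INF v\<in>determined A. q (x0 - v)) < 1 / Suc n" using \<open>d = 0\<close> by (simp add: d_def)
    then show ?thesis by (subst (asm) cINF_less_iff[OF det_ne bdd'])
  qed
  then obtain v where v: "\<And>n. v n \<in> determined A" "\<And>n. q (x0 - v n) < 1 / Suc n" by metis
  have close: "norm (v m - v n) \<le> 1 / Suc m + 1 / Suc n" for m n
  proof -
    have "norm (v m - v n) \<le> q (v m - v n)"
      using v(1) by (intro q_det real_vector.subspace_diff subspace_determined)
    also have "\<dots> = q (- (x0 - v m) + (x0 - v n))" by (simp add: algebra_simps)
    also have "\<dots> \<le> q (- (x0 - v m)) + q (x0 - v n)" by (rule sublinear_add[OF sub])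
    also have "\<dots> \<le> q (x0 - v m) + q (x0 - v n)" using q_minus[of "x0 - v m"] by (intro add_mono order_refl)
    finally show ?thesis using v(2)[of m] v(2)[of n] by linarith
  qed
  have "Cauchy v"
  proof (rule CauchyI)
    fix e :: real assume "0 < e"
    then obtain N where N: "1 / Suc N < e / 2" using nat_approx_posE[of "e / 2"] by auto
    have "norm (v m - v n) < e" if "m \<ge> N" "n \<ge> N" for m n
    proof -
      have "1 / Suc m \<le> 1 / Suc N" "1 / Suc n \<le> 1 / Suc N" using that by (simp_all add: frac_le)
      then show ?thesis using close[of m n] N by linarith
    qed
    then show "\<exists>M. \<forall>m\<ge>M. \<forall>n\<ge>M. norm (v m - v n) < e" by blast
  qed
  then obtain w where w: "v \<longlonglongrightarrow> w" using Cauchy_convergent_iff convergent_def by blast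
  have wdet: "w \<in> determined A"
    using closed_sequentially[OF closed_determined] v(1) w by blast
  have "q (x0 - w) \<le> 0"
  proof (rule LIMSEQ_le_const)
    have "(\<lambda>n. 1 / Suc n + norm (v n - w)) \<longlonglongrightarrow> 0 + norm (w - w)"
      using w LIMSEQ_Suc[OF lim_inverse_n'] by (intro tendsto_intros) (simp_all add: inverse_eq_divide)
    then show "(\<lambda>n. 1 / Suc n + norm (v n - w)) \<longlonglongrightarrow> 0" by simp
    have "q (x0 - w) \<le> 1 / Suc n + norm (v n - w)" for n
    proof -
      have "q (x0 - w) \<le> q (x0 - v n) + q (v n - w)"
        using sublinear_add[OF sub, of "x0 - v n" "v n - w"] by simp
      then show ?thesis using v(2)[of n] q_le[of "v n - w"] by linarith
    qed
    then show "\<exists>N. \<forall>n\<ge>N. q (x0 - w) \<le> 1 / Suc n + norm (v n - w)" by blast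
  qed
  then have re_le0: "re (f (x0 - w)) \<le> 0" if "f \<in> ball_on A" for f
    using upper[OF that, of "x0 - w"] by simp
  show thesis
  proof (rule that[of "x0 - w"])
    show "x0 - w \<noteq> 0" using wdet x0 by auto
    fix f assume f: "f \<in> ball_on A"
    have "re (u * f (x0 - w)) = 0" if u: "u \<in> units" for u
    proof -
      have uf: "(\<lambda>x. u * f x) \<in> ball_on A" by (rule ball_on_unit[OF A u f])
      have "re (u * f (x0 - w)) \<le> 0" using re_le0[OF uf] by simp
      moreover have "re (-1 * (u * f (x0 - w))) \<le> 0"
        using re_le0[OF ball_on_unit[OF A units(3) uf]] by simp
      ultimately show ?thesis by (simp add: re_minus)
    qed
    then show "f (x0 - w) = 0" by (rule units_determine)
  qed
qed

text \<open>
  The vectors in \<open>vecs \<gamma>\<close> for \<open>\<gamma> \<in> A\<close> span a dense subspace: a functional vanishing on all of them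
  agrees with zero on \<open>A\<close>, hence everywhere. Rational combinations then form a dense set.
\<close>

lemma dens_le_of_determined:
  assumes A: "saturated A" and r: "Cinfinite r" "|A| \<le>o r" and all: "determined A = UNIV"
  shows "dens (UNIV :: 'a set) \<le>o r"
proof -
  define W where "W = insert 0 (\<Union>\<gamma>\<in>A. vecs \<gamma>)"
  have "|\<Union>\<gamma>\<in>A. vecs \<gamma>| \<le>o r"
    using countable_ordLeq_Cinfinite[OF vecs(1) r(1)] by (intro UNION_Cinfinite_bound r) simp
  moreover have "|{0::'a}| \<le>o r" by (rule countable_ordLeq_Cinfinite[OF _ r(1)]) simp
  ultimately have "|{0} \<union> (\<Union>\<gamma>\<in>A. vecs \<gamma>)| \<le>o r"
    by (intro Un_Cinfinite_bound r)
  then have W: "|W| \<le>o r" by (simp add: W_def)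
  define S where "S F = (\<Union>x\<in>F. \<Union>y\<in>F. range (\<lambda>t::rat. of_rat t *\<^sub>R x + y))" for F :: "'a set"
  have S: "countable (S F)" if "finite F" for F
    unfolding S_def using countable_finite[OF that] by (intro countable_UN) auto
  obtain E where E: "W \<subseteq> E" "\<And>F. finite F \<Longrightarrow> F \<subseteq> E \<Longrightarrow> S F \<subseteq> E" "|E| \<le>o r"
    by (rule countably_generated_closure[where S = S, OF r(1) W S], assumption, rule that)
  have comb: "of_rat t *\<^sub>R x + y \<in> E" if "x \<in> E" "y \<in> E" for t x y
    using E(2)[of "{x, y}"] that by (auto simp: S_def)
  have zero: "0 \<in> E" using E(1) by (auto simp: W_def)
  have "Real_Vector_Spaces.subspace (closure E)"
    unfolding real_vector.subspace_def
  proof (intro conjI ballI allI)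
    show "0 \<in> closure E" using zero closure_subset by blast
    fix x y assume "x \<in> closure E" "y \<in> closure E"
    then obtain a b where "\<And>n. a n \<in> E" "a \<longlonglongrightarrow> x" "\<And>n. b n \<in> E" "b \<longlonglongrightarrow> y"
      by (auto simp: closure_sequential)
    then have "(\<lambda>n. a n + b n) \<longlonglongrightarrow> x + y" "\<And>n. a n + b n \<in> E"
      using comb[of _ _ 1] by (auto intro: tendsto_add)
    then show "x + y \<in> closure E"
      unfolding closure_sequential by (intro exI[of _ "\<lambda>n. a n + b n"]) simp
  next
    fix c :: real and x assume "x \<in> closure E"
    then obtain a where a: "\<And>n. a n \<in> E" "a \<longlonglongrightarrow> x" by (auto simp: closure_sequential)
    have "\<exists>t. \<bar>of_rat t - c\<bar> < 1 / Suc n" for n :: nat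
    proof -
      obtain t where "c < of_rat t" "of_rat t < c + 1 / Suc n"
        using of_rat_dense[of c "c + 1 / Suc n"] by auto
      then show ?thesis by (intro exI[of _ t]) auto
    qed
    then obtain t where t: "\<And>n. \<bar>of_rat (t n) - c\<bar> < 1 / Suc n" by metis
    have "(\<lambda>n. of_rat (t n)) \<longlonglongrightarrow> c"
    proof (rule LIM_zero_cancel, rule Lim_null_comparison)
      show "\<forall>\<^sub>F n in sequentially. norm (of_rat (t n) - c) \<le> 1 / Suc n"
        using t by (auto intro!: always_eventually less_imp_le)
      show "(\<lambda>n. 1 / real (Suc n)) \<longlonglongrightarrow> 0"
        using LIMSEQ_Suc[OF lim_inverse_n'] by simp
    qed
    then have "(\<lambda>n. of_rat (t n) *\<^sub>R a n) \<longlonglongrightarrow> c *\<^sub>R x" by (intro tendsto_scaleR a)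
    moreover have "of_rat (t n) *\<^sub>R a n \<in> E" for n using comb[OF a(1) zero, of "t n" n] by simp
    ultimately show "c *\<^sub>R x \<in> closure E"
      unfolding closure_sequential by (intro exI[of _ "\<lambda>n. of_rat (t n) *\<^sub>R a n"]) simp
  qed
  note sub = this
  have "closure E = UNIV"
  proof (rule ccontr)
    assume "closure E \<noteq> UNIV"
    then obtain x0 where x0: "x0 \<notin> closure E" by blast
    obtain \<psi> where \<psi>: "linear \<psi>" "\<And>x. \<psi> x \<le> norm x" "\<And>v. v \<in> closure E \<Longrightarrow> \<psi> v = 0"
      "\<psi> x0 = (INF v\<in>closure E. norm (x0 - v))"
      using hahn_banach_distance[OF norm_sublinear norm_ge_zero sub, of x0] by blast
    obtain \<phi> where \<phi>: "\<And>x y. \<phi> (x + y) = \<phi> x + \<phi> y" "\<And>c x. \<phi> (smul c x) = c * \<phi> x" "\<And>x. re (\<phi> x) = \<psi> x"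
      using complexify[OF \<psi>(1)] by blast
    have \<phi>B: "\<phi> \<in> dual_ball" using \<phi> \<psi>(2) by (intro functional_in_dual_ball) auto
    have "agree A (\<lambda>_. 0) \<phi>"
      unfolding agree_def
    proof
      fix \<gamma> assume "\<gamma> \<in> A"
      then have "vecs \<gamma> \<subseteq> closure E" using E(1) closure_subset[of E] by (auto simp: W_def)
      then show "\<pi> \<gamma> (\<lambda>_. 0) = \<pi> \<gamma> \<phi>"
        using \<psi>(3) by (intro vecs(2)[OF zero_in_dual_ball \<phi>B]) (auto simp: \<phi>(3))
    qed
    then have "0 = \<phi> x0"
      using all zero_in_ball_on[OF A] \<phi>B unfolding determined_def by blast
    then have "\<psi> x0 = 0" using \<phi>(3)[of x0] by simp
    moreover have "0 < \<psi> x0"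
    proof -
      have "x0 \<notin> closure (closure E)" using x0 by simp
      then obtain e where "e > 0" "\<forall>v\<in>closure E. \<not> dist v x0 < e"
        unfolding closure_approachable[of x0 "closure E"] by blast
      then have e: "e > 0" "\<And>v. v \<in> closure E \<Longrightarrow> e \<le> norm (x0 - v)"
        by (auto simp: dist_norm norm_minus_commute not_less)
      have "e \<le> \<psi> x0"
        unfolding \<psi>(4) using e(2) zero closure_subset by (intro cINF_greatest) auto
      then show ?thesis using e(1) by simp
    qed
    ultimately show False by simp
  qed
  then have "dens (UNIV :: 'a set) \<le>o |E|"
    by (intro dens_ordLeq) auto
  then show ?thesis by (rule ordLeq_transitive[OF _ E(3)])
qed

end


section \<open>Long sequences with countably supported functionals\<close>

lemma Cinfinite_Plus_nat:
  assumes Y: "|Y| <o \<kappa>" and \<kappa>: "natLeq <o \<kappa>" "Card_order \<kappa>"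
  shows "Cinfinite |Y <+> (UNIV :: nat set)|" "|Y| \<le>o |Y <+> (UNIV :: nat set)|"
    "|Y <+> (UNIV :: nat set)| <o \<kappa>"
proof -
  show "Cinfinite |Y <+> (UNIV :: nat set)|" by (rule Cinfinite_card_of) simp
  show "|Y| \<le>o |Y <+> (UNIV :: nat set)|" by (rule card_of_Plus1)
  have "cinfinite \<kappa>"
    using cinfinite_mono[OF ordLess_imp_ordLeq[OF \<kappa>(1)]] natLeq_cinfinite by blast
  then have inf: "infinite (Field \<kappa>)" by (simp add: cinfinite_def)
  show "|Y <+> (UNIV :: nat set)| <o \<kappa>"
    by (rule card_of_Plus_ordLess_infinite_Field[OF inf \<kappa>(2) Y ordIso_ordLess_trans[OF card_of_nat \<kappa>(1)]])
qed

context corson_ball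
begin

text \<open>
  At stage \<open>a\<close> the coordinates of the earlier vectors generate a saturated set \<open>A\<close> that is too small
  to determine all vectors, so some unit vector is killed by \<open>ball_on A\<close>. For countability of
  supports, let \<open>f (x a) \<noteq> 0\<close> and let \<open>up a\<close> be the saturated set generated after stage \<open>a\<close>. Then \<open>f\<close>
  and its retract to \<open>A\<close> differ at \<open>x a\<close>, so \<open>f\<close> has a nonzero coordinate in \<open>up a - A\<close>. These
  differences are disjoint for distinct stages, while \<open>f\<close> has countable support.
\<close>

theorem long_sequence:
  fixes I :: "'i set"
  assumes L: "wf L" "trans L" "total_on I L" "L \<subseteq> I \<times> I"
    and seg: "\<And>a. a \<in> I \<Longrightarrow> |{b. (b, a) \<in> L}| <o dens (UNIV :: 'a set)"
    and big: "natLeq <o dens (UNIV :: 'a set)"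
  obtains x :: "'i \<Rightarrow> 'a" and B :: "'i \<Rightarrow> ('a \<Rightarrow> 'k) set" where
    "\<And>a. a \<in> I \<Longrightarrow> norm (x a) = 1"
    "\<And>f. f \<in> dual_ball \<Longrightarrow> countable {a \<in> I. f (x a) \<noteq> 0}"
    "\<And>a. B a \<subseteq> dual_ball"
    "\<And>a f. a \<in> I \<Longrightarrow> f \<in> dual_ball \<Longrightarrow> \<exists>g\<in>B a. \<forall>b. (b, a) \<in> L \<longrightarrow> g (x b) = f (x b)"
    "\<And>a b g. a \<in> I \<Longrightarrow> b \<in> I \<Longrightarrow> g \<in> B a \<Longrightarrow> (b, a) \<notin> L \<Longrightarrow> g (x b) = 0"
proof -
  define below where "below a = {b. (b, a) \<in> L}" for a
  define A where "A S x = saturation (\<Union>b\<in>S. coords (x b))" for S and x :: "'i \<Rightarrow> 'a"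
  have A_sat: "saturated (A S x)" for S x
    unfolding A_def by (rule saturated_saturation)
  have A_mono: "A S x \<subseteq> A S' x" if "S \<subseteq> S'" for S S' x
    unfolding A_def using that by (intro saturation_mono) blast
  have A_coords: "x b \<in> determined (A S x)" if "b \<in> S" for b S x
    using that saturation_subset unfolding A_def by (intro determinedI) fast
  define P where "P x a z \<longleftrightarrow>
    (a \<in> I \<longrightarrow> norm z = 1 \<and> (\<forall>f\<in>ball_on (A (below a) x). f z = 0))" for x a z
  have "\<exists>x. \<forall>a. P x a (x a)"
  proof (rule dependent_wf_choice[where P = P, OF L(1)])
    fix x y :: "'i \<Rightarrow> 'a" and a z
    assume eq: "\<And>b. (b, a) \<in> L \<Longrightarrow> x b = y b"
    have "(\<Union>b\<in>below a. coords (x b)) = (\<Union>b\<in>below a. coords (y b))"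
      by (rule SUP_cong) (simp_all add: below_def eq)
    then show "P x a z = P y a z" by (simp only: P_def A_def)
  next
    fix a x
    show "\<exists>z. P x a z"
    proof (cases "a \<in> I")
      case True
      (* adding \<nat> makes the bound infinite at the early stages *)
      let ?r = "|below a <+> (UNIV :: nat set)|"
      note r = Cinfinite_Plus_nat[OF seg[OF True, folded below_def] big Card_order_dens]
      have "|\<Union>b\<in>below a. coords (x b)| \<le>o ?r"
        using countable_ordLeq_Cinfinite[OF coords(1) r(1)] by (intro UNION_Cinfinite_bound r) simp
      then have card: "|A (below a) x| \<le>o ?r"
        unfolding A_def by (rule card_of_saturation[OF r(1)])
      have "determined (A (below a) x) \<noteq> UNIV"
      proof
        assume "determined (A (below a) x) = UNIV"
        then have "dens (UNIV :: 'a set) \<le>o ?r"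
          by (rule dens_le_of_determined[OF A_sat r(1) card])
        then show False using r(3) not_ordLess_ordLeq by blast
      qed
      then obtain x0 where "x0 \<notin> determined (A (below a) x)" by blast
      from vector_killed_by_ball_on[OF A_sat this]
      obtain z where z: "z \<noteq> 0" "\<And>f. f \<in> ball_on (A (below a) x) \<Longrightarrow> f z = 0" by blast
      have "P x a ((1 / norm z) *\<^sub>R z)"
        using z by (simp add: P_def dual_ball_scaleR ball_on_dual_ball)
      then show ?thesis by blast
    qed (simp add: P_def)
  qed
  then obtain x where "\<forall>a. P x a (x a)" ..
  then have x: "norm (x a) = 1" "\<And>f. f \<in> ball_on (A (below a) x) \<Longrightarrow> f (x a) = 0" if "a \<in> I" for a
    using that by (auto simp: P_def)
  define B where "B a = ball_on (A (below a) x)" for a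
  show thesis
  proof (rule that[of x B])
    show "norm (x a) = 1" if "a \<in> I" for a using x(1)[OF that] .
    show "B a \<subseteq> dual_ball" for a unfolding B_def by (rule ball_on_subset)
    show "\<exists>g\<in>B a. \<forall>b. (b, a) \<in> L \<longrightarrow> g (x b) = f (x b)" if a: "a \<in> I" and f: "f \<in> dual_ball" for a f
    proof -
      obtain g where g: "g \<in> ball_on (A (below a) x)" "agree (A (below a) x) g f"
        by (rule retract[OF A_sat f])
      have "g (x b) = f (x b)" if "(b, a) \<in> L" for b
        using A_coords[of b "below a" x] that g f by (auto simp: determined_def below_def)
      then show ?thesis using g(1) by (auto simp: B_def)
    qed
    show "g (x b) = 0" if "a \<in> I" "b \<in> I" "g \<in> B a" "(b, a) \<notin> L" for a b g
    proof -
      have "a = b \<or> (a, b) \<in> L" using that L(3) by (auto simp: total_on_def)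
      then have "below a \<subseteq> below b"
        using L(2) unfolding below_def by (auto dest: transD)
      then have "g \<in> ball_on (A (below b) x)"
        using that(3) ball_on_mono[OF A_mono, of "below a" "below b" x] unfolding B_def by auto
      then show ?thesis by (rule x(2)[OF that(2)])
    qed
    show "countable {a \<in> I. f (x a) \<noteq> 0}" if f: "f \<in> dual_ball" for f
    proof -
      define Z where "Z = {a \<in> I. f (x a) \<noteq> 0}"
      define up where "up a = A (insert a (below a)) x" for a
      have "\<exists>\<gamma>. \<gamma> \<in> supp f \<and> \<gamma> \<in> up a \<and> \<gamma> \<notin> A (below a) x" if a: "a \<in> Z" for a
      proof (rule ccontr)
        assume none: "\<not> ?thesis"
        obtain g where g: "g \<in> ball_on (A (below a) x)" "agree (A (below a) x) g f"
          by (rule retract[OF A_sat f])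
        have sub: "A (below a) x \<subseteq> up a" unfolding up_def by (rule A_mono) blast
        have "agree (up a) g f"
          unfolding agree_def
        proof
          fix \<gamma> assume "\<gamma> \<in> up a"
          then show "\<pi> \<gamma> g = \<pi> \<gamma> f"
            using none g ball_on_outside[OF g(1), of \<gamma>]
            by (cases "\<gamma> \<in> A (below a) x") (auto simp: agree_def supp_def)
        qed
        moreover have "g \<in> ball_on (up a)" using g(1) ball_on_mono[OF sub] by blast
        moreover have "x a \<in> determined (up a)" unfolding up_def by (rule A_coords) simp
        ultimately have "g (x a) = f (x a)" using f by (simp add: determined_def)
        then show False using x(2)[OF _ g(1)] a by (simp add: Z_def)
      qed
      then obtain h where h: "\<And>a. a \<in> Z \<Longrightarrow> h a \<in> supp f"
        "\<And>a. a \<in> Z \<Longrightarrow> h a \<in> up a" "\<And>a. a \<in> Z \<Longrightarrow> h a \<notin> A (below a) x" by metis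
      have neq: "h a \<noteq> h b" if "a \<in> Z" "b \<in> Z" "(a, b) \<in> L" for a b
      proof -
        have "insert a (below a) \<subseteq> below b"
          using that(3) L(2) unfolding below_def by (auto dest: transD)
        then have "up a \<subseteq> A (below b) x" unfolding up_def by (rule A_mono)
        then show ?thesis using h(2)[OF that(1)] h(3)[OF that(2)] by auto
      qed
      have "inj_on h Z"
      proof (rule inj_onI, rule ccontr)
        fix a b assume ab: "a \<in> Z" "b \<in> Z" "h a = h b" "a \<noteq> b"
        then have "(a, b) \<in> L \<or> (b, a) \<in> L" using L(3) by (auto simp: total_on_def Z_def)
        then show False using neq[of a b] neq[of b a] ab by auto
      qed
      moreover have "countable (h ` Z)"
        using countable_support[OF f] h(1) by (intro countable_subset[of "h ` Z" "supp f"]) (auto simp: supp_def)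
      ultimately have "countable Z" using countable_image_inj_on by blast
      then show ?thesis by (simp add: Z_def)
    qed
  qed
qed

end


section \<open>Totality of the functionals of a long sequence\<close>

context banach_space_re
begin

lemma dual_ball_iff: "dual_ball = {f \<in> dual_space smul norm UNIV. dual_norm norm UNIV f \<le> 1}"
proof (rule set_eqI, rule iffI)
  fix f assume f: "f \<in> dual_ball"
  have "dual_norm norm UNIV f \<le> 1"
    unfolding dual_norm_def using order_trans[OF dual_ball_le[OF f]]
    by (intro cSUP_least) (auto intro: exI[of _ 0])
  moreover have "f \<in> dual_space smul norm UNIV"
    using f by (auto simp: dual_space_def dual_ball_def intro!: exI[of _ 1])
  ultimately show "f \<in> {f \<in> dual_space smul norm UNIV. dual_norm norm UNIV f \<le> 1}" by simp
next
  fix f assume "f \<in> {f \<in> dual_space smul norm UNIV. dual_norm norm UNIV f \<le> 1}"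
  then have add: "f (x + y) = f x + f y" and hom: "f (smul c x) = c * f x"
    and "\<exists>B. \<forall>x. norm (f x) \<le> B * norm x" and le: "dual_norm norm UNIV f \<le> 1" for x y c
    by (auto simp: dual_space_def)
  then obtain B where B: "\<And>x. norm (f x) \<le> B * norm x" by blast
  have "norm (f x) \<le> norm x" for x
  proof (cases "x = 0")
    case True
    then show ?thesis using B[of x] by simp
  next
    case False
    let ?z = "smul (of_real (1 / norm x)) x"
    have z: "norm ?z = 1" using False by (simp add: norm_smul norm_divide)
    have bdd: "bdd_above ((\<lambda>x. norm (f x)) ` {x \<in> UNIV. norm x \<le> 1})"
    proof (rule bdd_aboveI2)
      fix x :: 'a assume "x \<in> {x \<in> UNIV. norm x \<le> 1}"
      then have "norm x \<le> 1" by simp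
      then have "B * norm x \<le> \<bar>B\<bar> * 1" by (intro mult_mono) auto
      then show "norm (f x) \<le> \<bar>B\<bar>" using B[of x] by simp
    qed
    have "norm (f ?z) \<le> dual_norm norm UNIV f"
      unfolding dual_norm_def using z by (intro cSUP_upper[OF _ bdd]) simp
    then have "norm (f ?z) \<le> 1" using le by simp
    then show ?thesis using False by (simp add: hom norm_mult norm_divide field_simps)
  qed
  then show "f \<in> dual_ball" using add hom by (simp add: dual_ball_def)
qed

lemma WLD_corson_ball:
  assumes "WLD smul"
  obtains \<pi> :: "('a \<Rightarrow> 'k) \<Rightarrow> ('a \<Rightarrow> 'k) \<Rightarrow> real" where "corson_ball smul re units \<pi>"
proof -
  have "subtopology (weak_star_topology smul norm UNIV)
      {f \<in> dual_space smul norm UNIV. dual_norm norm UNIV f \<le> 1} = ball_topology"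
    unfolding weak_star_topology_def subtopology_subtopology dual_ball_iff by (rule arg_cong2[of _ _ _ _ subtopology]) auto
  then have cc: "corson_compact ball_topology" using assms by (simp add: WLD_def)
  show thesis
  proof (rule corson_compact_coordinates[OF cc], unfold topspace_ball)
    fix \<pi> :: "('a \<Rightarrow> 'k) \<Rightarrow> ('a \<Rightarrow> 'k) \<Rightarrow> real"
    assume 1: "compact_space ball_topology" "\<And>\<gamma>. continuous_map ball_topology euclideanreal (\<pi> \<gamma>)"
      and 2: "\<And>f g. f \<in> dual_ball \<Longrightarrow> g \<in> dual_ball \<Longrightarrow> (\<And>\<gamma>. \<pi> \<gamma> f = \<pi> \<gamma> g) \<Longrightarrow> f = g"
      and 3: "\<And>f. f \<in> dual_ball \<Longrightarrow> countable {\<gamma>. \<pi> \<gamma> f \<noteq> 0}"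
    have "corson_ball smul re units \<pi>"
    proof (unfold_locales, fact 1(1), fact 1(2))
      show "f = g" if "f \<in> dual_ball" "g \<in> dual_ball" "\<And>\<gamma>. \<pi> \<gamma> f = \<pi> \<gamma> g" for f g
        by (rule 2[OF that])
    qed (rule 3)
    then show thesis by (rule that)
  qed
qed

lemma subspace_closure:
  assumes S: "subspace S"
  shows "subspace (closure S)"
proof -
  have "smul c a \<in> closure S" if a: "a \<in> closure S" for c a
  proof -
    obtain s where s: "\<And>n. s n \<in> S" "s \<longlonglongrightarrow> a" using a by (auto simp: closure_sequential)
    have "bounded_linear (smul c)"
      by (rule bounded_linear_intro[of _ "norm c"])
        (auto simp: scale_right_distrib norm_smul mult.commute scale_scale simp flip: smul_of_real)
    then have "(\<lambda>n. smul c (s n)) \<longlonglongrightarrow> smul c a" using s(2) by (rule bounded_linear.tendsto)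
    then show ?thesis
      unfolding closure_sequential using subspace_scale[OF S s(1)] by (intro exI[of _ "\<lambda>n. smul c (s n)"]) simp
  qed
  moreover have "a + b \<in> closure S" if ab: "a \<in> closure S" "b \<in> closure S" for a b
  proof -
    obtain s t where s: "\<And>n. s n \<in> S" "s \<longlonglongrightarrow> a" "\<And>n. t n \<in> S" "t \<longlonglongrightarrow> b"
      using ab by (auto simp: closure_sequential)
    then show ?thesis
      unfolding closure_sequential using subspace_add[OF S s(1,3)]
      by (intro exI[of _ "\<lambda>n. s n + t n"]) (simp add: tendsto_add)
  qed
  moreover have "0 \<in> closure S" using subspace_0[OF S] closure_subset by blast
  ultimately show ?thesis by (simp add: subspace_def)
qed

lemma biorthogonal_expansion:
  assumes f: "\<And>a. a \<in> H \<Longrightarrow> f a \<in> dual_ball"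
    and bi: "\<And>a b. a \<in> H \<Longrightarrow> b \<in> H \<Longrightarrow> f a (x b) = (if a = b then 1 else 0)"
    and v: "v \<in> span (x ` H)"
  obtains T where "finite T" "T \<subseteq> H" "v = (\<Sum>a\<in>T. smul (f a v) (x a))"
proof -
  obtain t r where t: "finite t" "t \<subseteq> x ` H" "v = (\<Sum>a\<in>t. smul (r a) a)"
    using v unfolding span_explicit by blast
  obtain T where T: "T \<subseteq> H" "finite T" "t = x ` T" using finite_subset_image[OF t(1,2)] by blast
  have inj: "inj_on x T"
    using bi T(1) by (intro inj_onI) (metis subsetD zero_neq_one)
  have v: "v = (\<Sum>a\<in>T. smul (r (x a)) (x a))"
    using t(3) T(3) inj by (simp add: sum.reindex)
  have "f a v = r (x a)" if "a \<in> T" for a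
  proof -
    have aH: "a \<in> H" using that T(1) by blast
    have "f a v = (\<Sum>b\<in>T. r (x b) * f a (x b))"
      unfolding v by (rule dual_ball_sum[OF f[OF aH]])
    also have "\<dots> = (\<Sum>b\<in>T. if a = b then r (x b) else 0)"
      using bi aH T(1) by (intro sum.cong) auto
    also have "\<dots> = r (x a)" using that T(2) by simp
    finally show ?thesis .
  qed
  then have "(\<Sum>a\<in>T. smul (f a v) (x a)) = (\<Sum>a\<in>T. smul (r (x a)) (x a))"
    by (intro sum.cong) simp_all
  then have "v = (\<Sum>a\<in>T. smul (f a v) (x a))" unfolding v[symmetric] ..
  with T(2,1) show thesis by (rule that)
qed

text \<open>
  By induction along \<open>L\<close>, all functionals in all \<open>B a\<close> vanish at \<open>y\<close>. For such a \<open>g\<close>, approximate \<open>y\<close>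
  by a finite combination \<open>v\<close> of the sequence. If \<open>m\<close> is the last index of \<open>v\<close> at which \<open>g\<close> matters,
  then \<open>g v\<close> is the sum of the \<open>m\<close>-th term, which is small because \<open>f m y = 0\<close>, and of \<open>h v\<close> with
  \<open>h \<in> B m\<close>, which is small by the induction hypothesis. Taking the last index in \<open>v\<close> makes a
  distinction between successor and limit stages unnecessary.
\<close>

lemma long_sequence_total:
  fixes x :: "'i \<Rightarrow> 'a" and f :: "'i \<Rightarrow> 'a \<Rightarrow> 'k"
  assumes L: "wf L" "trans L" "total_on I L" "L \<subseteq> I \<times> I" and H: "H \<subseteq> I"
    and x: "\<And>a. a \<in> I \<Longrightarrow> norm (x a) = 1"
    and B: "\<And>a. B a \<subseteq> dual_ball"
    and extend: "\<And>a g. a \<in> I \<Longrightarrow> g \<in> dual_ball \<Longrightarrow> \<exists>h\<in>B a. \<forall>b. (b, a) \<in> L \<longrightarrow> h (x b) = g (x b)"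
    and kill: "\<And>a b g. a \<in> I \<Longrightarrow> b \<in> I \<Longrightarrow> g \<in> B a \<Longrightarrow> (b, a) \<notin> L \<Longrightarrow> g (x b) = 0"
    and f: "\<And>a. a \<in> H \<Longrightarrow> f a \<in> dual_ball"
    and bi: "\<And>a b. a \<in> H \<Longrightarrow> b \<in> H \<Longrightarrow> f a (x b) = (if a = b then 1 else 0)"
    and y: "y \<in> closure (span (x ` H))" and zero: "\<And>a. a \<in> H \<Longrightarrow> f a y = 0"
  shows "y = 0"
proof -
  have step: "g y = 0"
    if g: "g \<in> dual_ball" and J: "\<And>b. b \<in> H \<Longrightarrow> b \<notin> J \<Longrightarrow> g (x b) = 0"
      and IH: "\<And>b h. b \<in> H \<Longrightarrow> b \<in> J \<Longrightarrow> h \<in> B b \<Longrightarrow> h y = 0" for g J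
  proof -
    have bound: "norm (g y) \<le> 3 * e" if e: "e > 0" for e
    proof -
      obtain v where v: "v \<in> span (x ` H)" "norm (v - y) < e"
        using y e unfolding closure_approachable dist_norm by blast
      obtain T where T: "finite T" "T \<subseteq> H" "v = (\<Sum>a\<in>T. smul (f a v) (x a))"
        by (rule biorthogonal_expansion[OF f bi v(1)])
      have ev: "h v = (\<Sum>a\<in>T. f a v * h (x a))" if "h \<in> dual_ball" for h
        using dual_ball_sum[OF that, of "\<lambda>a. f a v" x T] T(3) by simp
      have small: "norm (h v) \<le> e" if "h \<in> dual_ball" "h y = 0" for h
        using dual_ball_le[OF that(1), of "v - y"] v(2) that by (simp add: dual_ball_diff)
      have "norm (g v) \<le> 2 * e"
      proof (cases "T \<inter> J = {}")
        case True
        then have "g v = (\<Sum>a\<in>T. 0)"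
          unfolding ev[OF g] using J T(2) by (intro sum.cong) auto
        then show ?thesis using \<open>e > 0\<close> by simp
      next
        case False
        then obtain m where m: "m \<in> T \<inter> J" "\<forall>a\<in>T \<inter> J. a = m \<or> (a, m) \<in> L"
          using finite_total_greatest[of "T \<inter> J" I L] T H L by blast
        then have mH: "m \<in> H" "m \<in> J" "m \<in> T" using T(2) by auto
        then have mI: "m \<in> I" using H by blast
        obtain h where h: "h \<in> B m" "\<And>b. (b, m) \<in> L \<Longrightarrow> h (x b) = g (x b)"
          using extend[OF mI g] by blast
        have hB: "h \<in> dual_ball" using h(1) B by blast
        have mm: "(m, m) \<notin> L" using L(1) by (simp add: wf_not_refl)
        have "f a v * g (x a) = f a v * h (x a) + (if m = a then f m v * g (x m) else 0)" if "a \<in> T" for a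
        proof (cases "a = m")
          case True
          then show ?thesis using kill[OF mI mI h(1) mm] by simp
        next
          case False
          have aI: "a \<in> I" "a \<in> H" using that T(2) H by auto
          show ?thesis
          proof (cases "(a, m) \<in> L")
            case True
            then show ?thesis using h(2) False by simp
          next
            case nL: False
            then have "a \<notin> J" using m(2) that False by blast
            then show ?thesis using J[OF aI(2)] kill[OF mI aI(1) h(1) nL] False by simp
          qed
        qed
        then have "g v = (\<Sum>a\<in>T. f a v * h (x a) + (if m = a then f m v * g (x m) else 0))"
          unfolding ev[OF g] by (intro sum.cong) auto
        also have "\<dots> = h v + f m v * g (x m)"
          using T(1) mH(3) by (simp add: sum.distrib ev[OF hB])
        finally have "norm (g v) \<le> norm (h v) + norm (f m v) * norm (g (x m))"
          by (metis norm_mult norm_triangle_ineq)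
        moreover have "norm (h v) \<le> e" using small[OF hB] IH[OF mH(1,2) h(1)] by simp
        moreover have "norm (f m v) * norm (g (x m)) \<le> e * 1"
          using small[OF f[OF mH(1)] zero[OF mH(1)]] dual_ball_le[OF g, of "x m"] x[OF mI] \<open>e > 0\<close>
          by (intro mult_mono) auto
        ultimately show ?thesis by simp
      qed
      moreover have "norm (g (y - v)) \<le> e"
        using dual_ball_le[OF g, of "y - v"] v(2) by (simp add: norm_minus_commute)
      moreover have "g y = g v + g (y - v)" using g by (simp add: dual_ball_diff)
      ultimately show ?thesis using norm_triangle_ineq[of "g v" "g (y - v)"] by simp
    qed
    have "norm (g y) \<le> 0"
    proof (rule field_le_epsilon)
      fix e :: real assume "0 < e"
      then show "norm (g y) \<le> 0 + e" using bound[of "e / 3"] by simp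
    qed
    then show ?thesis by simp
  qed
  have "a \<in> I \<longrightarrow> (\<forall>g\<in>B a. g y = 0)" for a
    using L(1)
  proof (induction a rule: wf_induct_rule)
    case (less a)
    show ?case
    proof (intro impI ballI)
      fix g assume a: "a \<in> I" and g: "g \<in> B a"
      show "g y = 0"
      proof (rule step[of g "{b. (b, a) \<in> L}"])
        show "g \<in> dual_ball" using g B by blast
        show "g (x b) = 0" if "b \<in> H" "b \<notin> {b. (b, a) \<in> L}" for b
          using kill[OF a _ g] that H by auto
        show "h y = 0" if "b \<in> H" "b \<in> {b. (b, a) \<in> L}" "h \<in> B b" for b h
          using less that H by auto
      qed
    qed
  qed
  then have all: "g y = 0" if "g \<in> dual_ball" for g
    using H by (intro step[of g UNIV]) (auto simp: that)
  obtain g where "g \<in> dual_ball" "g y = of_real (norm y)" by (rule norming_functional)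
  then show ?thesis using all[of g] by simp
qed


section \<open>Auerbach bases of large subspaces\<close>

definition combinations :: "'i set \<Rightarrow> ('i \<Rightarrow> 'a \<Rightarrow> 'k) \<Rightarrow> ('a \<Rightarrow> 'k) set" where
  "combinations H f = {\<lambda>x. \<Sum>a\<in>T. c a * f a x | T c. finite T \<and> T \<subseteq> H}"

lemma combinations_base: "a \<in> H \<Longrightarrow> f a \<in> combinations H f"
  unfolding combinations_def by (rule CollectI, intro exI[of _ "{a}"] exI[of _ "\<lambda>_. 1"]) simp

lemma combinations_add_mult:
  assumes "w \<in> combinations H f" "z \<in> combinations H f"
  shows "(\<lambda>x. w x + d * z x) \<in> combinations H f"
proof -
  obtain T c where T: "finite T" "T \<subseteq> H" "w = (\<lambda>x. \<Sum>a\<in>T. c a * f a x)"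
    using assms(1) by (auto simp: combinations_def)
  obtain T' c' where T': "finite T'" "T' \<subseteq> H" "z = (\<lambda>x. \<Sum>a\<in>T'. c' a * f a x)"
    using assms(2) by (auto simp: combinations_def)
  define e where "e a = (if a \<in> T then c a else 0) + d * (if a \<in> T' then c' a else 0)" for a
  have "w x + d * z x = (\<Sum>a\<in>T \<union> T'. e a * f a x)" for x
  proof -
    have "w x = (\<Sum>a\<in>T \<union> T'. (if a \<in> T then c a else 0) * f a x)"
      unfolding T(3) using T(1) T'(1) by (intro sum.mono_neutral_cong_left) auto
    moreover have "z x = (\<Sum>a\<in>T \<union> T'. (if a \<in> T' then c' a else 0) * f a x)"
      unfolding T'(3) using T(1) T'(1) by (intro sum.mono_neutral_cong_left) auto
    ultimately show ?thesis
      by (simp add: e_def sum_distrib_left sum.distrib algebra_simps)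
  qed
  then show ?thesis
    unfolding combinations_def using T(1,2) T'(1,2)
    by (intro CollectI exI[of _ "T \<union> T'"] exI[of _ e]) auto
qed

lemma combinations_linear:
  assumes f: "\<And>a. a \<in> H \<Longrightarrow> f a \<in> dual_ball" and w: "w \<in> combinations H f"
  shows "w (x + y) = w x + w y" "w (smul c x) = c * w x" "\<exists>B. \<forall>x. norm (w x) \<le> B * norm x"
proof -
  obtain T d where T: "finite T" "T \<subseteq> H" "w = (\<lambda>x. \<Sum>a\<in>T. d a * f a x)"
    using w by (auto simp: combinations_def)
  have fT: "f a \<in> dual_ball" if "a \<in> T" for a using f T(2) that by blast
  have "w (x + y) = (\<Sum>a\<in>T. d a * f a x + d a * f a y)"
    unfolding T(3) using fT by (intro sum.cong) (auto simp: dual_ball_add distrib_left)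
  then show "w (x + y) = w x + w y" by (simp add: T(3) sum.distrib)
  have "w (smul c x) = (\<Sum>a\<in>T. c * (d a * f a x))"
    unfolding T(3) using fT by (intro sum.cong) (auto simp: dual_ball_smul)
  then show "w (smul c x) = c * w x" by (simp add: T(3) sum_distrib_left)
  show "\<exists>B. \<forall>x. norm (w x) \<le> B * norm x"
  proof (intro exI allI)
    fix x
    have "norm (w x) \<le> (\<Sum>a\<in>T. norm (d a * f a x))" unfolding T(3) by (rule norm_sum)
    also have "\<dots> \<le> (\<Sum>a\<in>T. norm (d a) * norm x)"
      using fT by (intro sum_mono) (auto simp: norm_mult dual_ball_le intro!: mult_left_mono)
    finally show "norm (w x) \<le> (\<Sum>a\<in>T. norm (d a)) * norm x" by (simp add: sum_distrib_right)
  qed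
qed

text \<open>
  If the value at a new point \<open>e\<close> cannot be adjusted without changing those on \<open>E\<close>, then the values of
  all combinations at \<open>e\<close> are a fixed linear combination of those on \<open>E\<close>; by totality \<open>e\<close> is the same
  combination of \<open>E\<close>, and \<open>\<phi>\<close> follows.
\<close>

lemma total_functionals_interpolate:
  assumes f: "\<And>a. a \<in> H \<Longrightarrow> f a \<in> dual_ball" and Y: "subspace Y"
    and total: "\<And>y. y \<in> Y \<Longrightarrow> (\<And>a. a \<in> H \<Longrightarrow> f a y = 0) \<Longrightarrow> y = 0"
    and \<phi>: "\<And>x y. x \<in> Y \<Longrightarrow> y \<in> Y \<Longrightarrow> \<phi> (x + y) = \<phi> x + \<phi> y"
      "\<And>c x. x \<in> Y \<Longrightarrow> \<phi> (smul c x) = c * \<phi> x"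
    and E: "finite E" "E \<subseteq> Y"
  shows "\<exists>w\<in>combinations H f. \<forall>y\<in>E. w y = \<phi> y"
  using E
proof (induction E rule: finite_induct)
  case empty
  have "(\<lambda>x. 0) \<in> combinations H f"
    unfolding combinations_def by (rule CollectI, intro exI[of _ "{}"] exI[of _ "\<lambda>_. 0"]) simp
  then show ?case by auto
next
  case (insert e E)
  note lin = combinations_linear[OF f]
  obtain g where g: "g \<in> combinations H f" "\<And>y. y \<in> E \<Longrightarrow> g y = \<phi> y" using insert by auto
  show ?case
  proof (cases "\<forall>w\<in>combinations H f. (\<forall>y\<in>E. w y = 0) \<longrightarrow> w e = 0")
    case False
    then obtain h where h: "h \<in> combinations H f" "\<And>y. y \<in> E \<Longrightarrow> h y = 0" "h e \<noteq> 0" by blast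
    show ?thesis
      using g h by (intro bexI[OF _ combinations_add_mult[OF g(1) h(1), of "(\<phi> e - g e) / h e"]]) auto
  next
    case True
    have "\<exists>c. \<forall>w\<in>combinations H f. w e = (\<Sum>y\<in>E. c y * w y)"
    proof (rule in_span_of_common_kernel[where u = "\<lambda>y w. w y" and v = "\<lambda>w. w e"])
      show "finite E" by fact
      fix w z :: "'a \<Rightarrow> 'k" and c assume "w \<in> combinations H f" "z \<in> combinations H f"
      then have "(\<lambda>x. w x + (- c) * z x) \<in> combinations H f" by (rule combinations_add_mult)
      then show "\<exists>y\<in>combinations H f. y e = w e - c * z e \<and> (\<forall>i\<in>E. y i = w i - c * z i)"
        by (intro bexI[of _ "\<lambda>x. w x + (- c) * z x"]) simp_all
    qed (use True in blast)
    then obtain c where c: "\<And>w. w \<in> combinations H f \<Longrightarrow> w e = (\<Sum>y\<in>E. c y * w y)" by blast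
    have sumY: "(\<Sum>y\<in>E. smul (c y) y) \<in> Y"
      using insert.prems by (intro subspace_sum[OF Y] subspace_scale[OF Y]) auto
    have "e - (\<Sum>y\<in>E. smul (c y) y) = 0"
    proof (rule total)
      show "e - (\<Sum>y\<in>E. smul (c y) y) \<in> Y"
        using insert.prems sumY by (intro subspace_diff[OF Y]) auto
      fix a assume a: "a \<in> H"
      then show "f a (e - (\<Sum>y\<in>E. smul (c y) y)) = 0"
        using c[OF combinations_base[OF a, of f]] dual_ball_sum[OF f[OF a], of c "\<lambda>y. y" E]
        by (simp add: dual_ball_diff f)
    qed
    then have e: "e = (\<Sum>y\<in>E. smul (c y) y)" by simp
    have \<phi>_sum: "\<phi> (\<Sum>y\<in>F. smul (c y) y) = (\<Sum>y\<in>F. c y * \<phi> y)" if "finite F" "F \<subseteq> Y" for F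
      using that
    proof (induction F rule: finite_induct)
      case empty
      show ?case using \<phi>(2)[OF subspace_0[OF Y], of 0] by simp
    next
      case (insert y F)
      then have "(\<Sum>y\<in>F. smul (c y) y) \<in> Y" "smul (c y) y \<in> Y"
        by (auto intro!: subspace_sum[OF Y] subspace_scale[OF Y])
      then show ?case using insert by (simp add: \<phi>)
    qed
    have "g e = (\<Sum>y\<in>E. c y * \<phi> y)"
      using c[OF g(1)] g(2) by (metis (no_types, lifting) sum.cong)
    also have "\<dots> = \<phi> e"
      using \<phi>_sum[OF insert.hyps(1)] insert.prems e by simp
    finally show ?thesis using g by (intro bexI[of _ g]) auto
  qed
qed

lemma restrict_in_dual_space:
  assumes "\<And>x y. w (x + y) = w x + w y" "\<And>c x. w (smul c x) = c * w x" "\<exists>B. \<forall>x. norm (w x) \<le> B * norm x"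
    and Y: "subspace Y"
  shows "restrict w Y \<in> dual_space smul norm Y"
  unfolding dual_space_def using assms(1-3) subspace_add[OF Y] subspace_scale[OF Y] by auto

lemma weak_star_dense:
  assumes f: "\<And>a. a \<in> H \<Longrightarrow> f a \<in> dual_ball" and Y: "subspace Y"
    and total: "\<And>y. y \<in> Y \<Longrightarrow> (\<And>a. a \<in> H \<Longrightarrow> f a y = 0) \<Longrightarrow> y = 0"
    and inj: "inj_on (\<lambda>a. restrict (f a) Y) H"
  shows "weak_star_topology smul norm Y closure_of functional_span Y ((\<lambda>a. restrict (f a) Y) ` H)
    = dual_space smul norm Y"
proof
  let ?D = "dual_space smul norm Y" and ?F = "\<lambda>a. restrict (f a) Y"
  let ?T = "product_topology (\<lambda>_. euclidean) Y :: ('a \<Rightarrow> 'k) topology"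
  have "?D \<subseteq> topspace ?T" by (auto simp: dual_space_def PiE_def)
  then have top: "topspace (weak_star_topology smul norm Y) = ?D"
    by (auto simp: weak_star_topology_def)
  show "weak_star_topology smul norm Y closure_of functional_span Y (?F ` H) \<subseteq> ?D"
    using closure_of_subset_topspace[of "weak_star_topology smul norm Y"] unfolding top .
  have span: "restrict w Y \<in> functional_span Y (?F ` H)" if "w \<in> combinations H f" for w
  proof -
    obtain T c where T: "finite T" "T \<subseteq> H" "w = (\<lambda>x. \<Sum>a\<in>T. c a * f a x)"
      using \<open>w \<in> combinations H f\<close> by (auto simp: combinations_def)
    have injT: "inj_on ?F T" using inj T(2) by (rule inj_on_subset)
    have "restrict w Y = (\<lambda>x\<in>Y. \<Sum>g\<in>?F ` T. c (inv_into T ?F g) * g x)"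
      unfolding T(3) by (rule restrict_ext) (simp add: sum.reindex[OF injT] inv_into_f_f[OF injT])
    then show ?thesis
      unfolding functional_span_def using T(1,2)
      by (intro CollectI exI[of _ "?F ` T"] exI[of _ "\<lambda>g. c (inv_into T ?F g)"]) auto
  qed
  show "?D \<subseteq> weak_star_topology smul norm Y closure_of functional_span Y (?F ` H)"
  proof
    fix \<phi> assume \<phi>: "\<phi> \<in> ?D"
    show "\<phi> \<in> weak_star_topology smul norm Y closure_of functional_span Y (?F ` H)"
      unfolding in_closure_of top
    proof (intro conjI allI impI \<phi>)
      fix V assume V: "\<phi> \<in> V \<and> openin (weak_star_topology smul norm Y) V"
      then obtain S where S: "openin ?T S" "V = S \<inter> ?D"
        unfolding weak_star_topology_def openin_subtopology by blast
      have "\<forall>x\<in>S. \<exists>U. finite {i \<in> Y. U i \<noteq> topspace euclidean} \<and> (\<forall>i\<in>Y. openin euclidean (U i)) \<and>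
          x \<in> PiE Y U \<and> PiE Y U \<subseteq> S"
        using S(1) by (simp only: openin_product_topology_alt)
      moreover have "\<phi> \<in> S" using V S(2) by blast
      ultimately have "\<exists>U. finite {i \<in> Y. U i \<noteq> topspace euclidean} \<and> (\<forall>i\<in>Y. openin euclidean (U i)) \<and>
          \<phi> \<in> PiE Y U \<and> PiE Y U \<subseteq> S" by (rule bspec)
      then obtain U where "finite {i \<in> Y. U i \<noteq> topspace euclidean}"
        and U23: "\<phi> \<in> PiE Y U" "PiE Y U \<subseteq> S" by (elim exE conjE)
      then have U: "finite {i \<in> Y. U i \<noteq> UNIV}" "\<phi> \<in> PiE Y U" "PiE Y U \<subseteq> S" by simp_all
      have "\<exists>w\<in>combinations H f. \<forall>y\<in>{i \<in> Y. U i \<noteq> UNIV}. w y = \<phi> y"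
      proof (rule total_functionals_interpolate[OF f Y])
        show "\<phi> (y + z) = \<phi> y + \<phi> z" if "y \<in> Y" "z \<in> Y" for y z
          using \<phi> that by (simp add: dual_space_def)
        show "\<phi> (smul c y) = c * \<phi> y" if "y \<in> Y" for c y
          using \<phi> that by (simp add: dual_space_def)
      qed (use total U(1) in auto)
      then obtain w where w: "w \<in> combinations H f" "\<And>y. y \<in> Y \<Longrightarrow> U y \<noteq> UNIV \<Longrightarrow> w y = \<phi> y" by auto
      have "restrict w Y \<in> PiE Y U"
      proof (rule PiE_I)
        fix y assume y: "y \<in> Y"
        then show "restrict w Y y \<in> U y" using w(2)[OF y] U(2) by (cases "U y = UNIV") (auto simp: PiE_iff)
      qed simp
      then have "restrict w Y \<in> V"
        using S U(3) restrict_in_dual_space[OF combinations_linear[OF f w(1)] Y] by blast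
      then show "\<exists>g. g \<in> functional_span Y (?F ` H) \<and> g \<in> V" using span[OF w(1)] by blast
    qed
  qed
qed

theorem WLD_large_auerbach_subspace:
  assumes "WLD smul" and large: "cardSuc natLeq <o dens (UNIV :: 'a set)"
  shows "\<exists>Y :: 'a set. closed_subspace smul Y \<and>
    (\<exists>(\<Gamma> :: 'a set) x f. auerbach_basis smul Y \<Gamma> x f) \<and> dens Y =o dens (UNIV :: 'a set)"
proof -
  obtain \<pi> :: "('a \<Rightarrow> 'k) \<Rightarrow> ('a \<Rightarrow> 'k) \<Rightarrow> real" where "corson_ball smul re units \<pi>"
    by (rule WLD_corson_ball[OF assms(1)])
  then interpret corson_ball smul re units \<pi> .
  obtain I :: "'a set" where I: "UNIV \<subseteq> closure I" "dens (UNIV :: 'a set) = |I|"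
    by (rule dens_attained[of "UNIV :: 'a set"])
  have largeI: "cardSuc natLeq <o |I|" using large I(2) by simp
  have "natLeq <o |I|"
    by (rule ordLess_transitive[OF cardSuc_greater[OF natLeq_Card_order] largeI])
  then have big: "natLeq <o dens (UNIV :: 'a set)" using I(2) by simp
  have "uncountable I" unfolding uncountable_iff_cardSuc by (rule ordLess_imp_ordLeq[OF largeI])
  then have infI: "infinite I" using countable_finite by blast
  obtain L where L: "wf L" "trans L" "total_on I L" "L \<subseteq> I \<times> I"
    and seg: "\<And>a. a \<in> I \<Longrightarrow> |{b. (b, a) \<in> L}| <o |I|"
    by (rule cardinal_well_ordering[of I], rule that)
  obtain x :: "'a \<Rightarrow> 'a" and B where x: "\<And>a. a \<in> I \<Longrightarrow> norm (x a) = 1"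
    and cnt: "\<And>f. f \<in> dual_ball \<Longrightarrow> countable {a \<in> I. f (x a) \<noteq> 0}"
    and B: "\<And>a. B a \<subseteq> dual_ball"
    and extend: "\<And>a f. a \<in> I \<Longrightarrow> f \<in> dual_ball \<Longrightarrow> \<exists>g\<in>B a. \<forall>b. (b, a) \<in> L \<longrightarrow> g (x b) = f (x b)"
    and kill: "\<And>a b g. a \<in> I \<Longrightarrow> b \<in> I \<Longrightarrow> g \<in> B a \<Longrightarrow> (b, a) \<notin> L \<Longrightarrow> g (x b) = 0"
    by (rule long_sequence[OF L seg[folded I(2)] big], assumption, rule that)
  have "\<exists>f\<in>dual_ball. f (x a) = of_real (norm (x a))" for a
    using norming_functional[of "x a"] by blast
  then obtain f where f: "\<And>a. f a \<in> dual_ball" and fx: "\<And>a. f a (x a) = of_real (norm (x a))" by metis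
  obtain H where H: "H \<subseteq> I" "|H| =o |I|"
    and free: "\<And>a b. a \<in> H \<Longrightarrow> b \<in> H \<Longrightarrow> a \<noteq> b \<Longrightarrow> b \<notin> {b \<in> I. f a (x b) \<noteq> 0}"
    by (rule free_set_of_countable_set_mapping[OF largeI, of "\<lambda>a. {b \<in> I. f a (x b) \<noteq> 0}"])
      (use cnt f in blast)+
  have bi: "f a (x b) = (if a = b then 1 else 0)" if "a \<in> H" "b \<in> H" for a b
    using that free[of a b] fx[of a] x[of a] H(1) by auto
  define Y where "Y = closure (span (x ` H))"
  have Y: "subspace Y" unfolding Y_def by (intro subspace_closure subspace_span)
  have xY: "x a \<in> Y" if "a \<in> H" for a
    unfolding Y_def using that by (intro subsetD[OF closure_subset] span_base imageI)
  have total: "y = 0" if y: "y \<in> Y" and zero: "\<And>a. a \<in> H \<Longrightarrow> f a y = 0" for y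
  proof (rule long_sequence_total[where x = x and f = f and B = B, OF L H(1)])
    show "y \<in> closure (span (x ` H))" using y by (simp add: Y_def)
    show "f a \<in> dual_ball" for a by (rule f)
  qed (fact x B extend kill bi zero)+
  define F where "F a = restrict (f a) Y" for a
  have FD: "F a \<in> dual_space smul norm Y" for a
    unfolding F_def using f[of a]
    by (intro restrict_in_dual_space Y) (auto simp: dual_ball_add dual_ball_smul dual_ball_le intro!: exI[of _ 1])
  have Fx: "F a (x b) = (if a = b then 1 else 0)" if "a \<in> H" "b \<in> H" for a b
    using bi[OF that] xY[OF that(2)] by (simp add: F_def)
  have injF: "inj_on F H"
    using Fx by (intro inj_onI) (metis zero_neq_one)
  have norm_F: "dual_norm norm Y (F a) = 1" if a: "a \<in> H" for a
    unfolding dual_norm_def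
  proof (rule antisym)
    have le: "norm (F a y) \<le> 1" if "y \<in> {y \<in> Y. norm y \<le> 1}" for y
      using that order_trans[OF dual_ball_le[OF f]] by (simp add: F_def)
    show "(SUP y\<in>{y \<in> Y. norm y \<le> 1}. norm (F a y)) \<le> 1"
      using le subspace_0[OF Y] by (intro cSUP_least) (auto intro: exI[of _ 0])
    have "norm (F a (x a)) \<le> (SUP y\<in>{y \<in> Y. norm y \<le> 1}. norm (F a y))"
      using le xY[OF a] x[of a] a H(1) by (intro cSUP_upper bdd_aboveI2[of _ _ 1]) auto
    then show "1 \<le> (SUP y\<in>{y \<in> Y. norm y \<le> 1}. norm (F a y))" using Fx[OF a a] by simp
  qed
  have "biorthogonal_system smul norm Y H x F"
    unfolding biorthogonal_system_def using xY FD Fx by simp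
  moreover have "weak_star_topology smul norm Y closure_of functional_span Y (F ` H) = dual_space smul norm Y"
    using weak_star_dense[OF f Y total injF[unfolded F_def]] unfolding F_def by simp
  ultimately have "auerbach_basis smul Y H x F"
    unfolding auerbach_basis_def M_basis_def auerbach_system_def
    using norm_F x H(1) by (auto simp: Y_def)
  moreover have "closed_subspace smul Y" using Y by (simp add: closed_subspace_def Y_def)
  moreover have "dens Y =o dens (UNIV :: 'a set)"
    unfolding ordIso_iff_ordLeq
  proof
    show "dens Y \<le>o dens (UNIV :: 'a set)"
      unfolding I(2) using I(1) by (intro dens_mono_ordLeq infI) auto
    obtain D where D: "D \<subseteq> Y" "Y \<subseteq> closure D" "dens Y = |D|" by (rule dens_attained[of Y])
    (* the vectors x a are at mutual distance at least 1, so a dense set has a separate point near each *)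
    have "\<exists>d\<in>D. dist d (x a) < 1 / 2" if "a \<in> H" for a
    proof -
      have "x a \<in> closure D" using xY[OF that] D(2) by blast
      then have "\<forall>e>0. \<exists>d\<in>D. dist d (x a) < e" unfolding closure_approachable .
      then show ?thesis by (rule allE[of _ "1 / 2"]) simp
    qed
    then obtain d where d: "\<And>a. a \<in> H \<Longrightarrow> d a \<in> D" "\<And>a. a \<in> H \<Longrightarrow> dist (d a) (x a) < 1 / 2" by metis
    have "inj_on d H"
    proof (rule inj_onI, rule ccontr)
      fix a b assume ab: "a \<in> H" "b \<in> H" "d a = d b" "a \<noteq> b"
      have "1 \<le> norm (x a - x b)"
        using dual_ball_le[OF f, of a "x a - x b"] bi[OF ab(1,1)] bi[OF ab(1,2)] ab(4) f
        by (simp add: dual_ball_diff)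
      moreover have "dist (x a) (x b) < 1"
        using dist_triangle_half_r[of "d a" "x a" 1 "x b"] d(2)[OF ab(1)] d(2)[OF ab(2)] ab(3) by simp
      ultimately show False by (simp add: dist_norm)
    qed
    then have "|H| \<le>o |D|" using d(1) card_of_ordLeq by blast
    then show "dens (UNIV :: 'a set) \<le>o dens Y"
      unfolding I(2) D(3) by (rule ordIso_ordLeq_trans[OF ordIso_symmetric[OF H(2)]])
  qed
  ultimately show ?thesis by blast
qed

end

lemma banach_space_re_real: "banach_space_re (scaleR :: real \<Rightarrow> 'a::banach \<Rightarrow> 'a) id {1, -1}"
proof -
  interpret banach_space_over "scaleR :: real \<Rightarrow> 'a \<Rightarrow> 'a" by (rule banach_space_over_scaleR)
  show ?thesis
  proof (unfold_locales, goal_cases)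
    case (4 c)
    show ?case by (rule exI[of _ "if c < 0 then -1 else 1"]) auto
  next
    case (10 c)
    from 10[of 1] show ?case by simp
  next
    case (11 \<psi>)
    then show ?case by (intro exI[of _ \<psi>]) (auto simp: linear_add linear_scale)
  qed auto
qed

lemma banach_space_re_complex:
  fixes smul :: "complex \<Rightarrow> 'a::banach \<Rightarrow> 'a"
  assumes "banach_space_over smul"
  shows "banach_space_re smul Re {1, -1, \<i>}"
proof -
  interpret banach_space_over smul by fact
  show ?thesis
  proof (unfold_locales, goal_cases)
    case (3 c)
    show ?case by (rule abs_Re_le_cmod)
  next
    case (4 c)
    show ?case
    proof (cases "c = 0")
      case False
      then have "cnj c / of_real (norm c) * c = of_real (norm c)"
        by (simp add: complex_norm_square[symmetric] power2_eq_square mult.commute field_simps)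
      then show ?thesis
        using False by (intro exI[of _ "cnj c / of_real (norm c)"]) (simp add: norm_divide)
    qed (auto intro: exI[of _ 1])
  next
    case (5 c)
    then have "(Re c)\<^sup>2 = (Re c)\<^sup>2 + (Im c)\<^sup>2" by (metis cmod_power2)
    then show ?case using 5 by (simp add: complex_eq_iff)
  next
    case (10 c)
    from 10[of 1] 10[of \<i>] show ?case by (simp add: complex_eq_iff)
  next
    case (11 \<psi>)
    define \<phi> where "\<phi> x = Complex (\<psi> x) (- \<psi> (smul \<i> x))" for x
    have "\<phi> (smul c x) = c * \<phi> x" for c x
    proof -
      have c: "smul c y = Re c *\<^sub>R y + Im c *\<^sub>R smul \<i> y" for y
      proof -
        have "smul c y = smul (of_real (Re c) + of_real (Im c) * \<i>) y" by (simp add: complex_eq mult.commute)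
        then show ?thesis by (simp add: scale_left_distrib smul_of_real flip: scale_scale)
      qed
      have ii: "smul \<i> (smul \<i> x) = - x" by (simp add: scale_scale)
      have "smul \<i> (smul c x) = smul c (smul \<i> x)" by (simp add: scale_scale mult.commute)
      then show ?thesis
        using c[of x] c[of "smul \<i> x"] 11
        by (simp add: \<phi>_def ii complex_eq_iff linear_add linear_scale linear_neg linear_diff)
    qed
    moreover have "\<phi> (x + y) = \<phi> x + \<phi> y" for x y
      using 11 by (simp add: \<phi>_def complex_eq_iff linear_add scale_right_distrib)
    ultimately show ?case by (intro exI[of _ \<phi>]) (auto simp: \<phi>_def)
  qed (auto simp: algebra_simps)
qed


section \<open>A renorming of the space of null families\<close>

lift_definition coordinate :: "'g \<Rightarrow> 'g c0 \<Rightarrow>\<^sub>L real" is "\<lambda>\<gamma> x. apply_c0 x \<gamma>"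
  by (rule bounded_linear_intro[of _ 1])
    (use abs_le_norm_c0 in \<open>auto simp: plus_c0.rep_eq scaleR_c0.rep_eq\<close>)

lemma c0_eqI: "(\<And>\<gamma>. apply_c0 x \<gamma> = apply_c0 y \<gamma>) \<Longrightarrow> x = y"
  by (simp add: apply_c0_inject[symmetric] fun_eq_iff)

lemma c0_nonzero_coordinate: "w \<noteq> 0 \<Longrightarrow> \<exists>\<gamma>. apply_c0 w \<gamma> \<noteq> 0"
  using c0_eqI[of w 0] by (auto simp: zero_c0.rep_eq)

lemma finite_large_coordinates: "e > 0 \<Longrightarrow> finite {\<gamma>. e \<le> \<bar>apply_c0 x \<gamma>\<bar>}"
  using apply_c0[of x] by blast

lemma countable_support_c0: "countable {\<gamma>. apply_c0 x \<gamma> \<noteq> 0}"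
proof -
  have "{\<gamma>. apply_c0 x \<gamma> \<noteq> 0} \<subseteq> (\<Union>n. {\<gamma>. 1 / Suc n \<le> \<bar>apply_c0 x \<gamma>\<bar>})"
  proof
    fix \<gamma> assume "\<gamma> \<in> {\<gamma>. apply_c0 x \<gamma> \<noteq> 0}"
    then obtain n where "1 / Suc n < \<bar>apply_c0 x \<gamma>\<bar>"
      using nat_approx_posE[of "\<bar>apply_c0 x \<gamma>\<bar>"] by auto
    then show "\<gamma> \<in> (\<Union>n. {\<gamma>. 1 / Suc n \<le> \<bar>apply_c0 x \<gamma>\<bar>})" by (auto intro: less_imp_le)
  qed
  moreover have "countable (\<Union>n. {\<gamma>. 1 / Suc n \<le> \<bar>apply_c0 x \<gamma>\<bar>})"
    by (rule countable_UN[OF _ countable_finite[OF finite_large_coordinates]]) simp_all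
  ultimately show ?thesis by (rule countable_subset)
qed

lemma dense_open_Inter:
  fixes \<G> :: "'a::complete_space set set"
  assumes "countable \<G>" "\<And>T. T \<in> \<G> \<Longrightarrow> open T \<and> closure T = UNIV"
  shows "closure (\<Inter>\<G>) = UNIV"
proof -
  have "Met_TC.mcomplete TYPE('a)" by (simp add: complete_UNIV)
  from Met_TC.metric_Baire_category[OF this assms(1)] show ?thesis
    using assms(2) by simp
qed

text \<open>
  By the Baire category theorem: for \<open>w \<noteq> 0\<close>, the functionals not vanishing at \<open>w\<close> form a dense open
  set.
\<close>

lemma functional_avoiding_hyperplanes:
  fixes W :: "'g c0 set"
  assumes W: "countable W" "0 \<notin> W" and e: "e > 0"
  obtains \<phi> :: "'g c0 \<Rightarrow>\<^sub>L real" where "norm (\<phi> - \<phi>0) < e" "\<And>w. w \<in> W \<Longrightarrow> blinfun_apply \<phi> w \<noteq> 0"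
proof -
  define T where "T w = {\<phi> :: 'g c0 \<Rightarrow>\<^sub>L real. blinfun_apply \<phi> w \<noteq> 0}" for w
  have "open (T w) \<and> closure (T w) = UNIV" if w: "w \<in> W" for w
  proof
    show "open (T w)" unfolding T_def by (intro open_Collect_neq continuous_intros)
    have "w \<noteq> 0" using w W(2) by blast
    then obtain \<gamma> where \<gamma>: "apply_c0 w \<gamma> \<noteq> 0" using c0_nonzero_coordinate by blast
    have "\<phi> \<in> closure (T w)" for \<phi>
    proof (cases "\<phi> \<in> T w")
      case True
      then show ?thesis using closure_subset by blast
    next
      case False
      have "(\<lambda>n. \<phi> + (1 / Suc n) *\<^sub>R coordinate \<gamma>) \<longlonglongrightarrow> \<phi> + 0 *\<^sub>R coordinate \<gamma>"
        using LIMSEQ_Suc[OF lim_inverse_n'] by (intro tendsto_intros) (simp add: inverse_eq_divide)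
      moreover have "\<phi> + (1 / Suc n) *\<^sub>R coordinate \<gamma> \<in> T w" for n
        using False \<gamma> by (simp add: T_def blinfun.add_left blinfun.scaleR_left coordinate.rep_eq)
      ultimately show ?thesis
        unfolding closure_sequential
        by (intro exI[of _ "\<lambda>n. \<phi> + (1 / Suc n) *\<^sub>R coordinate \<gamma>"]) simp
    qed
    then show "closure (T w) = UNIV" by blast
  qed
  then have "closure (\<Inter>(T ` W)) = UNIV"
    using W(1) by (intro dense_open_Inter) auto
  then have "\<phi>0 \<in> closure (\<Inter>(T ` W))" by simp
  then obtain \<phi> where "\<phi> \<in> \<Inter>(T ` W)" "dist \<phi> \<phi>0 < e"
    using e unfolding closure_approachable by blast
  then show thesis by (intro that[of \<phi>]) (auto simp: T_def dist_norm)
qed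

definition infinite_dimensional :: "'a::real_vector set \<Rightarrow> bool" where
  "infinite_dimensional S \<longleftrightarrow> (\<forall>T. finite T \<longrightarrow> \<not> S \<subseteq> span T)"

lemma infinite_dimensional_span:
  "infinite_dimensional S \<Longrightarrow> finite T \<Longrightarrow> \<not> span S \<subseteq> span T"
  using span_superset[of S] unfolding infinite_dimensional_def by blast

lemma biorthogonal_coefficient:
  fixes x :: "'i \<Rightarrow> 'a::real_vector"
  assumes f: "linear (f a)" and bi: "\<And>b. b \<in> G \<Longrightarrow> f a (x b) = (if a = b then 1 else (0::real))"
    and t: "finite t" "t \<subseteq> x ` G" and a: "a \<in> G" "x a \<in> t"
  shows "f a (\<Sum>v\<in>t. r v *\<^sub>R v) = r (x a)"
proof -
  have "f a v = (if v = x a then 1 else 0)" if v: "v \<in> t" for v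
  proof -
    obtain b where "b \<in> G" "v = x b" using v t(2) by blast
    then show ?thesis using bi[of b] bi[OF a(1)] by auto
  qed
  then have "(\<Sum>v\<in>t. r v * f a v) = (\<Sum>v\<in>t. if v = x a then r v else 0)"
    by (intro sum.cong) auto
  then show ?thesis using t(1) a(2) by (simp add: linear_sum[OF f] linear_scale[OF f])
qed

lemma biorthogonal_infinite_dimensional:
  fixes x :: "'i \<Rightarrow> 'a::real_vector"
  assumes f: "\<And>a. a \<in> G \<Longrightarrow> linear (f a)" and inf: "infinite G"
    and bi: "\<And>a b. a \<in> G \<Longrightarrow> b \<in> G \<Longrightarrow> f a (x b) = (if a = b then 1 else (0::real))"
  shows "infinite_dimensional (x ` G)"
proof -
  have inj: "inj_on x G"
    using bi by (intro inj_onI) (metis zero_neq_one)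
  have "independent (x ` G)"
  proof
    assume "dependent (x ` G)"
    then obtain t u where t: "finite t" "t \<subseteq> x ` G" "(\<Sum>v\<in>t. u v *\<^sub>R v) = 0" "\<exists>v\<in>t. u v \<noteq> 0"
      unfolding dependent_explicit by blast
    then obtain a where a: "a \<in> G" "x a \<in> t" "u (x a) \<noteq> 0" by blast
    have "f a (\<Sum>v\<in>t. u v *\<^sub>R v) = u (x a)"
      using f bi a t(1,2) by (intro biorthogonal_coefficient[of f a G]) auto
    then show False using t(3) a(3) linear_0[OF f[OF a(1)]] by simp
  qed
  moreover have "infinite (x ` G)" using inf inj finite_imageD by blast
  ultimately show ?thesis
    unfolding infinite_dimensional_def using independent_span_bound by blast
qed

text \<open>
  Code reals as sets of natural numbers and sequences of such sets by pairing.
\<close>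

lemma continuum_sequences_inj: "\<exists>J :: (nat \<Rightarrow> real) \<Rightarrow> real. inj J"
proof -
  obtain b :: "nat set \<Rightarrow> real" where b: "bij b"
    using nat_sets_eqpoll_reals by (auto simp: eqpoll_def)
  define J where "J f = b {p. snd (prod_decode p) \<in> inv b (f (fst (prod_decode p)))}" for f :: "nat \<Rightarrow> real"
  have "inj J"
  proof (rule injI, rule ext)
    fix f g n assume "J f = J g"
    then have eq: "{p. snd (prod_decode p) \<in> inv b (f (fst (prod_decode p)))} =
        {p. snd (prod_decode p) \<in> inv b (g (fst (prod_decode p)))}"
      using b by (simp add: J_def bij_is_inj inj_eq)
    have "m \<in> inv b (f n) \<longleftrightarrow> m \<in> inv b (g n)" for m
      using eq[THEN eqset_imp_iff, of "prod_encode (n, m)"] by simp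
    then have "inv b (f n) = inv b (g n)" by blast
    then show "f n = g n" using b by (metis bij_inv_eq_iff)
  qed
  then show ?thesis by blast
qed

text \<open>
  An element of \<open>c\<^sub>0\<close> has countable support, so a sequence enumerating the support together with the
  sequence of values encodes it; the two are interleaved into one sequence of reals.
\<close>

lemma c0_sequences_inj:
  fixes k :: "'g \<Rightarrow> real"
  assumes k: "inj k"
  shows "\<exists>J :: (nat \<Rightarrow> 'g c0) \<Rightarrow> real. inj J"
proof -
  obtain J :: "(nat \<Rightarrow> real) \<Rightarrow> real" where J: "inj J" using continuum_sequences_inj by blast
  have "\<exists>g :: nat \<Rightarrow> 'g. {\<gamma>. apply_c0 x \<gamma> \<noteq> 0} \<subseteq> range g" for x
    using countable_support_c0[of x] by (metis empty_subsetI range_from_nat_into order_refl)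
  then obtain g :: "'g c0 \<Rightarrow> nat \<Rightarrow> 'g" where g: "\<And>x. {\<gamma>. apply_c0 x \<gamma> \<noteq> 0} \<subseteq> range (g x)" by metis
  define c where "c x = (\<lambda>n. if even n then k (g x (n div 2)) else apply_c0 x (g x (n div 2)))" for x
  have "inj c"
  proof (rule injI, rule c0_eqI)
    fix x y \<gamma> assume eq: "c x = c y"
    have gx: "g x n = g y n" for n
      using fun_cong[OF eq, of "2 * n"] k by (simp add: c_def inj_eq)
    have "apply_c0 x (g x n) = apply_c0 y (g x n)" for n
      using fun_cong[OF eq, of "2 * n + 1"] gx by (simp add: c_def)
    moreover have "g x = g y" using gx by (rule ext)
    ultimately show "apply_c0 x \<gamma> = apply_c0 y \<gamma>"
    proof (cases "\<gamma> \<in> range (g x)")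
      case False
      then have "\<gamma> \<notin> {\<gamma>. apply_c0 x \<gamma> \<noteq> 0}" "\<gamma> \<notin> {\<gamma>. apply_c0 y \<gamma> \<noteq> 0}"
        using g[of x] g[of y] \<open>g x = g y\<close> by auto
      then show ?thesis by simp
    qed auto
  qed
  then have Jc: "inj (\<lambda>x. J (c x))" using J by (simp add: inj_def)
  have "inj (\<lambda>s. J (\<lambda>n. J (c (s n))))"
  proof (rule injI, rule ext)
    fix s t n assume "J (\<lambda>n. J (c (s n))) = J (\<lambda>n. J (c (t n)))"
    then have "(\<lambda>n. J (c (s n))) = (\<lambda>n. J (c (t n)))" using J by (simp add: inj_eq)
    from fun_cong[OF this, of n] show "s n = t n" by (rule injD[OF Jc])
  qed
  then show ?thesis by blast
qed

lemma CH_index: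
  assumes CH: "|UNIV :: real set| =o cardSuc natLeq"
  shows "\<exists>idx :: (nat \<Rightarrow> omega1 c0) \<Rightarrow> omega1. inj idx"
proof -
  have "|UNIV :: real set| =o |UNIV :: omega1 set|"
    by (rule ordIso_transitive[OF CH ordIso_symmetric[OF card_omega1]])
  then obtain j :: "real \<Rightarrow> omega1" where j: "bij j" using card_of_ordIso by blast
  have "inj (inv j)" using j by (simp add: bij_imp_bij_inv bij_is_inj)
  from c0_sequences_inj[OF this] obtain J :: "(nat \<Rightarrow> omega1 c0) \<Rightarrow> real" where "inj J" by blast
  then have "inj (j \<circ> J)" using j by (simp add: inj_compose bij_is_inj)
  then show ?thesis by blast
qed

text \<open>
  At stage \<open>a\<close> there are only countably many pairs of a sequence with an earlier index and a finite set
  \<open>E\<close> of earlier stages. For each of them pick a nonzero vector in the span of the sequence that is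
  annihilated by the functionals from \<open>E\<close>, and choose \<open>\<phi> a\<close> to be nonzero at all these vectors.
\<close>

lemma generic_functionals:
  assumes L: "wf L" and below: "\<And>a :: 'g. countable {b. (b, a) \<in> L}"
    and idx: "inj (idx :: (nat \<Rightarrow> 'g c0) \<Rightarrow> 'g)"
  obtains \<phi> :: "'g \<Rightarrow> 'g c0 \<Rightarrow>\<^sub>L real" where "\<And>a. norm (\<phi> a - coordinate a) \<le> 1 / 4"
    "\<And>a s E. (idx s, a) \<in> L \<Longrightarrow> infinite_dimensional (range s) \<Longrightarrow> finite E \<Longrightarrow> E \<subseteq> {b. (b, a) \<in> L} \<Longrightarrow>
       \<exists>w\<in>span (range s). (\<forall>b\<in>E. blinfun_apply (\<phi> b) w = 0) \<and> blinfun_apply (\<phi> a) w \<noteq> 0"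
proof -
  define Q where "Q a = {(s, E). (idx s, a) \<in> L \<and> infinite_dimensional (range s) \<and> finite E \<and> E \<subseteq> {b. (b, a) \<in> L}}" for a
  define P where "P f a z \<longleftrightarrow> norm (z - coordinate a) \<le> 1 / 4 \<and>
    (\<forall>(s, E)\<in>Q a. \<exists>w\<in>span (range s). (\<forall>b\<in>E. blinfun_apply (f b) w = 0) \<and> blinfun_apply z w \<noteq> 0)"
    for f :: "'g \<Rightarrow> 'g c0 \<Rightarrow>\<^sub>L real" and a z
  have "\<exists>f. \<forall>a. P f a (f a)"
  proof (rule dependent_wf_choice[where P = P, OF L])
    fix f g :: "'g \<Rightarrow> 'g c0 \<Rightarrow>\<^sub>L real" and a z
    assume eq: "\<And>b. (b, a) \<in> L \<Longrightarrow> f b = g b"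
    have zeros: "(\<forall>b\<in>snd q. blinfun_apply (f b) w = 0) = (\<forall>b\<in>snd q. blinfun_apply (g b) w = 0)"
      if "q \<in> Q a" for q w
      using that eq by (intro ball_cong refl) (auto simp: Q_def)
    show "P f a z = P g a z"
      unfolding P_def split_beta by (intro conj_cong refl ball_cong bex_cong zeros)
  next
    fix a and f :: "'g \<Rightarrow> 'g c0 \<Rightarrow>\<^sub>L real"
    have "\<exists>w\<in>span (range s). w \<noteq> 0 \<and> (\<forall>b\<in>E. blinfun_apply (f b) w = 0)" if q: "(s, E) \<in> Q a" for s E
    proof -
      have "\<exists>w\<in>span (range s). w \<noteq> 0 \<and> (\<forall>\<psi>\<in>(\<lambda>b. blinfun_apply (f b)) ` E. \<psi> w = 0)"
      proof (rule common_zero_in_infinite_dimensional)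
        show "\<not> span (range s) \<subseteq> span T" if "finite T" for T
          using q that infinite_dimensional_span[of "range s" T] by (auto simp: Q_def)
      qed (use q in \<open>auto simp: Q_def blinfun.bounded_linear_right bounded_linear.linear\<close>)
      then show ?thesis by auto
    qed
    then have "\<forall>q\<in>Q a. \<exists>w. w \<in> span (range (fst q)) \<and> w \<noteq> 0 \<and> (\<forall>b\<in>snd q. blinfun_apply (f b) w = 0)"
      by fastforce
    from bchoice[OF this] obtain w where w': "\<forall>q\<in>Q a. w q \<in> span (range (fst q)) \<and> w q \<noteq> 0 \<and>
        (\<forall>b\<in>snd q. blinfun_apply (f b) (w q) = 0)" ..
    have w: "w (s, E) \<in> span (range s) \<and> w (s, E) \<noteq> 0 \<and> (\<forall>b\<in>E. blinfun_apply (f b) (w (s, E)) = 0)"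
      if "(s, E) \<in> Q a" for s E
      using bspec[OF w' that] by simp
    have "countable (Q a)"
    proof (rule countable_subset)
      show "Q a \<subseteq> (idx -` {b. (b, a) \<in> L}) \<times> {E. finite E \<and> E \<subseteq> {b. (b, a) \<in> L}}" by (auto simp: Q_def)
      have "countable (idx -` {b. (b, a) \<in> L})"
      proof (rule countable_image_inj_on)
        show "countable (idx ` (idx -` {b. (b, a) \<in> L}))"
          by (rule countable_subset[OF _ below[of a]]) auto
        show "inj_on idx (idx -` {b. (b, a) \<in> L})" using idx by (rule inj_on_subset) simp
      qed
      then show "countable ((idx -` {b. (b, a) \<in> L}) \<times> {E. finite E \<and> E \<subseteq> {b. (b, a) \<in> L}})"
        using countable_Collect_finite_subset[OF below] by (intro countable_SIGMA) auto
    qed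
    then have "countable (w ` Q a)" by simp
    moreover have "0 \<notin> w ` Q a" using w by force
    ultimately obtain z where z: "norm (z - coordinate a) < 1 / 4"
      "\<And>v. v \<in> w ` Q a \<Longrightarrow> blinfun_apply z v \<noteq> 0"
      using functional_avoiding_hyperplanes[of "w ` Q a" "1 / 4" "coordinate a"] by auto
    have "P f a z"
      unfolding P_def split_beta
    proof (intro conjI ballI)
      show "norm (z - coordinate a) \<le> 1 / 4" using z(1) by simp
      fix q assume q: "q \<in> Q a"
      show "\<exists>w\<in>span (range (fst q)). (\<forall>b\<in>snd q. blinfun_apply (f b) w = 0) \<and> blinfun_apply z w \<noteq> 0"
        using bspec[OF w' q] z(2)[OF imageI[OF q]] by blast
    qed
    then show "\<exists>z. P f a z" by blast
  qed
  then obtain \<phi> where "\<forall>a. P \<phi> a (\<phi> a)" ..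
  then show thesis by (intro that[of \<phi>]) (auto simp: P_def Q_def)
qed

locale perturbed_coordinates =
  fixes \<phi> :: "'g \<Rightarrow> 'g c0 \<Rightarrow>\<^sub>L real"
  assumes near: "norm (\<phi> a - coordinate a) \<le> 1 / 4"
begin

definition N :: "'g c0 \<Rightarrow> real" where
  "N x = (SUP a. \<bar>blinfun_apply (\<phi> a) x\<bar>)"

lemma deviation: "\<bar>blinfun_apply (\<phi> a) x - apply_c0 x a\<bar> \<le> norm x / 4"
proof -
  have "\<bar>blinfun_apply (\<phi> a - coordinate a) x\<bar> \<le> norm (\<phi> a - coordinate a) * norm x"
    using norm_blinfun[of "\<phi> a - coordinate a" x] by simp
  also have "\<dots> \<le> (1 / 4) * norm x" by (rule mult_right_mono[OF near]) simp
  finally show ?thesis by (simp add: blinfun.diff_left coordinate.rep_eq)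
qed

lemma functional_le: "\<bar>blinfun_apply (\<phi> a) x\<bar> \<le> 5 / 4 * norm x"
  using deviation[of a x] abs_le_norm_c0[of x a] by linarith

lemma N_upper: "\<bar>blinfun_apply (\<phi> a) x\<bar> \<le> N x"
  unfolding N_def by (intro cSUP_upper bdd_aboveI2[OF functional_le]) simp

lemma N_least: "(\<And>a. \<bar>blinfun_apply (\<phi> a) x\<bar> \<le> c) \<Longrightarrow> N x \<le> c"
  unfolding N_def by (intro cSUP_least) auto

lemma N_nonneg: "0 \<le> N x" using N_upper[of undefined x] by linarith

lemma norm_le_N: "3 / 4 * norm x \<le> N x"
proof -
  have "norm x \<le> N x + norm x / 4"
  proof (rule norm_c0_le)
    fix a
    show "\<bar>apply_c0 x a\<bar> \<le> N x + norm x / 4"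
      using deviation[of a x] N_upper[of a x] by linarith
  qed
  then show ?thesis by simp
qed

lemma N_scale: "N (r *\<^sub>R x) = \<bar>r\<bar> * N x"
proof (rule antisym)
  have le: "N (r *\<^sub>R x) \<le> \<bar>r\<bar> * N x" for r x
    using N_upper[of _ x] by (intro N_least) (simp add: blinfun.scaleR_right abs_mult mult_left_mono)
  show "N (r *\<^sub>R x) \<le> \<bar>r\<bar> * N x" by (rule le)
  show "\<bar>r\<bar> * N x \<le> N (r *\<^sub>R x)"
  proof (cases "r = 0")
    case False
    then show ?thesis using le[of "1 / r" "r *\<^sub>R x"] by (simp add: abs_mult field_simps)
  qed (simp add: N_nonneg)
qed

lemma equivalent_norm_N: "equivalent_norm N"
  unfolding equivalent_norm_def
proof (intro conjI allI)
  have upper: "N x \<le> 5 / 4 * norm x" for x by (rule N_least) (rule functional_le)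
  show "N x = 0 \<longleftrightarrow> x = 0" for x
    using norm_le_N[of x] upper[of x] N_nonneg[of x] by auto
  show "N (x + y) \<le> N x + N y" for x y
  proof (rule N_least)
    fix a
    show "\<bar>blinfun_apply (\<phi> a) (x + y)\<bar> \<le> N x + N y"
      using N_upper[of a x] N_upper[of a y] by (simp add: blinfun.add_right)
  qed
  show "N (r *\<^sub>R x) = \<bar>r\<bar> * N x" for r x by (rule N_scale)
  show "\<exists>a>0. \<exists>b>0. \<forall>x. a * norm x \<le> N x \<and> N x \<le> b * norm x"
    using norm_le_N upper by (intro exI[of _ "3 / 4"] exI[of _ "5 / 4"] conjI) auto
qed

text \<open>
  All but finitely many \<open>\<phi> a\<close> satisfy \<open>\<bar>\<phi> a x\<bar> \<le> 1 / 2\<close>. In a direction \<open>h\<close> annihilated by the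
  exceptional ones, \<open>N\<close> does not exceed 1 near \<open>x\<close>, so \<open>f h = 0\<close>. Thus \<open>f\<close> vanishes on the common
  kernel of finitely many \<open>\<phi> a\<close>. The constants work because \<open>norm x \<le> 4 / 3\<close>.
\<close>

lemma norm_attaining_finite_combination:
  assumes f: "linear f" and le: "\<And>v. \<bar>f v\<bar> \<le> N v" and x: "N x = 1" "f x = 1"
  obtains E c where "finite E" "\<And>a. a \<in> E \<Longrightarrow> c a \<noteq> 0"
    "\<And>v. f v = (\<Sum>a\<in>E. c a * blinfun_apply (\<phi> a) v)"
proof -
  define F where "F = {a. 1 / 2 < \<bar>blinfun_apply (\<phi> a) x\<bar>}"
  have "norm x \<le> 4 / 3" using norm_le_N[of x] x by simp
  have "F \<subseteq> {a. 1 / 6 \<le> \<bar>apply_c0 x a\<bar>}"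
  proof
    fix a assume "a \<in> F"
    then have "1 / 2 < \<bar>blinfun_apply (\<phi> a) x\<bar>" by (simp add: F_def)
    then show "a \<in> {a. 1 / 6 \<le> \<bar>apply_c0 x a\<bar>}"
      using deviation[of a x] \<open>norm x \<le> 4 / 3\<close> unfolding mem_Collect_eq by linarith
  qed
  moreover have "finite {a. 1 / 6 \<le> \<bar>apply_c0 x a\<bar>}" by (rule finite_large_coordinates) simp
  ultimately have F: "finite F" by (rule finite_subset)
  have kernel: "f h = 0" if h: "\<And>a. a \<in> F \<Longrightarrow> blinfun_apply (\<phi> a) h = 0" for h
  proof -
    have le0: "t * f h \<le> 0" if t: "\<bar>t\<bar> * N h \<le> 1 / 2" for t
    proof -
      have "N (x + t *\<^sub>R h) \<le> 1"
      proof (rule N_least)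
        fix a
        show "\<bar>blinfun_apply (\<phi> a) (x + t *\<^sub>R h)\<bar> \<le> 1"
        proof (cases "a \<in> F")
          case True
          then show ?thesis using h N_upper[of a x] x by (simp add: blinfun.add_right blinfun.scaleR_right)
        next
          case False
          have "\<bar>t * blinfun_apply (\<phi> a) h\<bar> \<le> 1 / 2"
            using mult_left_mono[OF N_upper[of a h], of "\<bar>t\<bar>"] t by (simp add: abs_mult)
          moreover have "\<bar>blinfun_apply (\<phi> a) x\<bar> \<le> 1 / 2" using False by (simp add: F_def)
          ultimately show ?thesis by (simp add: blinfun.add_right blinfun.scaleR_right)
        qed
      qed
      then have "f (x + t *\<^sub>R h) \<le> 1" using le[of "x + t *\<^sub>R h"] by linarith
      then show ?thesis using x by (simp add: linear_add[OF f] linear_scale[OF f])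
    qed
    (* small enough that the functionals outside F stay below 1/2 + 1/2 *)
    define t where "t = 1 / (2 * (N h + 1))"
    have t: "0 < t" "t * N h \<le> 1 / 2" using N_nonneg[of h] by (simp_all add: t_def field_simps)
    then have "t * f h \<le> 0" "- t * f h \<le> 0" using le0[of t] le0[of "- t"] by simp_all
    then have "t * f h = 0" by simp
    then show ?thesis using t(1) by simp
  qed
  have "\<exists>c. \<forall>v\<in>UNIV. f v = (\<Sum>a\<in>F. c a * blinfun_apply (\<phi> a) v)"
  proof (rule in_span_of_common_kernel[where u = "\<lambda>a. blinfun_apply (\<phi> a)", OF F])
    fix w z c
    show "\<exists>y\<in>UNIV. f y = f w - c * f z \<and>
        (\<forall>a\<in>F. blinfun_apply (\<phi> a) y = blinfun_apply (\<phi> a) w - c * blinfun_apply (\<phi> a) z)"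
      by (intro bexI[of _ "w - c *\<^sub>R z"])
        (simp_all add: linear_diff[OF f] linear_scale[OF f] blinfun.diff_right blinfun.scaleR_right)
  qed (rule kernel)
  then obtain c where c: "\<And>v. f v = (\<Sum>a\<in>F. c a * blinfun_apply (\<phi> a) v)" by blast
  show thesis
  proof (rule that[of "{a \<in> F. c a \<noteq> 0}" c])
    show "f v = (\<Sum>a\<in>{a \<in> F. c a \<noteq> 0}. c a * blinfun_apply (\<phi> a) v)" for v
      unfolding c using F by (intro sum.mono_neutral_right) auto
  qed (use F in auto)
qed

end

text \<open>
  Fix a sequence \<open>t\<close> of distinct vectors of the system. The functional \<open>f a\<close> of any other member vanishes
  on it, so genericity confines the finite set \<open>E a\<close> of \<open>\<phi> b\<close> that represents \<open>f a\<close> to the countable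
  set \<open>C\<close> of stages up to the index of \<open>t\<close>. Infinitely many members share the same \<open>E a\<close>, but the
  span of their vectors contains a nonzero vector annihilated by it.
\<close>

theorem c0_renorming_without_uncountable_auerbach:
  assumes CH: "|UNIV :: real set| =o cardSuc natLeq"
  shows "\<exists>N :: omega1 c0 \<Rightarrow> real. equivalent_norm N \<and>
    \<not> (\<exists>(\<Gamma> :: omega1 c0 set) x f.
         auerbach_system (scaleR :: real \<Rightarrow> omega1 c0 \<Rightarrow> omega1 c0) N UNIV \<Gamma> x f \<and> uncountable \<Gamma>)"
proof -
  obtain idx :: "(nat \<Rightarrow> omega1 c0) \<Rightarrow> omega1" where idx: "inj idx" using CH_index[OF CH] by blast
  obtain L :: "(omega1 \<times> omega1) set" where L: "wf L" "trans L" "total_on UNIV L"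
    and seg: "\<And>a. a \<in> UNIV \<Longrightarrow> |{b. (b, a) \<in> L}| <o |UNIV :: omega1 set|"
    by (rule cardinal_well_ordering[of UNIV], rule that)
  have below: "countable {b. (b, a) \<in> L}" for a
  proof -
    have "|{b. (b, a) \<in> L}| <o cardSuc natLeq"
      by (rule ordLess_ordIso_trans[OF seg[OF UNIV_I] card_omega1])
    then show ?thesis
      unfolding countable_card_le_natLeq
      using cardSuc_ordLeq_ordLess[OF natLeq_Card_order card_of_Card_order] by blast
  qed
  obtain \<phi> :: "omega1 \<Rightarrow> omega1 c0 \<Rightarrow>\<^sub>L real" where near: "\<And>a. norm (\<phi> a - coordinate a) \<le> 1 / 4"
    and generic: "\<And>a s E. (idx s, a) \<in> L \<Longrightarrow> infinite_dimensional (range s) \<Longrightarrow> finite E \<Longrightarrow>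
       E \<subseteq> {b. (b, a) \<in> L} \<Longrightarrow>
       \<exists>w\<in>span (range s). (\<forall>b\<in>E. blinfun_apply (\<phi> b) w = 0) \<and> blinfun_apply (\<phi> a) w \<noteq> 0"
    by (rule generic_functionals[OF L(1) below idx], rule that)
  interpret perturbed_coordinates \<phi> by unfold_locales (rule near)
  have False if A: "auerbach_system (scaleR :: real \<Rightarrow> omega1 c0 \<Rightarrow> omega1 c0) N UNIV \<Gamma> x f"
    and unc: "uncountable \<Gamma>" for \<Gamma> :: "omega1 c0 set" and x f
  proof -
    have bi: "f a (x b) = (if a = b then 1 else 0)" if "a \<in> \<Gamma>" "b \<in> \<Gamma>" for a b
      using A that by (auto simp: auerbach_system_def biorthogonal_system_def)
    have fD: "f a \<in> dual_space scaleR N UNIV" "N (x a) = 1" "dual_norm N UNIV (f a) = 1" if "a \<in> \<Gamma>" for a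
      using A that by (auto simp: auerbach_system_def biorthogonal_system_def)
    have lin: "linear (f a)" if "a \<in> \<Gamma>" for a
      using fD(1)[OF that] by (intro linearI) (auto simp: dual_space_def)
    have le: "\<bar>f a v\<bar> \<le> N v" if a: "a \<in> \<Gamma>" for a v
    proof -
      obtain B where B: "\<And>v. \<bar>f a v\<bar> \<le> B * N v" using fD(1)[OF a] by (auto simp: dual_space_def)
      show ?thesis
      proof (cases "N v = 0")
        case True
        then show ?thesis using B[of v] by simp
      next
        case False
        then have pos: "0 < N v" using N_nonneg[of v] by simp
        have "bdd_above ((\<lambda>v. norm (f a v)) ` {v \<in> UNIV. N v \<le> 1})"
        proof (rule bdd_aboveI2)
          fix v :: "omega1 c0" assume "v \<in> {v \<in> UNIV. N v \<le> 1}"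
          then have "N v \<le> 1" by simp
          then have "B * N v \<le> \<bar>B\<bar> * 1" using N_nonneg[of v] by (intro mult_mono) auto
          then show "norm (f a v) \<le> \<bar>B\<bar>" using B[of v] by simp
        qed
        moreover have "N ((1 / N v) *\<^sub>R v) = 1" using pos by (simp add: N_scale)
        ultimately have "norm (f a ((1 / N v) *\<^sub>R v)) \<le> dual_norm N UNIV (f a)"
          unfolding dual_norm_def by (intro cSUP_upper) auto
        then show ?thesis
          using fD(3)[OF a] pos by (simp add: linear_scale[OF lin[OF a]] field_simps)
      qed
    qed
    have "\<exists>E c. finite E \<and> (\<forall>b\<in>E. c b \<noteq> 0) \<and> (\<forall>v. f a v = (\<Sum>b\<in>E. c b * blinfun_apply (\<phi> b) v))"
      if a: "a \<in> \<Gamma>" for a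
    proof -
      obtain E c where "finite E" "\<And>b. b \<in> E \<Longrightarrow> c b \<noteq> 0" "\<And>v. f a v = (\<Sum>b\<in>E. c b * blinfun_apply (\<phi> b) v)"
        using norm_attaining_finite_combination[OF lin[OF a] le[OF a] fD(2)[OF a]] bi[OF a a] by auto
      then show ?thesis by blast
    qed
    then obtain E c where E: "\<And>a. a \<in> \<Gamma> \<Longrightarrow> finite (E a)" "\<And>a b. a \<in> \<Gamma> \<Longrightarrow> b \<in> E a \<Longrightarrow> c a b \<noteq> 0"
      and fE: "\<And>a v. a \<in> \<Gamma> \<Longrightarrow> f a v = (\<Sum>b\<in>E a. c a b * blinfun_apply (\<phi> b) v)" by metis
    have "infinite \<Gamma>" using unc countable_finite by blast
    then obtain s :: "nat \<Rightarrow> omega1 c0" where s: "inj s" "range s \<subseteq> \<Gamma>"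
      using infinite_countable_subset by blast
    define t where "t n = x (s n)" for n
    have rt: "range t = x ` range s" by (auto simp: t_def)
    have inft: "infinite_dimensional (range t)"
      unfolding rt
    proof (rule biorthogonal_infinite_dimensional)
      show "infinite (range s)" using s(1) by (rule range_inj_infinite)
    qed (use s(2) bi lin in \<open>blast+\<close>)
    define C where "C = insert (idx t) {b. (b, idx t) \<in> L}"
    have C: "countable C" using below by (simp add: C_def)
    have EC: "E a \<subseteq> C" if a: "a \<in> \<Gamma> - range s" for a
    proof (rule ccontr)
      assume "\<not> E a \<subseteq> C"
      then obtain b where b: "b \<in> E a" "b \<notin> C" by blast
      then have bL: "(idx t, b) \<in> L" using L(3) by (auto simp: C_def total_on_def)
      have a\<Gamma>: "a \<in> \<Gamma>" using a by blast
      obtain m where m: "m \<in> E a" "\<forall>b\<in>E a. b = m \<or> (b, m) \<in> L"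
        using finite_total_greatest[OF E(1)[OF a\<Gamma>] _ subset_UNIV L(2,3)] b(1) by blast
      have mL: "(idx t, m) \<in> L" using m(2) b(1) bL L(2) by (auto dest: transD)
      obtain w where w: "w \<in> span (range t)" "\<forall>b\<in>E a - {m}. blinfun_apply (\<phi> b) w = 0"
        "blinfun_apply (\<phi> m) w \<noteq> 0"
        using generic[OF mL inft, of "E a - {m}"] E(1)[OF a\<Gamma>] m(2) by auto
      have "f a v = 0" if "v \<in> range t" for v
        using that a s(2) bi[OF a\<Gamma>] by (auto simp: t_def subset_iff)
      then have "f a w = 0" using linear_eq_0_on_span[OF lin[OF a\<Gamma>] _ w(1)] by blast
      moreover have "f a w = c a m * blinfun_apply (\<phi> m) w"
        unfolding fE[OF a\<Gamma>] using E(1)[OF a\<Gamma>] m(1) w(2) by (simp add: sum.remove)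
      ultimately show False using E(2)[OF a\<Gamma> m(1)] w(3) by simp
    qed
    have "\<exists>F. infinite {a \<in> \<Gamma> - range s. E a = F}"
    proof (rule ccontr)
      assume none: "\<not> ?thesis"
      have "\<Gamma> - range s \<subseteq> (\<Union>F\<in>{F. finite F \<and> F \<subseteq> C}. {a \<in> \<Gamma> - range s. E a = F})"
        using EC E(1) by auto
      moreover have "countable (\<Union>F\<in>{F. finite F \<and> F \<subseteq> C}. {a \<in> \<Gamma> - range s. E a = F})"
        using none by (intro countable_UN countable_Collect_finite_subset[OF C] countable_finite) blast
      ultimately have "countable (\<Gamma> - range s)" by (rule countable_subset)
      then show False using unc by (simp add: uncountable_minus_countable)
    qed
    then obtain F where infG: "infinite {a \<in> \<Gamma> - range s. E a = F}" ..
    define G where "G = {a \<in> \<Gamma> - range s. E a = F}"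
    have G: "a \<in> \<Gamma>" "E a = F" if "a \<in> G" for a using that by (auto simp: G_def)
    have "G \<noteq> {}" using infG unfolding G_def by (metis finite.emptyI)
    then obtain a0 where "a0 \<in> G" by blast
    then have finF: "finite F" using E(1)[OF G(1)] G(2) by auto
    have infdim: "infinite_dimensional (x ` G)"
    proof (rule biorthogonal_infinite_dimensional)
      show "linear (f a)" if "a \<in> G" for a by (rule lin[OF G(1)[OF that]])
      show "infinite G" using infG by (simp add: G_def)
      show "f a (x b) = (if a = b then 1 else 0)" if "a \<in> G" "b \<in> G" for a b
        by (rule bi[OF G(1)[OF that(1)] G(1)[OF that(2)]])
    qed
    have "\<exists>w\<in>span (x ` G). w \<noteq> 0 \<and> (\<forall>\<psi>\<in>(\<lambda>b. blinfun_apply (\<phi> b)) ` F. \<psi> w = 0)"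
    proof (rule common_zero_in_infinite_dimensional)
      show "\<not> span (x ` G) \<subseteq> span T" if "finite T" for T
        using infinite_dimensional_span[OF infdim that] .
    qed (use finF in \<open>auto simp: blinfun.bounded_linear_right bounded_linear.linear\<close>)
    then obtain w where w: "w \<in> span (x ` G)" "w \<noteq> 0" "\<And>b. b \<in> F \<Longrightarrow> blinfun_apply (\<phi> b) w = 0" by auto
    have fw: "f a w = 0" if "a \<in> G" for a
      unfolding fE[OF G(1)[OF that]] G(2)[OF that] using w(3) by simp
    obtain u r where u: "finite u" "u \<subseteq> x ` G" "w = (\<Sum>v\<in>u. r v *\<^sub>R v)"
      using w(1) unfolding span_explicit by blast
    have "r v = 0" if v: "v \<in> u" for v
    proof -
      obtain a where a: "a \<in> G" "v = x a" using v u(2) by blast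
      have "f a (\<Sum>v\<in>u. r v *\<^sub>R v) = r (x a)"
        using a v u(1,2) lin bi G(1) by (intro biorthogonal_coefficient[of f a G]) auto
      then show ?thesis using fw[OF a(1)] a(2) u(3) by simp
    qed
    then have "w = 0" using u(3) by simp
    then show False using w(2) by simp
  qed
  then show ?thesis using equivalent_norm_N by blast
qed


section \<open>Auerbach systems in WLD spaces and in renormings\<close>

theorem theoremC:
  shows
    "(WLD (scaleR :: real \<Rightarrow> 'a::banach \<Rightarrow> 'a) \<and> cardSuc natLeq <o dens (UNIV :: 'a set) \<longrightarrow>
        (\<exists>Y :: 'a set. closed_subspace (scaleR :: real \<Rightarrow> 'a \<Rightarrow> 'a) Y \<and>
           (\<exists>(\<Gamma> :: 'a set) x f. auerbach_basis (scaleR :: real \<Rightarrow> 'a \<Rightarrow> 'a) Y \<Gamma> x f) \<and>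
           dens Y =o dens (UNIV :: 'a set)))
     \<and>
     (\<forall>smul :: complex \<Rightarrow> 'b::banach \<Rightarrow> 'b.
        banach_space_over smul \<and> WLD smul \<and> cardSuc natLeq <o dens (UNIV :: 'b set) \<longrightarrow>
        (\<exists>Y :: 'b set. closed_subspace smul Y \<and>
           (\<exists>(\<Gamma> :: 'b set) x f. auerbach_basis smul Y \<Gamma> x f) \<and>
           dens Y =o dens (UNIV :: 'b set)))
     \<and>
     ( |UNIV :: real set| =o cardSuc natLeq \<longrightarrow>
        (\<exists>N :: omega1 c0 \<Rightarrow> real. equivalent_norm N \<and>
           \<not> (\<exists>(\<Gamma> :: omega1 c0 set) x f.
                auerbach_system (scaleR :: real \<Rightarrow> omega1 c0 \<Rightarrow> omega1 c0) N UNIV \<Gamma> x f \<and>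
                uncountable \<Gamma>)))"
proof (intro conjI impI allI, goal_cases)
  case 1
  then interpret banach_space_re "scaleR :: real \<Rightarrow> 'a \<Rightarrow> 'a" id "{1, -1}"
    by (intro banach_space_re_real)
  show ?case using 1 by (intro WLD_large_auerbach_subspace) auto
next
  case (2 smul)
  then interpret banach_space_re smul Re "{1, -1, \<i>}"
    by (intro banach_space_re_complex) auto
  show ?case using 2 by (intro WLD_large_auerbach_subspace) auto
next
  case 3
  then show ?case by (rule c0_renorming_without_uncountable_auerbach)
qed

end
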